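(* Let $\mathcal{D}$ be a classical billiard table, let $\varepsilon>0$, and let $\nu_\varepsilon=\rho\,d\mathbf{m}$ be a noise distribution on $\mathbb{R}^2$ whose density $\rho$ has support containing the ball $B_\varepsilon(0,0)$. Let $P$ be the Markov transition function on the collision space $M$ of $\mathcal{D}$ obtained by applying the billiard map $F$ and then the random perturbation with law $\nu_\varepsilon$. Then the resulting random billiard is ergodic, i.e. the probability measure $m$ (given by $dm=\frac{1}{2|\partial\mathcal{D}|}\,dr\,ds$) is ergodic with respect to $P$.
   Context: Classical billiard table. A table $\mathcal{D}\subset\mathbb{R}^2$ is called classical if it is compact, its interior $\mathcal{D}_0$ is a bounded connected open domain, and $\partial\mathcal{D}=\Gamma_1\cup\dots\cup\Gamma_n$, $n\ge 1$, where each $\Gamma_i$ is a simple closed curve given by a piecewise $C^3$ map $\gamma_i:[a_i,b_i]\to\mathbb{R}^2$ which is injective on $[a_i,b_i)$, with $\gamma_i(a_i)=\gamma_i(b_i)$, and the sets $\gamma_i((a_i,b_i))$ are pairwise disjoint. Each $\gamma_i$ is parametrized by arclength and oriented so that $\mathcal{D}_0$ lies on its left. Billiard map. A point particle moves in $\mathcal{D}_0$ with constant velocity and reflects at the smooth part of the boundary by $v^+=v^--2(v^-,n)n$, $n$ the inward unit normal. A collision is described by $(r,s)$, where $r$ is the arclength parameter of the collision point and $s=\sin\varphi$, with $\varphi\in[-\pi/2,\pi/2]$ the signed angle from the post-collisional velocity $v$ to $n$. Let $R_i=[a_i,b_i]\times[-1,1]$ and let $M_i$ be the cylinder obtained from $R_i$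 by identifying the edges $\{r=a_i\}$ and $\{r=b_i\}$. The collision space is $M=M_1\cup\dots\cup M_n$ (disjoint union) with Borel $\sigma$-algebra $\mathcal{B}$, and $F:M\to M$ is the billiard map sending a collision $(r,s)$ to the next collision $(r_1,s_1)$. It is defined $m$-almost everywhere and is a $C^2$ diffeomorphism onto its image off the singular set $S_1$ of points whose trajectory hits a corner or is tangent to a dispersing wall. It preserves the probability measure $dm=\frac{1}{2|\partial\mathcal{D}|}\,dr\,ds$, where $|\partial\mathcal{D}|$ is the total length of $\partial\mathcal{D}$. Random perturbation. Fix $\varepsilon>0$ and a probability measure $\nu_\varepsilon$ on $\mathbb{R}^2$ with $d\nu_\varepsilon=\rho\,d\mathbf{m}$, $\mathbf{m}$ Lebesgue measure, where $\rho$ is measurable and its support contains the ball $B_\varepsilon(0,0)$ of radius $\varepsilon$ about the origin, meaning that $\rho$ is positive on this ball. Let $\Lambda_i=(b_i-a_i)\mathbb{Z}\times 2\mathbb{Z}$. For $x\in M_i$ and measurable $B\subset M_i$ put $\eta_\varepsilon^x(B)=\nu_\varepsilon\{u\in\mathbb{R}^2: u+x\in B \bmod \Lambda_i\}=\int_B\sum_{v\in\Lambda_i}\rho(u-x-v)\,\mathbf{m}(du)$ (and $\eta^x_\varepsilon(M_j)=0$ for $j\ne i$). The Markov transition function is $P(x,B)=\eta_\varepsilon^{F(x)}(B)$ for $m$-a.e. $x\in M$ and $B\in\mathcal{B}$. Ergodicity. A probability measure $\mu$ on $M$ is invariant with respect to $P$ if $\mu(B)=\int_M P(x,B)\,\mu(dx)$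 for all $B\in\mathcal{B}$. Let $\Omega$ be the space of sequences $\omega=(x_0,x_1,\dots)$ in $M$ with product $\sigma$-algebra $\mathcal{A}$, shift $\theta(x_0,x_1,\dots)=(x_1,x_2,\dots)$, and let $\mathbf{P}_\mu$ be the law on $\Omega$ of the Markov process with transition function $P$ and initial distribution $\mu$. An invariant measure $\mu$ is ergodic with respect to $P$ if $A\in\mathcal{A}$, $\theta^{-1}(A)=A$ implies $\mathbf{P}_\mu(A)\in\{0,1\}$. *)

theory Defs
  imports "HOL-Probability.Probability"
begin

section \<open>Markov chains and ergodicity\<close>

text \<open>A transition function \<open>P(x, B)\<close> is a measurable map into the space of probability measures;
  \<open>P(x, B)\<close> is written \<open>emeasure (P x) B\<close>.\<close>

definition markov_kernel :: "'a measure \<Rightarrow> ('a \<Rightarrow> 'a measure) \<Rightarrow> bool" where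
  "markov_kernel M P \<longleftrightarrow> P \<in> M \<rightarrow>\<^sub>M prob_algebra M"

definition invariant_measure :: "'a measure \<Rightarrow> ('a \<Rightarrow> 'a measure) \<Rightarrow> 'a measure \<Rightarrow> bool" where
  "invariant_measure M P \<mu> \<longleftrightarrow>
     prob_space \<mu> \<and> sets \<mu> = sets M \<and>
     (\<forall>B\<in>sets M. emeasure \<mu> B = (\<integral>\<^sup>+x. emeasure (P x) B \<partial>\<mu>))"

text \<open>Conditional law of \<open>x\<^sub>n\<close> given \<open>x\<^sub>0, \<dots>, x\<^bsub>n-1\<^esub>\<close>; the law of the chain on the sequence space is
  then the Ionescu-Tulcea limit of these steps.\<close>

definition markov_step :: "('a \<Rightarrow> 'a measure) \<Rightarrow> 'a measure \<Rightarrow> nat \<Rightarrow> (nat \<Rightarrow> 'a) \<Rightarrow> 'a measure" where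
  "markov_step P \<mu> n \<omega> = (case n of 0 \<Rightarrow> \<mu> | Suc k \<Rightarrow> P (\<omega> k))"

definition markov_law :: "'a measure \<Rightarrow> ('a \<Rightarrow> 'a measure) \<Rightarrow> 'a measure \<Rightarrow> (nat \<Rightarrow> 'a) measure" where
  "markov_law M P \<mu> =
     projective_family.lim UNIV (Ionescu_Tulcea.CI (markov_step P \<mu>) (\<lambda>_. M)) (\<lambda>_. M)"

text \<open>The library construction does apply to a kernel and an initial distribution.\<close>

lemma Ionescu_Tulcea_markov_step:
  assumes P: "markov_kernel M P" and mu: "prob_space \<mu>" "sets \<mu> = sets M"
  shows "Ionescu_Tulcea (markov_step P \<mu>) (\<lambda>_. M)"
proof (rule Ionescu_Tulcea.intro)
  have P': "P \<in> M \<rightarrow>\<^sub>M subprob_algebra M"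
    using P by (simp add: markov_kernel_def measurable_prob_algebraD)
  have mu': "\<mu> \<in> space (subprob_algebra M)"
    using mu by (simp add: space_subprob_algebra prob_space_imp_subprob_space)
  show "markov_step P \<mu> i \<in> PiM {0..<i} (\<lambda>_. M) \<rightarrow>\<^sub>M subprob_algebra M" for i
  proof (cases i)
    case 0
    then have "markov_step P \<mu> i = (\<lambda>_. \<mu>)"
      by (simp add: markov_step_def fun_eq_iff)
    then show ?thesis using mu' by simp
  next
    case (Suc k)
    then have "markov_step P \<mu> i = (\<lambda>\<omega>. P (\<omega> k))"
      by (simp add: markov_step_def fun_eq_iff)
    moreover have "(\<lambda>\<omega>. \<omega> k) \<in> PiM {0..<i} (\<lambda>_. M) \<rightarrow>\<^sub>M M"
      by (rule measurable_component_singleton) (simp add: Suc)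
    ultimately show ?thesis
      using measurable_compose[OF _ P'] by simp
  qed
  fix i and x :: "nat \<Rightarrow> 'a"
  assume x: "x \<in> space (PiM {0..<i} (\<lambda>_. M))"
  show "prob_space (markov_step P \<mu> i x)"
  proof (cases i)
    case 0
    then show ?thesis using mu by (simp add: markov_step_def)
  next
    case (Suc k)
    then have "x k \<in> space M"
      using x by (auto simp: space_PiM PiE_iff)
    then have "P (x k) \<in> space (prob_algebra M)"
      using P unfolding markov_kernel_def by (rule measurable_space[rotated])
    then show ?thesis
      by (simp add: Suc markov_step_def space_prob_algebra)
  qed
qed

definition seq_shift :: "(nat \<Rightarrow> 'a) \<Rightarrow> nat \<Rightarrow> 'a" where
  "seq_shift \<omega> = (\<lambda>n. \<omega> (Suc n))"

definition ergodic_measure :: "'a measure \<Rightarrow> ('a \<Rightarrow> 'a measure) \<Rightarrow> 'a measure \<Rightarrow> bool" where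
  "ergodic_measure M P \<mu> \<longleftrightarrow>
     invariant_measure M P \<mu> \<and>
     (\<forall>A\<in>sets (PiM UNIV (\<lambda>_. M)).
        seq_shift -` A \<inter> space (PiM UNIV (\<lambda>_. M)) = A \<longrightarrow>
        emeasure (markov_law M P \<mu>) A \<in> {0, 1})"

section \<open>Classical billiard tables\<close>

type_synonym plane = "real \<times> real"

text \<open>Derivatives are taken within \<open>S\<close>, so on a compact interval they are one-sided at the end
  points.\<close>

primrec Ck_on :: "nat \<Rightarrow> (real \<Rightarrow> 'a::real_normed_vector) \<Rightarrow> real set \<Rightarrow> bool" where
  "Ck_on 0 f S \<longleftrightarrow> continuous_on S f"
| "Ck_on (Suc k) f S \<longleftrightarrow>
     (\<exists>f'. (\<forall>x\<in>S. (f has_vector_derivative f' x) (at x within S)) \<and> Ck_on k f' S)"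

text \<open>There are finitely many break points between which \<open>f\<close> is \<open>C\<^sup>k\<close> up to and including the
  ends.\<close>

definition piecewise_Ck_on :: "nat \<Rightarrow> (real \<Rightarrow> 'a::real_normed_vector) \<Rightarrow> real \<Rightarrow> real \<Rightarrow> bool" where
  "piecewise_Ck_on k f a b \<longleftrightarrow>
     continuous_on {a..b} f \<and>
     (\<exists>S. finite S \<and>
        (\<forall>c d. a \<le> c \<and> c < d \<and> d \<le> b \<and> {c<..<d} \<inter> S = {} \<longrightarrow> Ck_on k f {c..d}))"

text \<open>A table together with its boundary parametrization: the boundary curves are
  \<open>wall T i\<close> on \<open>{lo T i..hi T i}\<close> for \<open>i < ncurves T\<close>.\<close>

record billiard_table =
  region :: "plane set"
  ncurves :: nat
  lo :: "nat \<Rightarrow> real"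
  hi :: "nat \<Rightarrow> real"
  wall :: "nat \<Rightarrow> real \<Rightarrow> plane"

definition smooth_point :: "billiard_table \<Rightarrow> nat \<Rightarrow> real \<Rightarrow> bool" where
  "smooth_point T i r \<longleftrightarrow> i < ncurves T \<and>
     (\<exists>c d. lo T i \<le> c \<and> c < r \<and> r < d \<and> d \<le> hi T i \<and> Ck_on 3 (wall T i) {c..d})"

definition tangent :: "billiard_table \<Rightarrow> nat \<Rightarrow> real \<Rightarrow> plane" where
  "tangent T i r = vector_derivative (wall T i) (at r)"

text \<open>The tangent rotated by a quarter turn to the left; this is the inward normal once the table
  lies on the left of its boundary curves.\<close>

definition normal :: "billiard_table \<Rightarrow> nat \<Rightarrow> real \<Rightarrow> plane" where
  "normal T i r = (- snd (tangent T i r), fst (tangent T i r))"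

text \<open>In the orientation condition finitely many parameters of each curve are exempt, because the
  base point of one curve is allowed to lie on another curve, and the normal may fail there
  to point into the interior.\<close>

definition classical_table :: "billiard_table \<Rightarrow> bool" where
  "classical_table T \<longleftrightarrow>
     compact (region T) \<and>
     connected (interior (region T)) \<and> interior (region T) \<noteq> {} \<and>
     1 \<le> ncurves T \<and>
     frontier (region T) = (\<Union>i<ncurves T. wall T i ` {lo T i..hi T i}) \<and>
     (\<forall>i<ncurves T.
        lo T i < hi T i \<and>
        piecewise_Ck_on 3 (wall T i) (lo T i) (hi T i) \<and>
        inj_on (wall T i) {lo T i..<hi T i} \<and>
        wall T i (lo T i) = wall T i (hi T i) \<and>
        (\<forall>r. smooth_point T i r \<longrightarrow> norm (tangent T i r) = 1) \<and>
        finite {r. smooth_point T i r \<and>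
          \<not> (\<forall>\<^sub>F t in at_right 0. wall T i r + t *\<^sub>R normal T i r \<in> interior (region T))}) \<and>
     disjoint_family_on (\<lambda>i. wall T i ` {lo T i<..<hi T i}) {..<ncurves T}"

section \<open>The collision space and the billiard map\<close>

text \<open>A collision is \<open>(i, r, s)\<close> with \<open>i\<close> the number of the boundary curve. The half-open
  \<open>r\<close>-interval represents the cylinder obtained by identifying \<open>r = lo T i\<close> and \<open>r = hi T i\<close>;
  the Borel sets of the cylinder and of this set of representatives are the same.\<close>

type_synonym collision = "nat \<times> real \<times> real"

definition collisions :: "billiard_table \<Rightarrow> collision set" where
  "collisions T = {(i, r, s). i < ncurves T \<and> lo T i \<le> r \<and> r < hi T i \<and> -1 \<le> s \<and> s \<le> 1}"

definition collision_space :: "billiard_table \<Rightarrow> collision measure" where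
  "collision_space T = restrict_space borel (collisions T)"

definition perimeter :: "billiard_table \<Rightarrow> real" where
  "perimeter T = (\<Sum>i<ncurves T. hi T i - lo T i)"

definition billiard_measure :: "billiard_table \<Rightarrow> collision measure" where
  "billiard_measure T =
     scale_measure (ennreal (1 / (2 * perimeter T)))
       (restrict_space (count_space UNIV \<Otimes>\<^sub>M lborel) (collisions T))"

text \<open>For unit vectors this is the sine of the signed angle from \<open>u\<close> to \<open>w\<close>.\<close>

definition sin_angle :: "plane \<Rightarrow> plane \<Rightarrow> real" where
  "sin_angle u w = fst u * snd w - snd u * fst w"

text \<open>The unit vector \<open>v\<close> with \<open>v \<bullet> n = cos \<phi>\<close> and \<open>sin_angle v n = sin \<phi>\<close>, where \<open>n\<close> is the normal,
  \<open>s = sin \<phi>\<close> and \<open>\<phi> \<in> [-\<pi>/2, \<pi>/2]\<close>.\<close>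

definition out_velocity :: "billiard_table \<Rightarrow> collision \<Rightarrow> plane" where
  "out_velocity T = (\<lambda>(i, r, s). sqrt (1 - s\<^sup>2) *\<^sub>R normal T i r + s *\<^sub>R tangent T i r)"

definition reflect :: "plane \<Rightarrow> plane \<Rightarrow> plane" where
  "reflect v n = v - (2 * (v \<bullet> n)) *\<^sub>R n"

text \<open>The particle leaves the boundary at \<open>x\<close>, crosses the interior of the table and first meets the
  boundary again at \<open>y\<close>. Trajectories that hit a point where the boundary is not smooth, or hit the
  boundary tangentially, have no next collision.\<close>

definition next_collision :: "billiard_table \<Rightarrow> collision \<Rightarrow> collision \<Rightarrow> bool" where
  "next_collision T = (\<lambda>(i, r, s) (j, r', s').
     -1 \<le> s \<and> s \<le> 1 \<and> smooth_point T i r \<and> smooth_point T j r' \<and>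
     (let v = out_velocity T (i, r, s) in
        (\<exists>t>0. wall T i r + t *\<^sub>R v = wall T j r' \<and>
           (\<forall>u. 0 < u \<and> u < t \<longrightarrow> wall T i r + u *\<^sub>R v \<in> interior (region T))) \<and>
        v \<bullet> normal T j r' \<noteq> 0 \<and>
        s' = sin_angle (reflect v (normal T j r')) (normal T j r')))"

text \<open>The next collision is unique if it exists; otherwise the value is unspecified.\<close>

definition billiard_map :: "billiard_table \<Rightarrow> collision \<Rightarrow> collision" where
  "billiard_map T x = (THE y. next_collision T x y)"

section \<open>The random perturbation\<close>

definition wrap_lattice :: "billiard_table \<Rightarrow> nat \<Rightarrow> plane set" where
  "wrap_lattice T i = {(of_int k * (hi T i - lo T i), of_int l * 2) | k l. True}"

text \<open>\<open>noise T \<nu> x B\<close> is the probability that \<open>u + x\<close> lies in \<open>B\<close> modulo the lattice of the component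
  of \<open>x\<close>; the other components carry no mass.\<close>

definition noise :: "billiard_table \<Rightarrow> plane measure \<Rightarrow> collision \<Rightarrow> collision set \<Rightarrow> ennreal" where
  "noise T \<nu> = (\<lambda>(i, x) B. emeasure \<nu> {u. \<exists>v\<in>wrap_lattice T i. (i, u + x + v) \<in> B})"

definition random_billiard ::
    "billiard_table \<Rightarrow> plane measure \<Rightarrow> (collision \<Rightarrow> collision measure) \<Rightarrow> bool" where
  "random_billiard T \<nu> P \<longleftrightarrow>
     markov_kernel (collision_space T) P \<and>
     (AE x in billiard_measure T.
        \<forall>B\<in>sets (collision_space T). emeasure (P x) B = noise T \<nu> (billiard_map T x) B)"

end

theory Submission
  imports Defs
begin

text \<open>Stationarity: parametrize collisions by chords. In the coordinates \<open>(r, r')\<close> of the two end points the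
  measure \<open>dr ds\<close> has the density \<open>(v \<bullet> n) \<bar>v \<bullet> n'\<bar> / L\<close>, which is symmetric in the end points, so that
  following a chord preserves \<open>dr ds\<close>; adding the noise preserves it by translation invariance.

  Ergodicity: a shift-invariant event has the conditional probabilities \<open>k (x\<^sub>n)\<close> for a function \<open>k\<close> of
  the state. By stationarity \<open>k (x\<^sub>0)\<close> and \<open>k (x\<^sub>1)\<close> have the same second moment, hence \<open>k (x\<^sub>0) = k (x\<^sub>1)\<close>
  almost surely. As the noise has a positive density near the origin, \<open>k\<close> is locally constant, hence
  constant on every component, and equal on any two components that are linked by a chord. Finally
  the components are all linked: almost every point of the table lies on no line with bad (tangential or
  singular) collisions at both ends, so around it all chords have the same colour, and the table is
  connected. If \<open>k\<close> is constant, the event is independent of itself.\<close>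

section \<open>Ergodicity of Markov chains\<close>

text \<open>No martingale convergence is needed: the mean of \<open>k (x_0) k (x_1)\<close> is the
  mean of \<open>k (x_0)\<close> over the event, and so is that of \<open>k (x_0)^2\<close>, hence
  \<open>k (x_0) - k (x_1)\<close> has mean square zero. The billiard map is a definite description
  whose measurability is never established. Integrals involving it are therefore rewritten over
  pairs of end points, an open set on which all data are continuous. The geometric obstacle is the
  linking of the components. One curve might be visible from another only tangentially, and
  tangencies can be uncountable where the curvature vanishes. A bad collision at one end of a line
  does no harm, as the other end retains the colour; only lines that are bad at both ends must be
  avoided. Where the curvature is nonzero, tangency is a nondegenerate equation, so common tangents,
  and tangents through the finitely many exceptional points, are countable; where it is zero, the
  tangent lines sweep out a null set.\<close>

locale markov_process =
  fixes M :: "'a measure" and P :: "'a \<Rightarrow> 'a measure" and \<mu> :: "'a measure"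
  assumes kernel: "markov_kernel M P" and prob_mu: "prob_space \<mu>" and sets_mu: "sets \<mu> = sets M"
begin

sublocale IT: Ionescu_Tulcea "markov_step P \<mu>" "\<lambda>_. M"
  by (rule Ionescu_Tulcea_markov_step[OF kernel prob_mu sets_mu])

abbreviation "law \<equiv> markov_law M P \<mu>"
abbreviation "hist n \<equiv> PiM {0..<n::nat} (\<lambda>_. M)"
abbreviation "paths \<equiv> PiM (UNIV :: nat set) (\<lambda>_. M)"

lemma sets_law [measurable_cong]: "sets law = sets paths"
  by (simp add: markov_law_def IT.PF.sets_lim)

lemma space_law: "space law = space paths"
  using sets_law by (rule sets_eq_imp_space_eq)

sublocale law: prob_space law
proof -
  have "distr law (PiM {} (\<lambda>_. M)) (\<lambda>\<omega>. restrict \<omega> {}) = IT.CI {}"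
    unfolding markov_law_def by (rule IT.distr_lim) simp
  moreover have "prob_space (IT.CI {})" by (rule IT.PF.prob_space_P) simp_all
  ultimately show "prob_space law"
    by (intro prob_space_distrD[of "\<lambda>\<omega>. restrict \<omega> {}" law "PiM {} (\<lambda>_. M)"])
      (auto intro!: measurable_restrict)
qed

lemma measurable_P [measurable]: "P \<in> M \<rightarrow>\<^sub>M subprob_algebra M"
  using kernel by (simp add: markov_kernel_def measurable_prob_algebraD)

lemma sets_P [measurable_cong]: "x \<in> space M \<Longrightarrow> sets (P x) = sets M"
  using measurable_P by (rule subprob_measurableD)

section \<open>Finite-dimensional laws and the Markov property\<close>

text \<open>\<open>IT.CI J\<close> is the law on the initial segment \<open>{0..<up_to J}\<close>
  projected to \<open>J\<close>; for an initial segment \<open>up_to\<close> is exactly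
  \<open>n\<close>, so no projection remains. The start \<open>undefined\<close> is the only element
  of the empty product.\<close>

lemma distr_law_hist:
  "distr law (hist n) (\<lambda>\<omega>. restrict \<omega> {0..<n}) = IT.C 0 n (\<lambda>_. undefined)"
proof -
  let ?u = "\<lambda>_::nat. undefined :: 'a"
  have u: "?u \<in> space (PiM {0..<0} (\<lambda>_. M))" by (simp add: space_PiM)
  have up: "IT.up_to {0..<n} \<le> n" by (simp add: IT.up_to_iff)
  have *: "{0..<IT.up_to {0..<n}} = {0..<n}"
    using up IT.up_to[of "{0..<n}"] by (auto simp: subset_iff)
  have eq: "IT.up_to {0..<n} = n" using arg_cong[OF *, of card] by simp
  have "distr law (hist n) (\<lambda>\<omega>. restrict \<omega> {0..<n}) = IT.CI {0..<n}"
    unfolding markov_law_def by (rule IT.distr_lim) simp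
  also have "\<dots> = IT.C 0 n ?u"
    unfolding IT.CI_def eq using IT.distr_C[OF le_refl u, of n] by simp
  finally show ?thesis .
qed

lemma measurable_hist_coord: "i < n \<Longrightarrow> (\<lambda>x. x i) \<in> hist n \<rightarrow>\<^sub>M M"
  by (rule measurable_component_singleton) simp

lemma nn_integral_hist:
  assumes [measurable]: "f \<in> borel_measurable (hist n)"
  shows "(\<integral>\<^sup>+\<omega>. f (restrict \<omega> {0..<n}) \<partial>law) = (\<integral>\<^sup>+x. f x \<partial>IT.C 0 n (\<lambda>_. undefined))"
  unfolding distr_law_hist[symmetric]
  by (subst nn_integral_distr) (auto intro!: measurable_restrict)

text \<open>The law of the first \<open>n + 2\<close> states is that of the first
  \<open>n + 1\<close> bound with the kernel that appends a state drawn from \<open>P (x n)\<close>.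
  The appended index is \<open>Suc n\<close>, never \<open>0\<close>, so the case of
  \<open>markov_step\<close> that returns \<open>\<mu>\<close> does not occur.\<close>

lemma nn_integral_step:
  assumes [measurable]: "f \<in> borel_measurable (hist (Suc (Suc n)))"
  shows "(\<integral>\<^sup>+\<omega>. f (restrict \<omega> {0..<Suc (Suc n)}) \<partial>law) =
    (\<integral>\<^sup>+\<omega>. (\<integral>\<^sup>+y. f ((restrict \<omega> {0..<Suc n})(Suc n := y)) \<partial>P (\<omega> n)) \<partial>law)"
proof -
  let ?u = "\<lambda>_::nat. undefined :: 'a"
  have u: "?u \<in> space (PiM {0..<0} (\<lambda>_. M))" by (simp add: space_PiM)
  define g where "g = (\<lambda>x. \<integral>\<^sup>+y. f (x(Suc n := y)) \<partial>P (x n))"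
  have upd: "(\<lambda>(x, y). x(Suc n := y)) \<in> hist (Suc n) \<Otimes>\<^sub>M M \<rightarrow>\<^sub>M hist (Suc (Suc n))"
    unfolding split_beta
    by (rule measurable_fun_upd[where J="{0..<Suc n}"]) (auto simp: less_Suc_eq)
  have comp: "(\<lambda>x. x n) \<in> hist (Suc n) \<rightarrow>\<^sub>M M"
    by (rule measurable_hist_coord) simp
  have fu: "(\<lambda>(x, y). f (x(Suc n := y))) \<in> borel_measurable (hist (Suc n) \<Otimes>\<^sub>M M)"
    using measurable_compose[OF upd assms] by (simp add: split_beta)
  have g: "g \<in> borel_measurable (hist (Suc n))"
    unfolding g_def
    by (rule nn_integral_measurable_subprob_algebra2[OF fu]) (rule measurable_compose[OF comp measurable_P])
  have "(\<integral>\<^sup>+\<omega>. f (restrict \<omega> {0..<Suc (Suc n)}) \<partial>law) = (\<integral>\<^sup>+x. f x \<partial>IT.C 0 (Suc (Suc n)) ?u)"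
    by (rule nn_integral_hist) simp
  also have "\<dots> = (\<integral>\<^sup>+x. f x \<partial>(IT.C 0 (Suc n) ?u \<bind> IT.eP (Suc n)))"
    by (simp only: IT.C.simps add_0)
  also have "\<dots> = (\<integral>\<^sup>+x. \<integral>\<^sup>+y. f y \<partial>IT.eP (Suc n) x \<partial>IT.C 0 (Suc n) ?u)"
  proof (rule nn_integral_bind[OF assms])
    have "sets (IT.C 0 (Suc n) ?u) = sets (hist (Suc n))"
      using IT.sets_C[OF u, of "Suc n"] by (simp only: add_0)
    then show "IT.eP (Suc n) \<in> IT.C 0 (Suc n) ?u \<rightarrow>\<^sub>M subprob_algebra (hist (Suc (Suc n)))"
      using IT.measurable_eP[of "Suc n"] by (simp only: measurable_cong_sets[OF \<open>sets (IT.C 0 (Suc n) ?u) = sets (hist (Suc n))\<close> refl])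
  qed
  also have "\<dots> = (\<integral>\<^sup>+x. g x \<partial>IT.C 0 (Suc n) ?u)"
  proof (rule nn_integral_cong)
    fix x assume "x \<in> space (IT.C 0 (Suc n) ?u)"
    then have x: "x \<in> space (hist (Suc n))"
      by (simp only: IT.space_C[OF u] add_0)
    show "(\<integral>\<^sup>+y. f y \<partial>IT.eP (Suc n) x) = g x"
      using IT.nn_integral_eP[OF x assms] by (simp add: g_def markov_step_def)
  qed
  also have "\<dots> = (\<integral>\<^sup>+\<omega>. g (restrict \<omega> {0..<Suc n}) \<partial>law)"
    by (rule nn_integral_hist[OF g, symmetric])
  finally show ?thesis by (simp add: g_def)
qed

lemma measurable_coord [measurable]: "(\<lambda>\<omega>. \<omega> n) \<in> law \<rightarrow>\<^sub>M M"
  by measurable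

lemma coord_space: "\<omega> \<in> space law \<Longrightarrow> \<omega> n \<in> space M"
  by (rule measurable_space[OF measurable_coord])

lemma measurable_hist [measurable]: "(\<lambda>\<omega>. restrict \<omega> {0..<n}) \<in> law \<rightarrow>\<^sub>M hist n"
  by (auto intro!: measurable_restrict)

lemma nn_integral_initial:
  assumes [measurable]: "f \<in> borel_measurable M"
  shows "(\<integral>\<^sup>+\<omega>. f (\<omega> 0) \<partial>law) = (\<integral>\<^sup>+x. f x \<partial>\<mu>)"
proof -
  let ?u = "\<lambda>_::nat. undefined :: 'a"
  have u: "?u \<in> space (PiM {0..<0} (\<lambda>_. M))" by (simp add: space_PiM)
  have f: "(\<lambda>x. f (x 0)) \<in> borel_measurable (hist (Suc 0))"
    using measurable_compose[OF measurable_component_singleton[of 0 "{0..<Suc 0}" "\<lambda>_. M"] assms] by simp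
  have "(\<integral>\<^sup>+\<omega>. f (\<omega> 0) \<partial>law) = (\<integral>\<^sup>+x. f (x 0) \<partial>IT.C 0 (Suc 0) ?u)"
    using nn_integral_hist[OF f] by simp
  also have "IT.C 0 (Suc 0) ?u = IT.eP 0 ?u"
    using bind_return[OF IT.measurable_eP u] by (simp add: PiM_empty)
  also have "(\<integral>\<^sup>+x. f (x 0) \<partial>IT.eP 0 ?u) = (\<integral>\<^sup>+x. f x \<partial>\<mu>)"
    using IT.nn_integral_eP[OF u f] by (simp add: markov_step_def)
  finally show ?thesis .
qed

text \<open>The Markov property in the form needed for test functions: \<open>h\<close> depends on
  the past only and leaves the inner integral as a constant factor.\<close>

lemma nn_integral_step_prod:
  assumes [measurable]: "h \<in> borel_measurable (hist (Suc n))" "g \<in> borel_measurable M"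
  shows "(\<integral>\<^sup>+\<omega>. h (restrict \<omega> {0..<Suc n}) * g (\<omega> (Suc n)) \<partial>law) =
    (\<integral>\<^sup>+\<omega>. h (restrict \<omega> {0..<Suc n}) * (\<integral>\<^sup>+y. g y \<partial>P (\<omega> n)) \<partial>law)"
proof -
  define f where "f x = h (restrict x {0..<Suc n}) * g (x (Suc n))" for x
  have 1: "(\<lambda>x. restrict x {0..<Suc n}) \<in> hist (Suc (Suc n)) \<rightarrow>\<^sub>M hist (Suc n)"
    by (rule measurable_restrict_subset) auto
  have 2: "(\<lambda>x. x (Suc n)) \<in> hist (Suc (Suc n)) \<rightarrow>\<^sub>M M"
    by (rule measurable_hist_coord) simp
  have f: "f \<in> borel_measurable (hist (Suc (Suc n)))"
    unfolding f_def using measurable_compose[OF 1 assms(1)] measurable_compose[OF 2 assms(2)]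
    by (rule borel_measurable_times_ennreal)
  have r: "restrict (restrict \<omega> {0..<Suc (Suc n)}) {0..<Suc n} = restrict \<omega> {0..<Suc n}" for \<omega> :: "nat \<Rightarrow> 'a"
    by (auto simp: restrict_def)
  have r': "restrict ((restrict \<omega> {0..<Suc n})(Suc n := y)) {0..<Suc n} = restrict \<omega> {0..<Suc n}"
    for \<omega> :: "nat \<Rightarrow> 'a" and y
    by (auto simp: restrict_def)
  have "(\<integral>\<^sup>+\<omega>. (\<integral>\<^sup>+y. f ((restrict \<omega> {0..<Suc n})(Suc n := y)) \<partial>P (\<omega> n)) \<partial>law) =
    (\<integral>\<^sup>+\<omega>. h (restrict \<omega> {0..<Suc n}) * (\<integral>\<^sup>+y. g y \<partial>P (\<omega> n)) \<partial>law)"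
  proof (rule nn_integral_cong)
    fix \<omega> assume "\<omega> \<in> space law"
    then have "\<omega> n \<in> space M" by (rule coord_space)
    then have g: "g \<in> borel_measurable (P (\<omega> n))"
      by (simp add: measurable_cong_sets[OF sets_P refl])
    show "(\<integral>\<^sup>+y. f ((restrict \<omega> {0..<Suc n})(Suc n := y)) \<partial>P (\<omega> n)) =
      h (restrict \<omega> {0..<Suc n}) * (\<integral>\<^sup>+y. g y \<partial>P (\<omega> n))"
    proof -
      have "((restrict \<omega> {0..<Suc n})(Suc n := y)) (Suc n) = y" for y by simp
      then show ?thesis unfolding f_def r' by (simp only: nn_integral_cmult[OF g])
    qed
  qed
  then show ?thesis
    using nn_integral_step[OF f] by (simp add: f_def r)
qed

text \<open>\<open>cond_version D k\<close> says that \<open>k (\<omega> n)\<close> is a version of the conditional probability, given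
  the first \<open>n + 1\<close> states, that the path from time \<open>n\<close> on lies in \<open>D\<close>.\<close>

definition cond_version :: "(nat \<Rightarrow> 'a) set \<Rightarrow> ('a \<Rightarrow> ennreal) \<Rightarrow> bool" where
  "cond_version D k \<longleftrightarrow> k \<in> borel_measurable M \<and>
    (\<forall>n. \<forall>f \<in> borel_measurable (hist (Suc n)). (\<forall>x. f x \<le> 1) \<longrightarrow>
      (\<integral>\<^sup>+\<omega>. f (restrict \<omega> {0..<Suc n}) * indicator D (\<lambda>m. \<omega> (n + m)) \<partial>law) =
      (\<integral>\<^sup>+\<omega>. f (restrict \<omega> {0..<Suc n}) * k (\<omega> n) \<partial>law))"

section \<open>Existence of conditional probabilities given the past\<close>

lemma measurable_shift [measurable]: "(\<lambda>\<omega> m. \<omega> (n + m)) \<in> law \<rightarrow>\<^sub>M paths"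
  by (rule measurable_PiM_single') (auto simp: space_law space_PiM)

lemma shift_space: "\<omega> \<in> space law \<Longrightarrow> (\<lambda>m. \<omega> (n + m)) \<in> space paths"
  by (rule measurable_space[OF measurable_shift])

text \<open>Induction on the number of constraints, removing the first: if \<open>k\<close> belongs
  to the remaining constraints shifted by one, the new version restricts to \<open>X 0\<close> and
  averages \<open>k\<close> over \<open>P x\<close>. As \<open>cond_version\<close> quantifies over
  all times, the induction hypothesis is available at time \<open>n + 1\<close>.\<close>

lemma cond_version_cylinder:
  "(\<And>j. X j \<in> sets M) \<Longrightarrow> \<exists>k. cond_version {\<omega> \<in> space paths. \<forall>j<m. \<omega> j \<in> X j} k"
proof (induction m arbitrary: X)
  case 0
  have "cond_version (space paths) (\<lambda>_. 1)"
    unfolding cond_version_def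
    by (auto intro!: nn_integral_cong simp: shift_space)
  then show ?case by auto
next
  case (Suc m)
  define D where "D = {\<omega> \<in> space paths. \<forall>j<m. \<omega> j \<in> X (Suc j)}"
  obtain k where k: "cond_version D k"
    using Suc.IH[of "\<lambda>j. X (Suc j)"] Suc.prems unfolding D_def by auto
  have [measurable]: "k \<in> borel_measurable M" using k by (simp add: cond_version_def)
  have [measurable]: "X 0 \<in> sets M" using Suc.prems by simp
  define k' where "k' x = indicator (X 0) x * (\<integral>\<^sup>+y. k y \<partial>P x)" for x
  have [measurable]: "k' \<in> borel_measurable M"
    unfolding k'_def by measurable
  have "cond_version {\<omega> \<in> space paths. \<forall>j<Suc m. \<omega> j \<in> X j} k'"
    unfolding cond_version_def
  proof (intro conjI allI ballI impI)
    fix n and f :: "(nat \<Rightarrow> 'a) \<Rightarrow> ennreal"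
    assume f [measurable]: "f \<in> borel_measurable (hist (Suc n))" and f1: "\<forall>x. f x \<le> 1"
    define h where "h x = f x * indicator (X 0) (x n)" for x
    have comp: "(\<lambda>x. x n) \<in> hist (Suc n) \<rightarrow>\<^sub>M M"
      by (rule measurable_hist_coord) simp
    have h: "h \<in> borel_measurable (hist (Suc n))"
      unfolding h_def
      by (intro borel_measurable_times_ennreal f measurable_compose[OF comp]) measurable
    \<comment> \<open>\<open>h'\<close> is \<open>h\<close> read as a function of one more state, so
      that it is an admissible test function at time \<open>n + 1\<close>.\<close>
    define h' where "h' x = h (restrict x {0..<Suc n})" for x
    have res: "(\<lambda>x. restrict x {0..<Suc n}) \<in> hist (Suc (Suc n)) \<rightarrow>\<^sub>M hist (Suc n)"
      by (rule measurable_restrict_subset) auto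
    have h': "h' \<in> borel_measurable (hist (Suc (Suc n)))"
      unfolding h'_def by (rule measurable_compose[OF res h])
    have h'1: "\<forall>x. h' x \<le> 1"
      using f1 by (auto simp: h'_def h_def split: split_indicator)
    have r: "h' (restrict \<omega> {0..<Suc (Suc n)}) = h (restrict \<omega> {0..<Suc n})" for \<omega> :: "nat \<Rightarrow> 'a"
      unfolding h'_def by (rule arg_cong[of _ _ h]) (auto simp: restrict_def)
    have "(\<integral>\<^sup>+\<omega>. f (restrict \<omega> {0..<Suc n}) *
        indicator {\<omega> \<in> space paths. \<forall>j<Suc m. \<omega> j \<in> X j} (\<lambda>m. \<omega> (n + m)) \<partial>law) =
      (\<integral>\<^sup>+\<omega>. h' (restrict \<omega> {0..<Suc (Suc n)}) * indicator D (\<lambda>m. \<omega> (Suc n + m)) \<partial>law)"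
    proof (rule nn_integral_cong)
      fix \<omega> assume w: "\<omega> \<in> space law"
      have "(\<lambda>m. \<omega> (n + m)) \<in> {\<omega> \<in> space paths. \<forall>j<Suc m. \<omega> j \<in> X j} \<longleftrightarrow>
        \<omega> n \<in> X 0 \<and> (\<lambda>m. \<omega> (Suc n + m)) \<in> D"
        using shift_space[OF w, of n] shift_space[OF w, of "Suc n"]
        by (simp add: D_def All_less_Suc2)
      then show "f (restrict \<omega> {0..<Suc n}) *
        indicator {\<omega> \<in> space paths. \<forall>j<Suc m. \<omega> j \<in> X j} (\<lambda>m. \<omega> (n + m)) =
        h' (restrict \<omega> {0..<Suc (Suc n)}) * indicator D (\<lambda>m. \<omega> (Suc n + m))"
        unfolding r h_def by (auto split: split_indicator)
    qed
    also have "\<dots> = (\<integral>\<^sup>+\<omega>. h' (restrict \<omega> {0..<Suc (Suc n)}) * k (\<omega> (Suc n)) \<partial>law)"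
      using k h' h'1 unfolding cond_version_def by blast
    also have "\<dots> = (\<integral>\<^sup>+\<omega>. h (restrict \<omega> {0..<Suc n}) * (\<integral>\<^sup>+y. k y \<partial>P (\<omega> n)) \<partial>law)"
      unfolding r by (rule nn_integral_step_prod[OF h]) simp
    also have "\<dots> = (\<integral>\<^sup>+\<omega>. f (restrict \<omega> {0..<Suc n}) * k' (\<omega> n) \<partial>law)"
      by (simp add: h_def k'_def mult.assoc)
    finally show "(\<integral>\<^sup>+\<omega>. f (restrict \<omega> {0..<Suc n}) *
        indicator {\<omega> \<in> space paths. \<forall>j<Suc m. \<omega> j \<in> X j} (\<lambda>m. \<omega> (n + m)) \<partial>law) =
      (\<integral>\<^sup>+\<omega>. f (restrict \<omega> {0..<Suc n}) * k' (\<omega> n) \<partial>law)" .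
  qed simp
  then show ?case by blast
qed

text \<open>Tested on the event \<open>k (\<omega> n) > 1\<close>, the defining identity bounds the
  integral of \<open>k\<close> over this event by its probability, which forces the event to be
  null. This makes the truncated subtraction \<open>1 - k\<close> an honest complement in
  \<open>ennreal\<close>.\<close>

lemma cond_version_le_1:
  assumes k: "cond_version D k"
  shows "AE \<omega> in law. k (\<omega> n) \<le> 1"
proof -
  have [measurable]: "k \<in> borel_measurable M" using k by (simp add: cond_version_def)
  define f where "f x = (indicator {x \<in> space M. 1 < k x} (x n) :: ennreal)" for x :: "nat \<Rightarrow> 'a"
  have comp: "(\<lambda>x. x n) \<in> hist (Suc n) \<rightarrow>\<^sub>M M"
    by (rule measurable_hist_coord) simp
  have f: "f \<in> borel_measurable (hist (Suc n))"
    unfolding f_def by (rule measurable_compose[OF comp]) measurable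
  have [measurable]: "(\<lambda>\<omega>. f \<omega>) \<in> borel_measurable law"
    unfolding f_def by measurable
  have fr: "f (restrict \<omega> {0..<Suc n}) = f \<omega>" for \<omega>
    by (simp add: f_def)
  have f1: "\<forall>x. f x \<le> 1" by (simp add: f_def indicator_def)
  have "(\<integral>\<^sup>+\<omega>. f \<omega> * k (\<omega> n) \<partial>law) = (\<integral>\<^sup>+\<omega>. f \<omega> * indicator D (\<lambda>m. \<omega> (n + m)) \<partial>law)"
  proof -
    have "(\<integral>\<^sup>+\<omega>. f (restrict \<omega> {0..<Suc n}) * indicator D (\<lambda>m. \<omega> (n + m)) \<partial>law) =
      (\<integral>\<^sup>+\<omega>. f (restrict \<omega> {0..<Suc n}) * k (\<omega> n) \<partial>law)"
      using k f f1 unfolding cond_version_def by blast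
    then show ?thesis unfolding fr by simp
  qed
  also have "\<dots> \<le> (\<integral>\<^sup>+\<omega>. f \<omega> \<partial>law)"
    by (intro nn_integral_mono) (auto split: split_indicator)
  finally have le: "(\<integral>\<^sup>+\<omega>. f \<omega> * k (\<omega> n) \<partial>law) \<le> (\<integral>\<^sup>+\<omega>. f \<omega> \<partial>law)" .
  have "(\<integral>\<^sup>+\<omega>. f \<omega> \<partial>law) \<le> (\<integral>\<^sup>+\<omega>. 1 \<partial>law)"
    by (intro nn_integral_mono) (use f1 in auto)
  then have fin: "(\<integral>\<^sup>+\<omega>. f \<omega> \<partial>law) \<noteq> \<infinity>"
    by (auto simp: law.emeasure_space_1 top_unique)
  have ge: "AE \<omega> in law. f \<omega> \<le> f \<omega> * k (\<omega> n)"
    by (auto simp: f_def split: split_indicator)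
  have "(\<integral>\<^sup>+\<omega>. f \<omega> * k (\<omega> n) - f \<omega> \<partial>law) = (\<integral>\<^sup>+\<omega>. f \<omega> * k (\<omega> n) \<partial>law) - (\<integral>\<^sup>+\<omega>. f \<omega> \<partial>law)"
    by (rule nn_integral_diff) (use fin ge in auto)
  also have "\<dots> = 0" using le fin by (auto simp: diff_eq_0_iff_ennreal less_top intro: le_less_trans)
  finally have "AE \<omega> in law. f \<omega> * k (\<omega> n) - f \<omega> = 0"
    by (subst (asm) nn_integral_0_iff_AE) auto
  moreover have "AE \<omega> in law. \<omega> \<in> space law" by (rule AE_space)
  ultimately show ?thesis
  proof eventually_elim
    case (elim \<omega>)
    show ?case
    proof (rule ccontr)
      assume "\<not> k (\<omega> n) \<le> 1"
      then have "f \<omega> = 1" using coord_space[OF elim(2)] by (simp add: f_def)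
      then show False using elim(1) \<open>\<not> k (\<omega> n) \<le> 1\<close>
        by (simp add: diff_eq_0_iff_ennreal)
    qed
  qed
qed

lemma sets_shift_indicator [measurable]:
  "D \<in> sets paths \<Longrightarrow> (\<lambda>\<omega>. indicator D (\<lambda>m. \<omega> (n + m)) :: ennreal) \<in> borel_measurable law"
  by (rule measurable_compose[OF measurable_shift]) simp

text \<open>The sets with a version contain the cylinders and are closed under complements and
  countable disjoint unions, with versions \<open>1 - k\<close> and the sum. The cylinders are
  stable under intersection, so a Dynkin argument reaches all measurable sets.\<close>

lemma cond_version_exists:
  assumes D: "D \<in> sets paths"
  shows "\<exists>k. cond_version D k"
proof -
  have "D \<in> sigma_sets (\<Pi>\<^sub>E i\<in>UNIV. space M) (prod_algebra UNIV (\<lambda>_::nat. M))"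
    using D by (simp add: sets_PiM)
  with Int_stable_prod_algebra[of UNIV "\<lambda>_. M"] prod_algebra_sets_into_space[of UNIV "\<lambda>_. M"]
  show ?thesis
  proof (induction rule: sigma_sets_induct_disjoint)
    case (basic A)
    then obtain J E where A: "A = prod_emb UNIV (\<lambda>_. M) J (\<Pi>\<^sub>E j\<in>J. E j)" "finite J"
      "\<And>i. i \<in> J \<Longrightarrow> E i \<in> sets M"
      by (elim prod_algebraE) auto
    \<comment> \<open>A finite set of constrained times is padded to an initial segment with the
      trivial constraint \<open>space M\<close>.\<close>
    define X where "X j = (if j \<in> J then E j else space M)" for j
    have "A = {\<omega> \<in> space paths. \<forall>j<Suc (Max J). \<omega> j \<in> X j}"
      using A(2) unfolding A(1) prod_emb_def X_def
      by (auto simp: space_PiM PiE_iff less_Suc_eq_le)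
    moreover have "X j \<in> sets M" for j using A(3) by (simp add: X_def)
    ultimately show ?case using cond_version_cylinder[of X] by simp
  next
    case empty
    have "cond_version {} (\<lambda>_. 0)" unfolding cond_version_def by simp
    then show ?case by blast
  next
    case (compl A)
    then obtain k where k: "cond_version A k" by blast
    have [measurable]: "k \<in> borel_measurable M" using k by (simp add: cond_version_def)
    have A: "A \<in> sets paths" using compl(1) by (simp add: sets_PiM)
    have "cond_version ((\<Pi>\<^sub>E i\<in>UNIV. space M) - A) (\<lambda>x. 1 - k x)"
      unfolding cond_version_def
    proof (intro conjI allI ballI impI)
      fix n and f :: "(nat \<Rightarrow> 'a) \<Rightarrow> ennreal"
      assume f [measurable]: "f \<in> borel_measurable (hist (Suc n))" and f1: "\<forall>x. f x \<le> 1"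
      let ?f = "\<lambda>\<omega>. f (restrict \<omega> {0..<Suc n})"
      have [measurable]: "?f \<in> borel_measurable law"
        by (rule measurable_compose[OF measurable_hist f])
      have eq: "(\<integral>\<^sup>+\<omega>. ?f \<omega> * indicator A (\<lambda>m. \<omega> (n + m)) \<partial>law) = (\<integral>\<^sup>+\<omega>. ?f \<omega> * k (\<omega> n) \<partial>law)"
        using k f f1 unfolding cond_version_def by blast
      have "(\<integral>\<^sup>+\<omega>. ?f \<omega> * indicator A (\<lambda>m. \<omega> (n + m)) \<partial>law) \<le> (\<integral>\<^sup>+\<omega>. 1 \<partial>law)"
        by (intro nn_integral_mono) (use f1 in \<open>auto split: split_indicator\<close>)
      then have fin: "(\<integral>\<^sup>+\<omega>. ?f \<omega> * indicator A (\<lambda>m. \<omega> (n + m)) \<partial>law) \<noteq> \<infinity>"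
        by (auto simp: law.emeasure_space_1 top_unique)
      let ?A' = "(\<Pi>\<^sub>E i\<in>UNIV. space M) - A"
      have A': "?A' \<in> sets paths" using sets.compl_sets[OF A] by (simp add: space_PiM)
      have "(\<integral>\<^sup>+\<omega>. ?f \<omega> * indicator A (\<lambda>m. \<omega> (n + m)) \<partial>law) +
          (\<integral>\<^sup>+\<omega>. ?f \<omega> * indicator ?A' (\<lambda>m. \<omega> (n + m)) \<partial>law) =
          (\<integral>\<^sup>+\<omega>. ?f \<omega> * indicator A (\<lambda>m. \<omega> (n + m)) + ?f \<omega> * indicator ?A' (\<lambda>m. \<omega> (n + m)) \<partial>law)"
        by (rule nn_integral_add[symmetric]) (use A A' in measurable)
      also have "\<dots> = (\<integral>\<^sup>+\<omega>. ?f \<omega> \<partial>law)"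
      proof (rule nn_integral_cong)
        fix \<omega> assume "\<omega> \<in> space law"
        from shift_space[OF this, of n] show "?f \<omega> * indicator A (\<lambda>m. \<omega> (n + m)) +
          ?f \<omega> * indicator ?A' (\<lambda>m. \<omega> (n + m)) = ?f \<omega>"
          by (cases "(\<lambda>m. \<omega> (n + m)) \<in> A") (simp_all add: space_PiM del: restrict_apply)
      qed
      finally have "(\<integral>\<^sup>+\<omega>. ?f \<omega> * indicator A (\<lambda>m. \<omega> (n + m)) \<partial>law) +
          (\<integral>\<^sup>+\<omega>. ?f \<omega> * indicator ?A' (\<lambda>m. \<omega> (n + m)) \<partial>law) = (\<integral>\<^sup>+\<omega>. ?f \<omega> \<partial>law)" .
      moreover have "(\<integral>\<^sup>+\<omega>. ?f \<omega> * k (\<omega> n) \<partial>law) + (\<integral>\<^sup>+\<omega>. ?f \<omega> * (1 - k (\<omega> n)) \<partial>law) =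
          (\<integral>\<^sup>+\<omega>. ?f \<omega> \<partial>law)"
      proof -
        have "(\<integral>\<^sup>+\<omega>. ?f \<omega> * k (\<omega> n) \<partial>law) + (\<integral>\<^sup>+\<omega>. ?f \<omega> * (1 - k (\<omega> n)) \<partial>law) =
          (\<integral>\<^sup>+\<omega>. ?f \<omega> * k (\<omega> n) + ?f \<omega> * (1 - k (\<omega> n)) \<partial>law)"
          by (rule nn_integral_add[symmetric]) measurable
        also have "\<dots> = (\<integral>\<^sup>+\<omega>. ?f \<omega> \<partial>law)"
        proof (rule nn_integral_cong_AE)
          show "AE \<omega> in law. ?f \<omega> * k (\<omega> n) + ?f \<omega> * (1 - k (\<omega> n)) = ?f \<omega>"
            using cond_version_le_1[OF k, of n]
          proof eventually_elim
            case (elim \<omega>)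
            then have "k (\<omega> n) + (1 - k (\<omega> n)) = 1" by (rule add_diff_inverse_ennreal)
            then show ?case by (metis distrib_left mult.right_neutral)
          qed
        qed
        finally show ?thesis .
      qed
      ultimately have "(\<integral>\<^sup>+\<omega>. ?f \<omega> * indicator A (\<lambda>m. \<omega> (n + m)) \<partial>law) +
          (\<integral>\<^sup>+\<omega>. ?f \<omega> * indicator ((\<Pi>\<^sub>E i\<in>UNIV. space M) - A) (\<lambda>m. \<omega> (n + m)) \<partial>law) =
          (\<integral>\<^sup>+\<omega>. ?f \<omega> * indicator A (\<lambda>m. \<omega> (n + m)) \<partial>law) +
          (\<integral>\<^sup>+\<omega>. ?f \<omega> * (1 - k (\<omega> n)) \<partial>law)"
        unfolding eq by (rule trans[OF _ sym])
      \<comment> \<open>Cancellation in \<open>ennreal\<close> is legitimate because the common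
        summand is finite.\<close>
      then show "(\<integral>\<^sup>+\<omega>. ?f \<omega> * indicator ((\<Pi>\<^sub>E i\<in>UNIV. space M) - A) (\<lambda>m. \<omega> (n + m)) \<partial>law) =
          (\<integral>\<^sup>+\<omega>. ?f \<omega> * (1 - k (\<omega> n)) \<partial>law)"
        unfolding ennreal_add_left_cancel using fin by (elim disjE) simp_all
    qed measurable
    then show ?case by blast
  next
    case (union A)
    then obtain k where k: "\<And>i. cond_version (A i) (k i)" by metis
    have [measurable]: "k i \<in> borel_measurable M" for i using k by (simp add: cond_version_def)
    have A [measurable]: "A i \<in> sets paths" for i using union(2) by (auto simp: sets_PiM)
    have "cond_version (\<Union>i. A i) (\<lambda>x. \<Sum>i. k i x)"
      unfolding cond_version_def
    proof (intro conjI allI ballI impI)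
      fix n and f :: "(nat \<Rightarrow> 'a) \<Rightarrow> ennreal"
      assume f [measurable]: "f \<in> borel_measurable (hist (Suc n))" and f1: "\<forall>x. f x \<le> 1"
      let ?f = "\<lambda>\<omega>. f (restrict \<omega> {0..<Suc n})"
      have [measurable]: "?f \<in> borel_measurable law"
        by (rule measurable_compose[OF measurable_hist f])
      have eq: "(\<integral>\<^sup>+\<omega>. ?f \<omega> * indicator (A i) (\<lambda>m. \<omega> (n + m)) \<partial>law) = (\<integral>\<^sup>+\<omega>. ?f \<omega> * k i (\<omega> n) \<partial>law)" for i
        using k f f1 unfolding cond_version_def by blast
      have "(\<integral>\<^sup>+\<omega>. ?f \<omega> * indicator (\<Union>i. A i) (\<lambda>m. \<omega> (n + m)) \<partial>law) =
        (\<integral>\<^sup>+\<omega>. (\<Sum>i. ?f \<omega> * indicator (A i) (\<lambda>m. \<omega> (n + m))) \<partial>law)"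
        by (simp add: suminf_indicator[OF union(1)])
      also have "\<dots> = (\<Sum>i. \<integral>\<^sup>+\<omega>. ?f \<omega> * indicator (A i) (\<lambda>m. \<omega> (n + m)) \<partial>law)"
        by (rule nn_integral_suminf) measurable
      also have "\<dots> = (\<integral>\<^sup>+\<omega>. (\<Sum>i. ?f \<omega> * k i (\<omega> n)) \<partial>law)"
        unfolding eq by (rule nn_integral_suminf[symmetric]) measurable
      finally show "(\<integral>\<^sup>+\<omega>. ?f \<omega> * indicator (\<Union>i. A i) (\<lambda>m. \<omega> (n + m)) \<partial>law) =
          (\<integral>\<^sup>+\<omega>. ?f \<omega> * (\<Sum>i. k i (\<omega> n)) \<partial>law)"
        by simp
    qed measurable
    then show ?case by blast
  qed
qed


section \<open>Invariant events of a stationary chain\<close>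

lemma seq_shift_funpow:
  assumes A: "A \<in> sets paths" and inv: "seq_shift -` A \<inter> space paths = A" and w: "\<omega> \<in> space law"
  shows "(\<lambda>m. \<omega> (n + m)) \<in> A \<longleftrightarrow> \<omega> \<in> A"
proof (induction n)
  case (Suc n)
  have "(\<lambda>m. \<omega> (Suc n + m)) = seq_shift (\<lambda>m. \<omega> (n + m))"
    by (simp add: seq_shift_def)
  then show ?case using Suc inv shift_space[OF w, of n] by auto
qed simp

context
  assumes invariant: "invariant_measure M P \<mu>"
begin

text \<open>Induction on time: invariance passes the marginal \<open>\<mu>\<close> from
  \<open>n\<close> to \<open>n + 1\<close>.\<close>

lemma nn_integral_coord:
  assumes [measurable]: "f \<in> borel_measurable M"
  shows "(\<integral>\<^sup>+\<omega>. f (\<omega> n) \<partial>law) = (\<integral>\<^sup>+x. f x \<partial>\<mu>)"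
proof -
  have eq: "distr law M (\<lambda>\<omega>. \<omega> n) = \<mu>"
  proof (induction n)
    case 0
    show ?case
    proof (rule measure_eqI)
      fix B assume "B \<in> sets (distr law M (\<lambda>\<omega>. \<omega> 0))"
      then have [measurable]: "B \<in> sets M" by simp
      have "emeasure (distr law M (\<lambda>\<omega>. \<omega> 0)) B = (\<integral>\<^sup>+x. indicator B x \<partial>distr law M (\<lambda>\<omega>. \<omega> 0))"
        by simp
      also have "\<dots> = (\<integral>\<^sup>+\<omega>. indicator B (\<omega> 0) \<partial>law)"
        using nn_integral_distr[of "\<lambda>\<omega>. \<omega> 0" law M "indicator B"] by simp
      also have "\<dots> = (\<integral>\<^sup>+x. indicator B x \<partial>\<mu>)"
        using nn_integral_initial[of "indicator B"] by simp
      finally show "emeasure (distr law M (\<lambda>\<omega>. \<omega> 0)) B = emeasure \<mu> B"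
        using sets_mu by simp
    qed (simp add: sets_mu)
  next
    case (Suc n)
    show ?case
    proof (rule measure_eqI)
      fix B assume "B \<in> sets (distr law M (\<lambda>\<omega>. \<omega> (Suc n)))"
      then have B [measurable]: "B \<in> sets M" by simp
      have "emeasure (distr law M (\<lambda>\<omega>. \<omega> (Suc n))) B =
        (\<integral>\<^sup>+x. indicator B x \<partial>distr law M (\<lambda>\<omega>. \<omega> (Suc n)))"
        by simp
      also have "\<dots> = (\<integral>\<^sup>+\<omega>. indicator B (\<omega> (Suc n)) \<partial>law)"
        using nn_integral_distr[of "\<lambda>\<omega>. \<omega> (Suc n)" law M "indicator B"] by simp
      also have "\<dots> = (\<integral>\<^sup>+\<omega>. (\<integral>\<^sup>+y. indicator B y \<partial>P (\<omega> n)) \<partial>law)"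
        using nn_integral_step_prod[of "\<lambda>_. 1" n "indicator B"] by simp
      also have "\<dots> = (\<integral>\<^sup>+x. (\<integral>\<^sup>+y. indicator B y \<partial>P x) \<partial>distr law M (\<lambda>\<omega>. \<omega> n))"
        using nn_integral_distr[of "\<lambda>\<omega>. \<omega> n" law M "\<lambda>x. \<integral>\<^sup>+y. indicator B y \<partial>P x"] by simp
      also have "\<dots> = (\<integral>\<^sup>+x. emeasure (P x) B \<partial>\<mu>)"
        unfolding Suc
        by (rule nn_integral_cong) (simp add: sets_P sets_eq_imp_space_eq[OF sets_mu])
      also have "\<dots> = emeasure \<mu> B"
        using invariant B by (simp add: invariant_measure_def)
      finally show "emeasure (distr law M (\<lambda>\<omega>. \<omega> (Suc n))) B = emeasure \<mu> B" .
    qed (simp add: sets_mu)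
  qed
  have "f \<in> borel_measurable (distr law M (\<lambda>\<omega>. \<omega> n))"
    using assms by (simp only: measurable_distr_eq1)
  from nn_integral_distr[OF measurable_coord this] show ?thesis
    unfolding eq by (rule sym)
qed

lemma AE_coord:
  assumes "AE x in \<mu>. Q x" shows "AE \<omega> in law. Q (\<omega> n)"
proof -
  obtain N where N: "N \<in> sets M" "emeasure \<mu> N = 0" "{x \<in> space M. \<not> Q x} \<subseteq> N"
    using assms sets_mu by (auto elim!: AE_E simp: sets_eq_imp_space_eq[OF sets_mu])
  note [measurable] = N(1)
  have "(\<integral>\<^sup>+\<omega>. indicator N (\<omega> n) \<partial>law) = 0"
    using nn_integral_coord[of "indicator N" n] N sets_mu by simp
  then have "AE \<omega> in law. indicator N (\<omega> n) = (0 :: ennreal)"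
    by (subst (asm) nn_integral_0_iff_AE) auto
  moreover have "AE \<omega> in law. \<omega> \<in> space law" by (rule AE_space)
  ultimately show ?thesis
  proof eventually_elim
    case (elim \<omega>)
    then show ?case using N(3) coord_space[of \<omega> n] by (auto simp: indicator_eq_0_iff)
  qed
qed

text \<open>By invariance the shifted path lies in \<open>A\<close> exactly when the path does, so
  the mean of \<open>a (\<omega> 0) * a (\<omega> n)\<close> is the mean of
  \<open>a (\<omega> 0)\<close> over \<open>A\<close>, for every \<open>n\<close>. Comparing
  \<open>n = 0\<close> with \<open>n = 1\<close> evaluates the mixed moment, and the square of the
  difference integrates to zero.\<close>

lemma cond_version_harmonic:
  assumes A: "A \<in> sets paths" and inv: "seq_shift -` A \<inter> space paths = A"
    and k: "cond_version A k"
  shows "AE \<omega> in law. enn2real (k (\<omega> 0)) = enn2real (k (\<omega> 1))"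
proof -
  have km [measurable]: "k \<in> borel_measurable M" using k by (simp add: cond_version_def)
  \<comment> \<open>The truncation is bounded everywhere, so all products are integrable; along the
    path it almost surely equals \<open>k\<close>.\<close>
  define a where "a x = enn2real (min 1 (k x))" for x
  have [measurable]: "a \<in> borel_measurable M" unfolding a_def by measurable
  have a01: "0 \<le> a x" "a x \<le> 1" for x
    by (auto simp: a_def min_def enn2real_leI)
  have ea: "ennreal (a x) = min 1 (k x)" for x
    by (simp add: a_def min_less_iff_disj)
  have k1: "AE \<omega> in law. ennreal (a (\<omega> n)) = k (\<omega> n)" for n
    using cond_version_le_1[OF k, of n] by eventually_elim (simp add: ea min_def)
  have ind: "(\<integral>\<^sup>+\<omega>. ennreal (a (\<omega> 0)) * ennreal (a (\<omega> n)) \<partial>law) =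
    (\<integral>\<^sup>+\<omega>. ennreal (a (\<omega> 0)) * indicator A \<omega> \<partial>law)" for n
  proof -
    define f where "f x = ennreal (a (x 0))" for x :: "nat \<Rightarrow> 'a"
    have comp: "(\<lambda>x. x 0) \<in> hist (Suc n) \<rightarrow>\<^sub>M M"
      by (rule measurable_hist_coord) simp
    have f: "f \<in> borel_measurable (hist (Suc n))"
      unfolding f_def by (rule measurable_compose[OF comp]) measurable
    have f1: "\<forall>x. f x \<le> 1" using a01 by (simp add: f_def)
    have fr: "f (restrict \<omega> {0..<Suc n}) = ennreal (a (\<omega> 0))" for \<omega> by (simp add: f_def)
    have "(\<integral>\<^sup>+\<omega>. f (restrict \<omega> {0..<Suc n}) * indicator A (\<lambda>m. \<omega> (n + m)) \<partial>law) =
      (\<integral>\<^sup>+\<omega>. f (restrict \<omega> {0..<Suc n}) * k (\<omega> n) \<partial>law)"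
      using k f f1 unfolding cond_version_def by blast
    moreover have "(\<integral>\<^sup>+\<omega>. ennreal (a (\<omega> 0)) * indicator A (\<lambda>m. \<omega> (n + m)) \<partial>law) =
      (\<integral>\<^sup>+\<omega>. ennreal (a (\<omega> 0)) * indicator A \<omega> \<partial>law)"
      by (intro nn_integral_cong) (simp add: indicator_def seq_shift_funpow[OF A inv])
    moreover have "(\<integral>\<^sup>+\<omega>. ennreal (a (\<omega> 0)) * k (\<omega> n) \<partial>law) =
      (\<integral>\<^sup>+\<omega>. ennreal (a (\<omega> 0)) * ennreal (a (\<omega> n)) \<partial>law)"
      by (rule nn_integral_cong_AE) (use k1[of n] in eventually_elim, simp)
    ultimately show ?thesis unfolding fr by simp
  qed
  have int: "integrable law (\<lambda>\<omega>. a (\<omega> i) * a (\<omega> j))" for i j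
    by (rule law.integrable_const_bound[of _ 1]) (use a01 in \<open>auto intro!: mult_le_one\<close>)
  have conv: "(\<integral>\<^sup>+\<omega>. ennreal (a (\<omega> i)) * ennreal (a (\<omega> j)) \<partial>law) = ennreal (\<integral>\<omega>. a (\<omega> i) * a (\<omega> j) \<partial>law)" for i j
    using nn_integral_eq_integral[OF int[of i j]] a01 by (simp add: ennreal_mult[symmetric])
  have nonneg: "0 \<le> (\<integral>\<omega>. a (\<omega> i) * a (\<omega> j) \<partial>law)" for i j
    using a01 by (intro integral_nonneg_AE) auto
  have e1: "(\<integral>\<omega>. a (\<omega> 0) * a (\<omega> 1) \<partial>law) = (\<integral>\<omega>. a (\<omega> 0) * a (\<omega> 0) \<partial>law)"
  proof -
    have "ennreal (\<integral>\<omega>. a (\<omega> 0) * a (\<omega> 1) \<partial>law) = ennreal (\<integral>\<omega>. a (\<omega> 0) * a (\<omega> 0) \<partial>law)"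
      unfolding conv[symmetric] ind ..
    then show ?thesis by (simp only: ennreal_inj[OF nonneg nonneg])
  qed
  have e2: "(\<integral>\<omega>. a (\<omega> 1) * a (\<omega> 1) \<partial>law) = (\<integral>\<omega>. a (\<omega> 0) * a (\<omega> 0) \<partial>law)"
  proof -
    have "(\<lambda>x. ennreal (a x) * ennreal (a x)) \<in> borel_measurable M" by measurable
    note c = nn_integral_coord[OF this]
    have "ennreal (\<integral>\<omega>. a (\<omega> 1) * a (\<omega> 1) \<partial>law) = ennreal (\<integral>\<omega>. a (\<omega> 0) * a (\<omega> 0) \<partial>law)"
      unfolding conv[symmetric] c ..
    then show ?thesis by (simp only: ennreal_inj[OF nonneg nonneg])
  qed
  let ?g = "\<lambda>\<omega>. a (\<omega> 0) * a (\<omega> 0) - 2 * (a (\<omega> 0) * a (\<omega> 1)) + a (\<omega> 1) * a (\<omega> 1)"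
  have ig: "integrable law ?g"
    by (intro Bochner_Integration.integrable_add Bochner_Integration.integrable_diff
        Bochner_Integration.integrable_mult_right int)
  have g: "?g \<omega> = (a (\<omega> 0) - a (\<omega> 1))\<^sup>2" for \<omega>
    by (simp add: power2_eq_square algebra_simps)
  have "(\<integral>\<omega>. ?g \<omega> \<partial>law) = (\<integral>\<omega>. a (\<omega> 0) * a (\<omega> 0) \<partial>law) - 2 * (\<integral>\<omega>. a (\<omega> 0) * a (\<omega> 1) \<partial>law)
      + (\<integral>\<omega>. a (\<omega> 1) * a (\<omega> 1) \<partial>law)"
    using int by simp
  then have "(\<integral>\<omega>. ?g \<omega> \<partial>law) = 0" using e1 e2 by simp
  then have "AE \<omega> in law. ?g \<omega> = 0"
    using integral_nonneg_eq_0_iff_AE[OF ig] unfolding g by simp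
  then show ?thesis using k1[of 0] k1[of 1]
  proof eventually_elim
    case (elim \<omega>)
    then have "a (\<omega> 0) = a (\<omega> 1)" unfolding g by simp
    then show ?case using elim(2,3) by simp
  qed
qed

text \<open>The condition concerns functions of the state only. Once the version of an invariant
  \<open>A\<close> is a constant \<open>c\<close>, the identity
  \<open>law (A \<inter> B) = c * law B\<close> holds for cylinders and hence for all measurable
  \<open>B\<close>; the whole space as \<open>B\<close> gives \<open>c = law A\<close>, and
  \<open>B = A\<close> gives \<open>law A = (law A)^2\<close>.\<close>

theorem ergodicI:
  assumes const: "\<And>k :: 'a \<Rightarrow> real. k \<in> borel_measurable M \<Longrightarrow>
      (AE x in \<mu>. AE y in P x. k y = k x) \<Longrightarrow> \<exists>c. AE x in \<mu>. k x = c"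
  shows "ergodic_measure M P \<mu>"
  unfolding ergodic_measure_def
proof (intro conjI ballI impI invariant)
  fix A assume A [measurable]: "A \<in> sets paths" and inv: "seq_shift -` A \<inter> space paths = A"
  obtain k where k: "cond_version A k" using cond_version_exists[OF A] by blast
  have km [measurable]: "k \<in> borel_measurable M" using k by (simp add: cond_version_def)
  define a where "a x = enn2real (k x)" for x
  have [measurable]: "a \<in> borel_measurable M" unfolding a_def by measurable
  have harmonic: "AE \<omega> in law. a (\<omega> 0) = a (\<omega> 1)"
    unfolding a_def by (rule cond_version_harmonic[OF A inv k])
  \<comment> \<open>Written as a vanishing integral, the almost sure equality can be split by the
    one-step formula into statements about \<open>P x\<close> for almost every
    \<open>x\<close>.\<close>
  define f where "f x = (if a (x 0) = a (x 1) then 0 else 1 :: ennreal)" for x :: "nat \<Rightarrow> 'a"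
  have comp: "(\<lambda>x. x i) \<in> hist (Suc (Suc 0)) \<rightarrow>\<^sub>M M" if "i < Suc (Suc 0)" for i
    by (rule measurable_component_singleton) (use that in simp)
  have [measurable]: "(\<lambda>x. a (x 0)) \<in> borel_measurable (hist (Suc (Suc 0)))"
     "(\<lambda>x. a (x 1)) \<in> borel_measurable (hist (Suc (Suc 0)))"
    using comp[of 0] comp[of 1] by (auto intro: measurable_compose)
  have f: "f \<in> borel_measurable (hist (Suc (Suc 0)))"
    unfolding f_def by measurable
  have "(\<integral>\<^sup>+\<omega>. (\<integral>\<^sup>+y. (if a (\<omega> 0) = a y then 0 else 1) \<partial>P (\<omega> 0)) \<partial>law) =
      (\<integral>\<^sup>+\<omega>. f \<omega> \<partial>law)"
    using nn_integral_step[OF f] by (simp add: f_def)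
  also have "\<dots> = (\<integral>\<^sup>+\<omega>. 0 \<partial>law)"
    by (rule nn_integral_cong_AE) (use harmonic in eventually_elim, simp add: f_def)
  finally have z: "(\<integral>\<^sup>+\<omega>. (\<integral>\<^sup>+y. (if a (\<omega> 0) = a y then 0 else 1) \<partial>P (\<omega> 0)) \<partial>law) = 0" by simp
  have am: "a \<in> borel_measurable M" by fact
  have "(\<lambda>(x, y). if a x = a y then 0 else 1 :: ennreal) \<in> borel_measurable (M \<Otimes>\<^sub>M M)"
    unfolding split_beta
    by (intro measurable_If measurable_const borel_measurable_eq
        measurable_compose[OF measurable_fst am] measurable_compose[OF measurable_snd am]) simp_all
  then have m2: "(\<lambda>x. (\<integral>\<^sup>+y. (if a x = a y then 0 else 1 :: ennreal) \<partial>P x)) \<in> borel_measurable M"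
    by (rule nn_integral_measurable_subprob_algebra2) (rule measurable_P)
  have "(\<integral>\<^sup>+x. (\<integral>\<^sup>+y. (if a x = a y then 0 else 1) \<partial>P x) \<partial>\<mu>) = 0"
    using nn_integral_coord[OF m2, of 0] z by simp
  then have "AE x in \<mu>. (\<integral>\<^sup>+y. (if a x = a y then 0 else 1 :: ennreal) \<partial>P x) = 0"
    by (subst (asm) nn_integral_0_iff_AE) (use m2 in \<open>auto simp: measurable_cong_sets[OF sets_mu refl]\<close>)
  moreover have "AE x in \<mu>. x \<in> space \<mu>" by (rule AE_space)
  ultimately have "AE x in \<mu>. AE y in P x. a y = a x"
  proof eventually_elim
    case (elim x)
    then have x: "x \<in> space M" by (simp add: sets_eq_imp_space_eq[OF sets_mu])
    have "(\<lambda>y. if a x = a y then 0 else 1 :: ennreal) \<in> borel_measurable (P x)"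
      by (simp add: measurable_cong_sets[OF sets_P[OF x] refl])
    from nn_integral_0_iff_AE[OF this] elim(1) show ?case
      by (auto elim!: eventually_mono split: if_splits)
  qed
  then obtain c where c: "AE x in \<mu>. a x = c"
    using const[of a] by auto
  have c': "AE \<omega> in law. k (\<omega> n) = ennreal c" for n
    using AE_coord[OF c, of n] cond_version_le_1[OF k, of n]
  proof eventually_elim
    case (elim \<omega>)
    then have "k (\<omega> n) < top" using le_less_trans ennreal_one_less_top by blast
    then show ?case using elim(1) ennreal_enn2real unfolding a_def by fastforce
  qed
  have cyl: "emeasure law (A \<inter> B) = ennreal c * emeasure law B"
    if B: "B \<in> prod_algebra UNIV (\<lambda>_. M)" for B
  proof -
    obtain J E where BE: "B = prod_emb UNIV (\<lambda>_. M) J (\<Pi>\<^sub>E j\<in>J. E j)" "finite J"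
      "\<And>i. i \<in> J \<Longrightarrow> E i \<in> sets M"
      using B by (elim prod_algebraE) auto
    define n where "n = Max J"
    have J: "j \<in> {0..<Suc n}" if "j \<in> J" for j using that BE(2) by (simp add: n_def less_Suc_eq_le)
    have [measurable]: "B \<in> sets paths" using B by (simp add: sets_PiM)
    define f where "f x = (\<Prod>j\<in>J. indicator (E j) (x j) :: ennreal)" for x :: "nat \<Rightarrow> 'a"
    have f: "f \<in> borel_measurable (hist (Suc n))"
      unfolding f_def
    proof (rule borel_measurable_prod_ennreal)
      fix j assume j: "j \<in> J"
      have comp: "(\<lambda>x. x j) \<in> hist (Suc n) \<rightarrow>\<^sub>M M"
        by (rule measurable_component_singleton) (use J[OF j] in simp)
      show "(\<lambda>x. indicator (E j) (x j) :: ennreal) \<in> borel_measurable (hist (Suc n))"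
        by (rule measurable_compose[OF comp]) (use BE(3)[OF j] in simp)
    qed
    have f1: "\<forall>x. f x \<le> 1"
      unfolding f_def by (auto intro!: prod_le_1 simp: indicator_def)
    have fr: "f (restrict \<omega> {0..<Suc n}) = indicator B \<omega>" if "\<omega> \<in> space law" for \<omega>
    proof -
      have "f (restrict \<omega> {0..<Suc n}) = (\<Prod>j\<in>J. indicator (E j) (\<omega> j))"
        unfolding f_def using J by (intro prod.cong) auto
      also have "\<dots> = (if \<forall>j\<in>J. \<omega> j \<in> E j then 1 else 0)"
        using BE(2) by (auto simp: indicator_def prod_zero_iff)
      also have "\<dots> = indicator B \<omega>"
        using that unfolding BE(1) by (auto simp: prod_emb_def space_law space_PiM indicator_def)
      finally show ?thesis .
    qed
    have "emeasure law (A \<inter> B) = (\<integral>\<^sup>+\<omega>. indicator (A \<inter> B) \<omega> \<partial>law)"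
      by (simp add: sets_law)
    also have "\<dots> = (\<integral>\<^sup>+\<omega>. f (restrict \<omega> {0..<Suc n}) * indicator A (\<lambda>m. \<omega> (n + m)) \<partial>law)"
      by (auto intro!: nn_integral_cong simp: fr indicator_def seq_shift_funpow[OF A inv])
    also have "\<dots> = (\<integral>\<^sup>+\<omega>. f (restrict \<omega> {0..<Suc n}) * k (\<omega> n) \<partial>law)"
      using k f f1 unfolding cond_version_def by blast
    also have "\<dots> = (\<integral>\<^sup>+\<omega>. ennreal c * indicator B \<omega> \<partial>law)"
      by (rule nn_integral_cong_AE)
        (use c'[of n] AE_space[of law] in eventually_elim, simp add: fr mult.commute)
    also have "\<dots> = ennreal c * emeasure law B"
      by (simp add: nn_integral_cmult sets_law)
    finally show ?thesis .
  qed
  have all: "emeasure law (A \<inter> B) = ennreal c * emeasure law B" if "B \<in> sets paths" for B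
  proof -
    let ?\<Omega> = "\<Pi>\<^sub>E i\<in>(UNIV :: nat set). space M"
    have \<Omega>: "?\<Omega> = space paths" by (simp add: space_PiM)
    have AL: "A \<in> sets law" using A by (simp add: sets_law)
    have dA: "emeasure (density law (indicator A)) X = emeasure law (A \<inter> X)" if "X \<in> sets paths" for X
    proof -
      have X: "X \<in> sets law" using that by (simp add: sets_law)
      have "emeasure (density law (indicator A)) X = (\<integral>\<^sup>+\<omega>. indicator A \<omega> * indicator X \<omega> \<partial>law)"
        by (rule emeasure_density[OF borel_measurable_indicator[OF AL] X])
      also have "\<dots> = (\<integral>\<^sup>+\<omega>. indicator (A \<inter> X) \<omega> \<partial>law)"
        by (simp only: indicator_inter_arith)
      also have "\<dots> = emeasure law (A \<inter> X)"
        by (rule nn_integral_indicator[OF sets.Int[OF AL X]])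
      finally show ?thesis .
    qed
    have dc: "emeasure (density law (\<lambda>_. ennreal c)) X = ennreal c * emeasure law X" if "X \<in> sets paths" for X
      by (rule emeasure_density_const) (use that in \<open>simp add: sets_law\<close>)
    \<comment> \<open>Both densities are measures on the path space that agree on the
      intersection-stable family of cylinders; the first has finite total mass.\<close>
    have "density law (indicator A) = density law (\<lambda>_. ennreal c)"
    proof (rule measure_eqI_generator_eq[OF Int_stable_prod_algebra[of "UNIV :: nat set" "\<lambda>_. M"]])
      show "prod_algebra (UNIV :: nat set) (\<lambda>_. M) \<subseteq> Pow ?\<Omega>"
        by (rule prod_algebra_sets_into_space)
      show "sets (density law (indicator A)) = sigma_sets ?\<Omega> (prod_algebra (UNIV :: nat set) (\<lambda>_. M))"
        "sets (density law (\<lambda>_. ennreal c)) = sigma_sets ?\<Omega> (prod_algebra (UNIV :: nat set) (\<lambda>_. M))"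
        unfolding sets_density sets_law sets_PiM by simp_all
      have "?\<Omega> = prod_emb (UNIV :: nat set) (\<lambda>_. M) {0} (\<Pi>\<^sub>E j\<in>{0::nat}. space M)"
        by (auto simp: prod_emb_def)
      also have "\<dots> \<in> prod_algebra (UNIV :: nat set) (\<lambda>_. M)"
        by (rule prod_algebraI) auto
      finally show "range (\<lambda>_::nat. ?\<Omega>) \<subseteq> prod_algebra (UNIV :: nat set) (\<lambda>_. M)" by auto
      show "(\<Union>i::nat. ?\<Omega>) = ?\<Omega>" by (rule UN_constant_eq[of 0]) simp_all
      show "emeasure (density law (indicator A)) ?\<Omega> \<noteq> \<infinity>"
        unfolding \<Omega> using dA[OF sets.top] by simp
      fix X assume X: "X \<in> prod_algebra (UNIV :: nat set) (\<lambda>_. M)"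
      then have "X \<in> sets paths" unfolding sets_PiM by (rule sigma_sets.Basic)
      then show "emeasure (density law (indicator A)) X = emeasure (density law (\<lambda>_. ennreal c)) X"
        using dA dc cyl[OF X] by simp
    qed
    then show ?thesis using dA[OF that] dc[OF that] by simp
  qed
  have c1: "emeasure law A = ennreal c"
    using all[of "space law"] A sets.sets_into_space[OF A] law.emeasure_space_1
    by (simp add: space_law Int_absorb2)
  have "emeasure law A = emeasure law A * emeasure law A"
    using all[OF A] c1 by simp
  moreover have "emeasure law A \<noteq> \<infinity>" by simp
  ultimately show "emeasure law A \<in> {0, 1}"
    by (auto simp: law.emeasure_eq_measure ennreal_mult[symmetric])
qed

end

end

section \<open>The table near a smooth boundary point\<close>

lemma plane_frame:
  fixes a x :: plane
  assumes "norm a = 1"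
  shows "x = (x \<bullet> a) *\<^sub>R a + (x \<bullet> (- snd a, fst a)) *\<^sub>R (- snd a, fst a)"
proof -
  obtain p q where a: "a = (p, q)" by (cases a)
  obtain u v where x: "x = (u, v)" by (cases x)
  have 1: "p * p + q * q = 1"
    using assms unfolding a norm_Pair by (simp add: power2_eq_square)
  have "(u * p + v * q) * p + (v * p - u * q) * - q = u * (p * p + q * q)"
    "(u * p + v * q) * q + (v * p - u * q) * p = v * (p * p + q * q)"
    by (simp_all add: algebra_simps)
  then show ?thesis unfolding a x using 1 by (simp add: algebra_simps)
qed

lemma norm_rot: "norm (- snd a, fst a) = norm (a :: plane)"
  by (cases a) (simp add: norm_Pair)

lemma inner_rot: "(a :: plane) \<bullet> (- snd a, fst a) = 0" "(- snd a, fst a) \<bullet> (a :: plane) = 0"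
  by (simp_all add: inner_prod_def mult.commute)

locale classical_billiard =
  fixes T :: billiard_table
  assumes classical: "classical_table T"
begin

abbreviation "N \<equiv> ncurves T"
abbreviation "domain \<equiv> interior (region T)"

lemma compact_region: "compact (region T)" and connected_domain: "connected domain"
  and domain_nonempty: "domain \<noteq> {}" and N_pos: "1 \<le> N"
  and frontier_region: "frontier (region T) = (\<Union>i<N. wall T i ` {lo T i..hi T i})"
  using classical unfolding classical_table_def by auto

lemma
  assumes "i < N"
  shows lo_less_hi: "lo T i < hi T i"
    and piecewise_smooth: "piecewise_Ck_on 3 (wall T i) (lo T i) (hi T i)"
    and inj_wall: "inj_on (wall T i) {lo T i..<hi T i}"
    and closed_wall: "wall T i (lo T i) = wall T i (hi T i)"
    and finite_exempt: "finite {r. smooth_point T i r \<and>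
          \<not> (\<forall>\<^sub>F t in at_right 0. wall T i r + t *\<^sub>R normal T i r \<in> domain)}"
  using classical assms unfolding classical_table_def by auto

lemma disjoint_walls:
  "i < N \<Longrightarrow> j < N \<Longrightarrow> i \<noteq> j \<Longrightarrow> r \<in> {lo T i<..<hi T i} \<Longrightarrow> r' \<in> {lo T j<..<hi T j} \<Longrightarrow>
    wall T i r \<noteq> wall T j r'"
  using classical unfolding classical_table_def disjoint_family_on_def by blast

lemma norm_tangent: "smooth_point T i r \<Longrightarrow> norm (tangent T i r) = 1"
  using classical unfolding classical_table_def smooth_point_def by blast

lemma norm_normal: "smooth_point T i r \<Longrightarrow> norm (normal T i r) = 1"
  unfolding normal_def norm_rot by (rule norm_tangent)

lemma continuous_wall: "i < N \<Longrightarrow> continuous_on {lo T i..hi T i} (wall T i)"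
  using piecewise_smooth unfolding piecewise_Ck_on_def by blast

lemma smooth_bounds: "smooth_point T i r \<Longrightarrow> i < N \<and> lo T i < r \<and> r < hi T i"
  unfolding smooth_point_def by auto

text \<open>\<open>Ck_on\<close> only asserts the existence of derivatives within a closed interval.
  At interior points they are ordinary derivatives and so agree with \<open>tangent\<close> on an
  open interval, which allows the second derivative to be transferred to \<open>tangent\<close>
  itself.\<close>

lemma smooth_derivatives:
  assumes "smooth_point T i r"
  shows "(wall T i has_vector_derivative tangent T i r) (at r)"
    and "\<exists>t'. (tangent T i has_vector_derivative t') (at r)"
    and "open {r. smooth_point T i r}"
proof -
  have *: "\<exists>c d t'. c < r \<and> r < d \<and> (\<forall>x\<in>{c<..<d}. smooth_point T i x) \<and>
      (\<forall>x\<in>{c<..<d}. (wall T i has_vector_derivative tangent T i x) (at x)) \<and>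
      (tangent T i has_vector_derivative t') (at r)" if sm: "smooth_point T i r" for r
  proof -
    obtain c d where cd: "lo T i \<le> c" "c < r" "r < d" "d \<le> hi T i" "Ck_on 3 (wall T i) {c..d}" "i < N"
      using sm unfolding smooth_point_def by blast
    obtain f' where f': "\<And>x. x \<in> {c..d} \<Longrightarrow> (wall T i has_vector_derivative f' x) (at x within {c..d})"
      and C2: "Ck_on 2 f' {c..d}"
      using cd(5) unfolding numeral_3_eq_3 numeral_2_eq_2 Ck_on.simps(2)[of "Suc (Suc 0)"] by blast
    obtain f'' where f'': "\<And>x. x \<in> {c..d} \<Longrightarrow> (f' has_vector_derivative f'' x) (at x within {c..d})"
      using C2 unfolding numeral_2_eq_2 Ck_on.simps(2)[of "Suc 0"] by blast
    have at: "at x within {c..d} = at x" if "x \<in> {c<..<d}" for x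
      using that by (intro at_within_interior) simp
    have w: "(wall T i has_vector_derivative f' x) (at x)" if "x \<in> {c<..<d}" for x
      using f'[of x] at[OF that] that by auto
    have t: "tangent T i x = f' x" if "x \<in> {c<..<d}" for x
      unfolding tangent_def by (rule vector_derivative_at[OF w[OF that]])
    have "(f' has_vector_derivative f'' r) (at r)"
      using f''[of r] at[of r] cd by auto
    then have "(tangent T i has_vector_derivative f'' r) (at r)"
      by (rule has_vector_derivative_transform_within_open[where S="{c<..<d}"]) (use cd t in auto)
    moreover have "smooth_point T i x" if "x \<in> {c<..<d}" for x
      unfolding smooth_point_def using cd that by auto
    ultimately show ?thesis using cd w t by metis
  qed
  show "(wall T i has_vector_derivative tangent T i r) (at r)"
    "\<exists>t'. (tangent T i has_vector_derivative t') (at r)"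
    using *[OF assms] by auto
  show "open {r. smooth_point T i r}"
    unfolding open_subopen[of "{r. smooth_point T i r}"]
  proof clarify
    fix r assume "smooth_point T i r"
    from *[OF this] obtain c d where "c < r" "r < d" "\<forall>x\<in>{c<..<d}. smooth_point T i x" by blast
    then show "\<exists>U. open U \<and> r \<in> U \<and> U \<subseteq> {r. smooth_point T i r}"
      by (intro exI[of _ "{c<..<d}"]) auto
  qed
qed

lemma isCont_wall: "smooth_point T i r \<Longrightarrow> isCont (wall T i) r"
  using smooth_derivatives(1) has_vector_derivative_continuous by blast

lemma isCont_tangent: "smooth_point T i r \<Longrightarrow> isCont (tangent T i) r"
  using smooth_derivatives(2) has_vector_derivative_continuous by blast

lemma isCont_normal: "smooth_point T i r \<Longrightarrow> isCont (normal T i) r"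
  unfolding normal_def[abs_def] by (intro continuous_intros isCont_tangent)

lemma finite_not_smooth:
  assumes "i < N" shows "finite {r \<in> {lo T i..hi T i}. \<not> smooth_point T i r}"
proof -
  obtain S where S: "finite S" "\<And>c d. lo T i \<le> c \<Longrightarrow> c < d \<Longrightarrow> d \<le> hi T i \<Longrightarrow> {c<..<d} \<inter> S = {} \<Longrightarrow>
      Ck_on 3 (wall T i) {c..d}"
    using piecewise_smooth[OF assms] unfolding piecewise_Ck_on_def by auto
  have "smooth_point T i r" if r: "r \<in> {lo T i<..<hi T i} - S" for r
  proof -
    have "open ({lo T i<..<hi T i} - S)" using S(1) by (intro open_Diff finite_imp_closed) auto
    then obtain e where e: "e > 0" "cball r e \<subseteq> {lo T i<..<hi T i} - S"
      using r open_contains_cball by blast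
    have sub: "{r-e..r+e} \<subseteq> {lo T i<..<hi T i} - S" using e(2) by (simp add: cball_eq_atLeastAtMost)
    have "r - e \<in> {r-e..r+e}" "r + e \<in> {r-e..r+e}" using e(1) by auto
    then have "r - e \<in> {lo T i<..<hi T i}" "r + e \<in> {lo T i<..<hi T i}" using sub by blast+
    moreover have "Ck_on 3 (wall T i) {r-e..r+e}"
    proof (rule S(2))
      show "{r - e<..<r + e} \<inter> S = {}"
        using sub greaterThanLessThan_subseteq_atLeastAtMost_iff[of "r - e" "r + e" "r - e" "r + e"] by blast
    qed (use calculation e(1) in auto)
    ultimately show ?thesis unfolding smooth_point_def using assms e(1)
      by (intro conjI exI[of _ "r-e"] exI[of _ "r+e"]) auto
  qed
  then have "{r \<in> {lo T i..hi T i}. \<not> smooth_point T i r} \<subseteq> insert (lo T i) (insert (hi T i) S)"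
    by force
  then show ?thesis using S(1) finite_subset by blast
qed

text \<open>The parameters for which, locally, the boundary is a single smooth arc with the table on
  its left.\<close>

definition nice :: "nat \<Rightarrow> real \<Rightarrow> bool" where
  "nice i r \<longleftrightarrow> smooth_point T i r \<and>
    (\<forall>\<^sub>F t in at_right 0. wall T i r + t *\<^sub>R normal T i r \<in> domain) \<and>
    (\<forall>j<N. wall T i r \<noteq> wall T j (lo T j))"

lemma nice_smooth: "nice i r \<Longrightarrow> smooth_point T i r"
  by (simp add: nice_def)

lemma nice_bounds: "nice i r \<Longrightarrow> i < N \<and> lo T i < r \<and> r < hi T i"
  using nice_smooth smooth_bounds by blast

lemma finite_not_nice:
  assumes i: "i < N" shows "finite {r \<in> {lo T i..hi T i}. \<not> nice i r}"
proof -
  \<comment> \<open>Injectivity leaves at most one parameter over each base point;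
    \<open>SOME\<close> names it, with an irrelevant value if there is none.\<close>
  have fin: "finite {r \<in> {lo T i..<hi T i}. wall T i r = wall T j (lo T j)}" for j
  proof (rule finite_subset[OF _ finite.insertI[OF finite.emptyI]])
    show "{r \<in> {lo T i..<hi T i}. wall T i r = wall T j (lo T j)} \<subseteq>
      {SOME r. r \<in> {lo T i..<hi T i} \<and> wall T i r = wall T j (lo T j)}"
    proof
      fix r assume r: "r \<in> {r \<in> {lo T i..<hi T i}. wall T i r = wall T j (lo T j)}"
      let ?s = "SOME r. r \<in> {lo T i..<hi T i} \<and> wall T i r = wall T j (lo T j)"
      have "?s \<in> {lo T i..<hi T i} \<and> wall T i ?s = wall T j (lo T j)"
        by (rule someI[of _ r]) (use r in auto)
      then have "r = ?s" using r inj_onD[OF inj_wall[OF i], of r ?s] by simp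
      then show "r \<in> {?s}" by simp
    qed
  qed
  have "{r \<in> {lo T i..hi T i}. \<not> nice i r} \<subseteq> {r \<in> {lo T i..hi T i}. \<not> smooth_point T i r} \<union>
    {r. smooth_point T i r \<and> \<not> (\<forall>\<^sub>F t in at_right 0. wall T i r + t *\<^sub>R normal T i r \<in> domain)} \<union>
    (\<Union>j<N. {r \<in> {lo T i..<hi T i}. wall T i r = wall T j (lo T j)}) \<union> {hi T i}"
    unfolding nice_def by force
  moreover have "finite \<dots>"
    using finite_not_smooth[OF i] finite_exempt[OF i] fin by auto
  ultimately show ?thesis by (rule finite_subset)
qed

text \<open>The entering condition in \<open>nice\<close> is pointwise and not evidently open;
  openness follows because only finitely many parameters fail.\<close>

lemma open_nice: "open {r. nice i r}"
proof (cases "i < N")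
  case True
  have "{r. nice i r} = {lo T i<..<hi T i} - {r \<in> {lo T i..hi T i}. \<not> nice i r}"
    using nice_bounds by auto
  then show ?thesis
    by (metis finite_imp_closed finite_not_nice[OF True] open_Diff open_greaterThanLessThan)
next
  case False
  then have "{r. nice i r} = {}" using nice_bounds by auto
  then show ?thesis by simp
qed

text \<open>Two curves, or two parameters of one curve, can only meet at a base point of some curve,
  and \<open>nice\<close> excludes all base points.\<close>

lemma nice_unique:
  assumes r: "nice i r" and eq: "wall T i r = wall T j r'" and j: "j < N" "r' \<in> {lo T j..hi T j}"
  shows "j = i \<and> r' = r"
proof -
  have r': "r' \<noteq> lo T j" using r j eq unfolding nice_def by auto
  have r'': "r' \<noteq> hi T j" using r j eq closed_wall[OF j(1)] unfolding nice_def by auto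
  have in_j: "r' \<in> {lo T j<..<hi T j}" using r' r'' j by auto
  have ij: "j = i"
    using disjoint_walls[of i j r r'] nice_bounds[OF r] in_j j eq by auto
  moreover have "r' = r"
    using inj_onD[OF inj_wall[OF j(1)], of r' r] eq in_j nice_bounds[OF r] ij by auto
  ultimately show ?thesis by simp
qed

lemma wall_frontier: "i < N \<Longrightarrow> r \<in> {lo T i..hi T i} \<Longrightarrow> wall T i r \<in> frontier (region T)"
  unfolding frontier_region by blast

lemma nice_frontier: "nice i r \<Longrightarrow> wall T i r \<in> frontier (region T)"
  using wall_frontier[of i r] nice_bounds[of i r] by auto

text \<open>The rest of the boundary, namely the other curves and the curve \<open>i\<close> outside
  the parameter window, is compact and misses the point by \<open>nice_unique\<close>, so it stays
  at a positive distance.\<close>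

lemma nice_isolated:
  assumes r: "nice i r" and d: "0 < \<delta>"
  obtains \<beta> where "0 < \<beta>" "frontier (region T) \<inter> ball (wall T i r) \<beta> \<subseteq> wall T i ` {r - \<delta><..<r + \<delta>}"
proof -
  define K where "K = (\<Union>j\<in>{..<N} - {i}. wall T j ` {lo T j..hi T j}) \<union>
    wall T i ` ({lo T i..hi T i} - {r - \<delta><..<r + \<delta>})"
  have i: "i < N" using nice_bounds[OF r] by simp
  have "compact (wall T j ` {lo T j..hi T j})" if "j < N" for j
    using continuous_wall[OF that] by (intro compact_continuous_image) auto
  moreover have "compact (wall T i ` ({lo T i..hi T i} - {r - \<delta><..<r + \<delta>}))"
    by (intro compact_continuous_image continuous_on_subset[OF continuous_wall[OF i]] compact_diff) auto
  ultimately have "compact K"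
    unfolding K_def by (intro compact_Un compact_UN) auto
  then have "closed K" by (rule compact_imp_closed)
  moreover have "wall T i r \<notin> K"
    unfolding K_def using nice_unique[OF r] i d by force
  ultimately obtain \<beta> where b: "0 < \<beta>" "ball (wall T i r) \<beta> \<inter> K = {}"
    by (metis Compl_iff disjoint_eq_subset_Compl open_Compl open_contains_ball)
  have "frontier (region T) \<subseteq> K \<union> wall T i ` {r - \<delta><..<r + \<delta>}"
    unfolding frontier_region K_def by auto
  then show ?thesis using b that by blast
qed

text \<open>The mean value inequality with a tangent that varies by less than \<open>e\<close>. The
  estimate is uniform in both points, so the base point of later cone conditions may move along the
  arc.\<close>

lemma nice_linearization:
  assumes r: "nice i r" and e: "0 < e"
  obtains \<delta> where "0 < \<delta>" "\<And>x. \<bar>x - r\<bar> < \<delta> \<Longrightarrow> nice i x"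
    "\<And>x y. \<bar>x - r\<bar> < \<delta> \<Longrightarrow> \<bar>y - r\<bar> < \<delta> \<Longrightarrow>
      norm (wall T i y - wall T i x - (y - x) *\<^sub>R tangent T i r) \<le> e * \<bar>y - x\<bar>"
proof -
  have "\<forall>\<^sub>F x in nhds r. nice i x"
    using open_nice[of i] r eventually_nhds by blast
  moreover have "\<forall>\<^sub>F x in nhds r. dist (tangent T i x) (tangent T i r) < e"
    using isCont_tangent[OF nice_smooth[OF r]] e
    by (intro tendstoD) (simp_all add: isCont_def tendsto_at_iff_tendsto_nhds)
  ultimately have "\<forall>\<^sub>F x in nhds r. nice i x \<and> dist (tangent T i x) (tangent T i r) < e"
    by eventually_elim simp
  then obtain \<delta> where d: "0 < \<delta>"
    "\<And>x. dist x r < \<delta> \<Longrightarrow> nice i x \<and> dist (tangent T i x) (tangent T i r) < e"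
    by (auto simp: eventually_nhds_metric)
  show ?thesis
  proof
    show "0 < \<delta>" by fact
    show "nice i x" if "\<bar>x - r\<bar> < \<delta>" for x using d(2)[of x] that by (simp add: dist_real_def)
    fix x y assume xy: "\<bar>x - r\<bar> < \<delta>" "\<bar>y - r\<bar> < \<delta>"
    have "norm (wall T i y - wall T i x - (y - x) *\<^sub>R tangent T i r) \<le> norm (y - x) * e"
    proof (rule vector_differentiable_bound_linearization[where S="ball r \<delta>"])
      fix z assume z: "z \<in> ball r \<delta>"
      then have "nice i z \<and> dist (tangent T i z) (tangent T i r) < e"
        using d(2)[of z] by (simp add: dist_commute)
      then show "(wall T i has_vector_derivative tangent T i z) (at z within ball r \<delta>)"
        "norm (tangent T i z - tangent T i r) \<le> e"
        using smooth_derivatives(1) nice_smooth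
        by (auto intro: has_vector_derivative_at_within simp: dist_norm)
    next
      show "closed_segment x y \<subseteq> ball r \<delta>"
        using xy by (intro closed_segment_subset) (auto simp: dist_real_def abs_minus_commute)
    qed (use d in auto)
    then show "norm (wall T i y - wall T i x - (y - x) *\<^sub>R tangent T i r) \<le> e * \<bar>y - x\<bar>"
      by (simp add: mult.commute)
  qed
qed

text \<open>Near a nice point the two sides of the boundary are swept out by translates of the boundary
  arc along the normal, so each side is connected and misses the boundary. Both sides cannot lie in
  the table, as it is closed and the arc consists of frontier points.\<close>

lemma nice_local:
  assumes r: "nice i r" and e: "0 < e"
  obtains \<delta> \<rho> where "0 < \<delta>" "0 < \<rho>" "\<And>x. \<bar>x - r\<bar> < \<delta> \<Longrightarrow> nice i x"
    "\<And>r' x. \<bar>r' - r\<bar> < \<delta> \<Longrightarrow> norm x < \<rho> \<Longrightarrow> e * norm x < x \<bullet> normal T i r \<Longrightarrow> wall T i r' + x \<in> domain"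
    "\<And>r' x. \<bar>r' - r\<bar> < \<delta> \<Longrightarrow> norm x < \<rho> \<Longrightarrow> x \<bullet> normal T i r < - e * norm x \<Longrightarrow> wall T i r' + x \<notin> region T"
proof -
  let ?q = "wall T i" and ?\<tau> = "tangent T i r" and ?n = "normal T i r"
  have t1: "norm ?\<tau> = 1" and n1: "norm ?n = 1"
    using norm_tangent norm_normal nice_smooth[OF r] by auto
  have tn: "?\<tau> \<bullet> ?n = 0" "?n \<bullet> ?\<tau> = 0" unfolding normal_def by (rule inner_rot)+
  have frame: "x = (x \<bullet> ?\<tau>) *\<^sub>R ?\<tau> + (x \<bullet> ?n) *\<^sub>R ?n" for x
    unfolding normal_def by (rule plane_frame[OF t1])
  \<comment> \<open>The bound \<open>1/3\<close> makes the tangential coordinate injective along the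
    arc and lets a parameter step \<open>3/2 * norm x\<close> cover a tangential displacement
    \<open>norm x\<close>; the bound \<open>e / 2\<close> keeps the normal error
    \<open>3/2 * e1 * norm x\<close> below \<open>e * norm x\<close>.\<close>
  define e1 where "e1 = min (1/3) (e / 2)"
  have e1: "0 < e1" "e1 \<le> 1/3" "2 * e1 \<le> e" using e by (auto simp: e1_def min_def)
  obtain \<delta>0 where d0: "0 < \<delta>0" "\<And>x. \<bar>x - r\<bar> < \<delta>0 \<Longrightarrow> nice i x"
    and lin: "\<And>x y. \<bar>x - r\<bar> < \<delta>0 \<Longrightarrow> \<bar>y - r\<bar> < \<delta>0 \<Longrightarrow> norm (?q y - ?q x - (y - x) *\<^sub>R ?\<tau>) \<le> e1 * \<bar>y - x\<bar>"
    using nice_linearization[OF r e1(1)] by metis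
  obtain \<beta> where b: "0 < \<beta>" "frontier (region T) \<inter> ball (?q r) \<beta> \<subseteq> ?q ` {r - \<delta>0<..<r + \<delta>0}"
    using nice_isolated[OF r d0(1)] by metis
  define \<delta> where "\<delta> = min \<delta>0 (\<beta> / 4)"
  have d: "0 < \<delta>" "\<delta> \<le> \<delta>0" "\<delta> \<le> \<beta> / 4" using d0 b by (auto simp: \<delta>_def)
  have lin_t: "\<bar>(?q y - ?q x) \<bullet> ?\<tau> - (y - x)\<bar> \<le> e1 * \<bar>y - x\<bar>"
    and lin_n: "\<bar>(?q y - ?q x) \<bullet> ?n\<bar> \<le> e1 * \<bar>y - x\<bar>"
    if xy: "\<bar>x - r\<bar> < \<delta>0" "\<bar>y - r\<bar> < \<delta>0" for x y
  proof -
    let ?w = "?q y - ?q x - (y - x) *\<^sub>R ?\<tau>"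
    have "\<bar>?w \<bullet> ?\<tau>\<bar> \<le> norm ?w * norm ?\<tau>" "\<bar>?w \<bullet> ?n\<bar> \<le> norm ?w * norm ?n"
      by (rule Cauchy_Schwarz_ineq2)+
    moreover have "?w \<bullet> ?\<tau> = (?q y - ?q x) \<bullet> ?\<tau> - (y - x)"
      using t1 by (simp add: inner_diff_left norm_eq_1)
    moreover have "?w \<bullet> ?n = (?q y - ?q x) \<bullet> ?n"
      by (simp add: inner_diff_left tn)
    ultimately show "\<bar>(?q y - ?q x) \<bullet> ?\<tau> - (y - x)\<bar> \<le> e1 * \<bar>y - x\<bar>"
      "\<bar>(?q y - ?q x) \<bullet> ?n\<bar> \<le> e1 * \<bar>y - x\<bar>"
      using lin[OF xy] t1 n1 by auto
  qed
  \<comment> \<open>The strip of width \<open>\<beta> / 4\<close> on the side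
    \<open>\<sigma> = 1\<close> or \<open>\<sigma> = -1\<close> of the arc, made of fibres parallel
    to the fixed normal at \<open>r\<close>.\<close>
  define U where "U \<sigma> = (\<lambda>(x, t). ?q x + (\<sigma> * t) *\<^sub>R ?n) ` ({r - \<delta><..<r + \<delta>} \<times> {0<..<\<beta> / 4})" for \<sigma> :: real
  have U_frontier: "U \<sigma> \<inter> frontier (region T) = {}" if s: "\<bar>\<sigma>\<bar> = 1" for \<sigma>
  proof (rule ccontr)
    assume "U \<sigma> \<inter> frontier (region T) \<noteq> {}"
    then obtain p where p: "p \<in> U \<sigma>" "p \<in> frontier (region T)" by blast
    from p(1) obtain z where z: "z \<in> {r - \<delta><..<r + \<delta>} \<times> {0<..<\<beta> / 4}"
      "p = (\<lambda>(x, t). ?q x + (\<sigma> * t) *\<^sub>R ?n) z"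
      unfolding U_def by blast
    obtain x t where xz: "z = (x, t)" by (cases z)
    have xt: "\<bar>x - r\<bar> < \<delta>" "0 < t" "t < \<beta> / 4"
      and fr: "?q x + (\<sigma> * t) *\<^sub>R ?n \<in> frontier (region T)"
      using z p(2) unfolding xz by auto
    have "norm (?q x - ?q r) \<le> norm (?q x - ?q r - (x - r) *\<^sub>R ?\<tau>) + norm ((x - r) *\<^sub>R ?\<tau>)"
      by (metis diff_add_cancel norm_triangle_ineq)
    also have "\<dots> \<le> e1 * \<bar>x - r\<bar> + \<bar>x - r\<bar>"
      using lin[of r x] xt d d0 t1 by auto
    also have "\<dots> \<le> 2 * \<bar>x - r\<bar>" using e1 by (simp add: mult_left_le_one_le)
    also have "\<dots> < \<beta> / 2" using xt d by simp
    finally have "norm (?q x - ?q r) < \<beta> / 2" .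
    moreover have "norm ((\<sigma> * t) *\<^sub>R ?n) < \<beta> / 4" using xt s n1 by (simp add: abs_mult)
    ultimately have "norm ((?q x - ?q r) + (\<sigma> * t) *\<^sub>R ?n) < \<beta>"
      using norm_triangle_ineq[of "?q x - ?q r" "(\<sigma> * t) *\<^sub>R ?n"] b(1) by linarith
    then have "?q x + (\<sigma> * t) *\<^sub>R ?n \<in> ball (?q r) \<beta>"
      by (simp add: dist_norm norm_minus_commute algebra_simps)
    then obtain y where y: "\<bar>y - r\<bar> < \<delta>0" "?q y = ?q x + (\<sigma> * t) *\<^sub>R ?n"
      using b(2) fr by (force simp: abs_less_iff)
    \<comment> \<open>A boundary point on a fibre has the same tangential coordinate as the foot of
      the fibre, and this coordinate is injective along the arc.\<close>
    have "(?q y - ?q x) \<bullet> ?\<tau> = 0" using y(2) by (simp add: tn)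
    then have "\<bar>y - x\<bar> \<le> e1 * \<bar>y - x\<bar>" using lin_t[of x y] xt d y by auto
    also have "\<dots> \<le> 1/3 * \<bar>y - x\<bar>" using e1 by (intro mult_right_mono) auto
    finally have "y = x" by simp
    then show False using y(2) xt s n1 by auto
  qed
  have U_connected: "connected (U \<sigma>)" for \<sigma>
    unfolding U_def
  proof (rule connected_continuous_image)
    have "continuous_on ({r - \<delta><..<r + \<delta>} \<times> {0<..<\<beta> / 4}) (\<lambda>z. ?q (fst z))"
    proof (rule continuous_on_compose2[OF _ continuous_on_fst[OF continuous_on_id]])
      show "continuous_on {r - \<delta><..<r + \<delta>} ?q"
        by (intro continuous_at_imp_continuous_on ballI isCont_wall nice_smooth d0) (use d in auto)
    qed auto
    then show "continuous_on ({r - \<delta><..<r + \<delta>} \<times> {0<..<\<beta> / 4}) (\<lambda>(x, t). ?q x + (\<sigma> * t) *\<^sub>R ?n)"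
      unfolding split_beta by (intro continuous_intros)
    show "connected ({r - \<delta><..<r + \<delta>} \<times> {0<..<\<beta> / 4})"
      by (intro convex_connected convex_Times) auto
  qed
  define \<rho> where "\<rho> = min (\<delta> / 4) (\<beta> / 8)"
  have rho: "0 < \<rho>" "\<rho> \<le> \<delta> / 4" "\<rho> \<le> \<beta> / 8" using d b by (auto simp: \<rho>_def)
  \<comment> \<open>Every point near the arc lies on a fibre: the intermediate value theorem finds
    the foot \<open>r2\<close>, and the height \<open>y\<close> differs from the normal component of
    \<open>x\<close> by at most \<open>e * norm x\<close>.\<close>
  have chart: "\<exists>r2 y. \<bar>r2 - r\<bar> < \<delta> \<and> \<bar>y\<bar> < \<beta> / 4 \<and> \<bar>y - x \<bullet> ?n\<bar> \<le> e * norm x \<and> ?q r' + x = ?q r2 + y *\<^sub>R ?n"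
    if r': "\<bar>r' - r\<bar> < \<delta> / 2" and x: "norm x < \<rho>" for r' and x :: plane
  proof -
    define h where "h = 3/2 * norm x"
    have h: "0 \<le> h" "h < \<delta> / 2" using x rho d by (auto simp: h_def)
    have r'0: "\<bar>r' - r\<bar> < \<delta>0" using r' d by auto
    have near: "\<bar>z - r\<bar> < \<delta>" if "r' - h \<le> z" "z \<le> r' + h" for z using that h r' by linarith
    have near0: "\<bar>z - r\<bar> < \<delta>0" if "r' - h \<le> z" "z \<le> r' + h" for z using near[OF that] d by auto
    have eh: "e1 * h \<le> h / 3" using e1 h mult_right_mono[of e1 "1/3" h] by simp
    have xt: "\<bar>x \<bullet> ?\<tau>\<bar> \<le> norm x" using Cauchy_Schwarz_ineq2[of x ?\<tau>] t1 by simp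
    let ?f = "\<lambda>z. (?q z - ?q r') \<bullet> ?\<tau>"
    have "\<bar>?f (r' - h) + h\<bar> \<le> e1 * h" "\<bar>?f (r' + h) - h\<bar> \<le> e1 * h"
      using lin_t[of r' "r' - h"] lin_t[of r' "r' + h"] near0[of "r' - h"] near0[of "r' + h"] r'0 h by simp_all
    then have "?f (r' - h) \<le> x \<bullet> ?\<tau>" "x \<bullet> ?\<tau> \<le> ?f (r' + h)"
      using eh xt h_def by linarith+
    moreover have "continuous_on {r' - h..r' + h} ?f"
      by (intro continuous_intros continuous_at_imp_continuous_on ballI isCont_wall nice_smooth d0 near0) auto
    ultimately obtain r2 where r2: "r' - h \<le> r2" "r2 \<le> r' + h" "?f r2 = x \<bullet> ?\<tau>"
      using IVT'[of ?f "r' - h" "x \<bullet> ?\<tau>" "r' + h"] h(1) by auto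
    define y where "y = (?q r' + x - ?q r2) \<bullet> ?n"
    have "(?q r' + x - ?q r2) \<bullet> ?\<tau> = 0"
      using r2(3) by (simp add: inner_diff_left inner_add_left)
    then have eq: "?q r' + x - ?q r2 = y *\<^sub>R ?n"
      using frame[of "?q r' + x - ?q r2"] by (simp add: y_def)
    have yx: "y - x \<bullet> ?n = - ((?q r2 - ?q r') \<bullet> ?n)"
      by (simp add: y_def inner_diff_left inner_add_left)
    have "\<bar>y - x \<bullet> ?n\<bar> \<le> e1 * \<bar>r2 - r'\<bar>"
      unfolding yx using lin_n[of r' r2] r'0 near0[OF r2(1,2)] by simp
    also have "\<dots> \<le> e1 * h" using r2 e1 by (intro mult_left_mono) auto
    finally have y1: "\<bar>y - x \<bullet> ?n\<bar> \<le> e1 * h" .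
    also have "e1 * h \<le> e * norm x"
    proof -
      have "e1 * h = (3/2 * e1) * norm x" by (simp add: h_def)
      also have "\<dots> \<le> e * norm x" using e1 by (intro mult_right_mono) auto
      finally show ?thesis .
    qed
    finally have y2: "\<bar>y - x \<bullet> ?n\<bar> \<le> e * norm x" .
    have "\<bar>x \<bullet> ?n\<bar> \<le> norm x" using Cauchy_Schwarz_ineq2[of x ?n] n1 by simp
    then have "\<bar>y\<bar> \<le> 2 * norm x" using y1 eh h_def by linarith
    then have "\<bar>y\<bar> < \<beta> / 4" using x rho by simp
    then show ?thesis
      using near[OF r2(1,2)] y2 eq by (intro exI[of _ r2] exI[of _ y]) (auto simp: algebra_simps)
  qed
  have in_U: "?q r2 + y *\<^sub>R ?n \<in> U \<sigma>" if "\<bar>r2 - r\<bar> < \<delta>" "\<bar>y\<bar> < \<beta> / 4" "0 < \<sigma> * y" "\<bar>\<sigma>\<bar> = 1" for r2 y \<sigma>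
  proof -
    have "\<bar>y\<bar> = \<sigma> * y" "\<sigma> * \<sigma> = 1" using that(3,4)
      by (metis abs_mult abs_of_pos mult_1) (use that(4) abs_mult_self_eq[of \<sigma>] in simp)
    then have "\<sigma> * \<bar>y\<bar> = y" by (metis mult.assoc mult_1)
    moreover have "0 < \<bar>y\<bar>" using that by auto
    ultimately show ?thesis unfolding U_def using that
      by (intro image_eqI[of _ _ "(r2, \<bar>y\<bar>)"]) auto
  qed
  have "\<forall>\<^sub>F t in at_right 0. ?q r + t *\<^sub>R ?n \<in> domain" using r by (simp add: nice_def)
  moreover have "\<forall>\<^sub>F t in at_right 0. t < \<beta> / 4"
    using b by (intro eventually_at_rightI[of 0 "\<beta> / 4"]) auto
  moreover have "\<forall>\<^sub>F t :: real in at_right 0. 0 < t" by (rule eventually_at_right_less)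
  ultimately have "\<forall>\<^sub>F t in at_right 0. ?q r + t *\<^sub>R ?n \<in> domain \<and> t < \<beta> / 4 \<and> 0 < t"
    by eventually_elim simp
  then obtain t where t: "?q r + t *\<^sub>R ?n \<in> domain" "t < \<beta> / 4" "0 < t"
    using eventually_happens'[OF trivial_limit_at_right_real] by blast
  have "?q r + t *\<^sub>R ?n \<in> U 1" using in_U[of r t 1] t d by simp
  then have "U 1 \<inter> region T \<noteq> {}" using t interior_subset by blast
  then have "U 1 \<subseteq> region T"
    using connected_Int_frontier[OF U_connected[of 1]] U_frontier[of 1] by auto
  then have U1: "U 1 \<subseteq> domain"
    using U_frontier[of 1] compact_imp_closed[OF compact_region] by (auto simp: frontier_def)
  have U2: "U (-1) \<inter> region T = {}"
  proof (rule ccontr)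
    assume "U (-1) \<inter> region T \<noteq> {}"
    then have sub: "U (-1) \<subseteq> region T"
      using connected_Int_frontier[OF U_connected[of "-1"]] U_frontier[of "-1"] by auto
    \<comment> \<open>If the outer side belonged to the table as well, the two sides and the arc
      would fill a ball around a frontier point.\<close>
    have "ball (?q r) \<rho> \<subseteq> region T"
    proof
      fix z assume "z \<in> ball (?q r) \<rho>"
      then have "norm (z - ?q r) < \<rho>" by (simp add: dist_norm norm_minus_commute)
      then obtain r2 y where *: "\<bar>r2 - r\<bar> < \<delta>" "\<bar>y\<bar> < \<beta> / 4" "?q r + (z - ?q r) = ?q r2 + y *\<^sub>R ?n"
        using chart[of r "z - ?q r"] d by auto
      have fr: "?q r2 \<in> region T"
        using nice_frontier[OF d0(2), of r2] * d frontier_subset_closed[OF compact_imp_closed[OF compact_region]] by auto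
      consider "0 < y" | "y < 0" | "y = 0" by linarith
      then show "z \<in> region T"
        using in_U[of r2 y 1] in_U[of r2 y "-1"] * U1 sub fr interior_subset by cases auto
    qed
    then have "?q r \<in> domain" using rho by (meson centre_in_ball interiorI open_ball)
    then show False using nice_frontier[OF r] by (simp add: frontier_def)
  qed
  show ?thesis
  proof
    show "0 < \<delta> / 2" "0 < \<rho>" using d rho by auto
    show "nice i x" if "\<bar>x - r\<bar> < \<delta> / 2" for x using d0(2)[of x] that d by simp
    fix r' and x :: plane assume *: "\<bar>r' - r\<bar> < \<delta> / 2" "norm x < \<rho>"
    obtain r2 y where y: "\<bar>r2 - r\<bar> < \<delta>" "\<bar>y\<bar> < \<beta> / 4" "\<bar>y - x \<bullet> ?n\<bar> \<le> e * norm x" "?q r' + x = ?q r2 + y *\<^sub>R ?n"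
      using chart[OF *] by blast
    show "?q r' + x \<in> domain" if "e * norm x < x \<bullet> ?n"
    proof -
      have "0 < y" using y(3) that by linarith
      then show ?thesis using in_U[of r2 y 1] y U1 by auto
    qed
    show "?q r' + x \<notin> region T" if "x \<bullet> ?n < - e * norm x"
    proof -
      have "y < 0" using y(3) that by linarith
      then have "?q r' + x \<in> U (-1)" using in_U[of r2 y "-1"] y by simp
      then show ?thesis using U2 by blast
    qed
  qed
qed

end

section \<open>Chords of the table\<close>

lemma open_nhdsI:
  assumes "\<And>x. x \<in> S \<Longrightarrow> \<forall>\<^sub>F y in nhds x. y \<in> S"
  shows "open S"
proof (subst open_subopen, intro ballI)
  fix x assume "x \<in> S"
  then obtain U where "open U" "x \<in> U" "\<forall>y\<in>U. y \<in> S"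
    using assms[of x] by (auto simp: eventually_nhds)
  then show "\<exists>U. open U \<and> x \<in> U \<and> U \<subseteq> S" by blast
qed

lemma compact_subset_open_thicken:
  fixes K U :: "'a :: heine_borel set"
  assumes "compact K" "open U" "K \<subseteq> U"
  obtains \<epsilon> where "0 < \<epsilon>" "\<And>x y. x \<in> K \<Longrightarrow> dist x y < \<epsilon> \<Longrightarrow> y \<in> U"
proof (cases "K = {} \<or> U = UNIV")
  case True
  then show ?thesis using that[of 1] by auto
next
  case False
  then have ne: "K \<noteq> {}" "- U \<noteq> {}" by auto
  have "K \<inter> - U = {}" using assms(3) by auto
  then obtain d where d: "0 < d" "\<And>x y. x \<in> K \<Longrightarrow> y \<in> - U \<Longrightarrow> d \<le> dist x y"
    using separate_compact_closed[OF assms(1) closed_Compl[OF assms(2)]] by auto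
  show ?thesis using d by (intro that[of d]) force+
qed

context classical_billiard
begin

lemma closed_region: "closed (region T)"
  by (rule compact_imp_closed[OF compact_region])

section \<open>Rays inside the table\<close>

text \<open>The infimum of the exit times works. Its point is not interior, and it cannot lie
  outside the closed region either, as the points just before it would then be outside too.\<close>

lemma first_exit:
  fixes z v :: plane
  assumes ab: "a \<le> b" and a: "z + a *\<^sub>R v \<in> domain" and b: "z + b *\<^sub>R v \<notin> domain"
  obtains t where "a < t" "t \<le> b" "z + t *\<^sub>R v \<in> frontier (region T)"
    "\<And>u. a \<le> u \<Longrightarrow> u < t \<Longrightarrow> z + u *\<^sub>R v \<in> domain"
proof -
  let ?f = "\<lambda>u. z + u *\<^sub>R v"
  define S where "S = {u \<in> {a..b}. ?f u \<notin> domain}"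
  have "S = {a..b} \<inter> ?f -` (- domain)" unfolding S_def by auto
  moreover have "closed ({a..b} \<inter> ?f -` (- domain))"
    by (intro closed_Int closed_vimage continuous_intros) auto
  ultimately have cl: "closed S" by simp
  have ne: "S \<noteq> {}" using ab b by (auto simp: S_def)
  have bd: "bdd_below S" by (auto simp: S_def)
  define t where "t = Inf S"
  have tS: "t \<in> S" unfolding t_def by (rule closed_contains_Inf[OF ne bd cl])
  have before: "?f u \<in> domain" if "a \<le> u" "u < t" for u
    using cInf_lower[OF _ bd, of u] that tS by (force simp: S_def t_def)
  have at: "a < t" using tS a by (cases "a = t") (auto simp: S_def)
  have "?f t \<in> frontier (region T)"
  proof (rule ccontr)
    assume "?f t \<notin> frontier (region T)"
    then have out: "?f t \<in> - region T"
      using tS closed_region by (auto simp: S_def frontier_def)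
    have "\<forall>\<^sub>F u in at_left t. ?f u \<in> - region T"
      by (rule topological_tendstoD[OF _ _ out])
        (use closed_region in \<open>auto intro!: tendsto_eq_intros\<close>)
    moreover have "\<forall>\<^sub>F u in at_left t. u \<in> {a<..<t}"
      by (rule eventually_at_leftI[OF _ at]) simp
    ultimately have "\<forall>\<^sub>F u in at_left t. False"
    proof eventually_elim
      case (elim u)
      then show False using before[of u] interior_subset[of "region T"] by auto
    qed
    then show False by simp
  qed
  then show ?thesis using that at tS before by (auto simp: S_def)
qed

lemma leaves_domain:
  fixes z v :: plane
  assumes "v \<noteq> 0"
  shows "\<exists>b>a. z + b *\<^sub>R v \<notin> domain"
proof -
  obtain B where B: "\<And>x. x \<in> domain \<Longrightarrow> norm x \<le> B"
    using bounded_subset[OF compact_imp_bounded[OF compact_region] interior_subset]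
    by (auto simp: bounded_iff)
  define b where "b = max (a + 1) ((B + norm z + 1) / norm v)"
  have "b > a" by (simp add: b_def)
  moreover have "z + b *\<^sub>R v \<notin> domain"
  proof
    assume "z + b *\<^sub>R v \<in> domain"
    then have "norm (z + b *\<^sub>R v) \<le> B" by (rule B)
    moreover have "norm (b *\<^sub>R v) \<le> norm (z + b *\<^sub>R v) + norm z"
      using norm_triangle_ineq4[of "z + b *\<^sub>R v" z] by simp
    moreover have "B + norm z + 1 \<le> b * norm v"
      using assms by (simp add: b_def pos_divide_le_eq[symmetric])
    moreover have "b * norm v \<le> norm (b *\<^sub>R v)" by (simp add: mult_right_mono)
    ultimately show False by linarith
  qed
  ultimately show ?thesis by blast
qed

text \<open>Only the open flight interval must lie in the interior, so the definition serves
  interior starting points as well as rays leaving the boundary. A negative normal component means a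
  transversal arrival from inside.\<close>

definition hit :: "plane \<Rightarrow> plane \<Rightarrow> nat \<Rightarrow> real \<Rightarrow> real \<Rightarrow> bool" where
  "hit z v j r t \<longleftrightarrow> 0 < t \<and> z + t *\<^sub>R v = wall T j r \<and>
    (\<forall>u. 0 < u \<and> u < t \<longrightarrow> z + u *\<^sub>R v \<in> domain) \<and> nice j r \<and> v \<bullet> normal T j r < 0"

text \<open>No first-hit condition is included and only the line spanned by \<open>v\<close>
  matters, so bad lines can be described by equations in the boundary parameters.\<close>

definition bad_point :: "plane \<Rightarrow> plane \<Rightarrow> bool" where
  "bad_point v p \<longleftrightarrow> (\<exists>j<N. \<exists>r\<in>{lo T j..hi T j}. p = wall T j r \<and> (\<not> nice j r \<or> v \<bullet> normal T j r = 0))"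

text \<open>With \<open>e\<close> half the cosine between \<open>v\<close> and the normal,
  \<open>v\<close> lies strictly inside the cone of \<open>nice_local\<close>; small multiples of
  \<open>v\<close> stay in that cone, those of \<open>- v\<close> in the opposite one.\<close>

lemma ray_enters_domain:
  assumes r: "nice i r" and v: "0 < v \<bullet> normal T i r"
  obtains \<eta> where "0 < \<eta>" "\<And>u. 0 < u \<Longrightarrow> u < \<eta> \<Longrightarrow> wall T i r + u *\<^sub>R v \<in> domain"
    "\<And>u. 0 < u \<Longrightarrow> u < \<eta> \<Longrightarrow> wall T i r - u *\<^sub>R v \<notin> region T"
proof -
  have v0: "norm v > 0" using v by auto
  define e where "e = (v \<bullet> normal T i r) / (2 * norm v)"
  have e: "0 < e" "e * norm v < v \<bullet> normal T i r" using v v0 by (auto simp: e_def)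
  obtain \<delta> \<rho> where *: "0 < \<delta>" "0 < \<rho>"
    "\<And>r' x. \<bar>r' - r\<bar> < \<delta> \<Longrightarrow> norm x < \<rho> \<Longrightarrow> e * norm x < x \<bullet> normal T i r \<Longrightarrow> wall T i r' + x \<in> domain"
    "\<And>r' x. \<bar>r' - r\<bar> < \<delta> \<Longrightarrow> norm x < \<rho> \<Longrightarrow> x \<bullet> normal T i r < - e * norm x \<Longrightarrow> wall T i r' + x \<notin> region T"
    using nice_local[OF r e(1)] by metis
  show ?thesis
  proof
    show "0 < \<rho> / norm v" using * v0 by simp
    fix u assume u: "0 < u" "u < \<rho> / norm v"
    then have n: "norm (u *\<^sub>R v) < \<rho>" using v0 by (simp add: pos_less_divide_eq)
    have "e * (u * norm v) < u * (v \<bullet> normal T i r)"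
      using e(2) u(1) by (simp add: mult.left_commute)
    then show "wall T i r + u *\<^sub>R v \<in> domain" "wall T i r - u *\<^sub>R v \<notin> region T"
      using *(3)[of r "u *\<^sub>R v"] *(4)[of r "- (u *\<^sub>R v)"] n *(1) u(1) by auto
  qed
qed

text \<open>A ray from inside the table cannot arrive at a nice point from the outer side.\<close>

lemma ray_hit:
  fixes z v :: plane
  assumes v: "v \<noteq> 0" and \<eta>: "0 < \<eta>" "\<And>u. 0 < u \<Longrightarrow> u < \<eta> \<Longrightarrow> z + u *\<^sub>R v \<in> domain"
  shows "(\<exists>j r t. hit z v j r t) \<or> (\<exists>t>0. bad_point v (z + t *\<^sub>R v))"
proof -
  have a: "z + (\<eta> / 2) *\<^sub>R v \<in> domain" using \<eta> by simp
  obtain b where "b > \<eta> / 2" "z + b *\<^sub>R v \<notin> domain" using leaves_domain[OF v] by blast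
  then obtain t where t: "\<eta> / 2 < t" "z + t *\<^sub>R v \<in> frontier (region T)"
    "\<And>u. \<eta> / 2 \<le> u \<Longrightarrow> u < t \<Longrightarrow> z + u *\<^sub>R v \<in> domain"
    using first_exit[of "\<eta> / 2" b z v] a by (metis less_imp_le)
  have dom: "z + u *\<^sub>R v \<in> domain" if "0 < u" "u < t" for u
    using t(3)[of u] \<eta>(2)[of u] that \<eta>(1) by (cases "u < \<eta>") auto
  obtain j r where j: "j < N" "r \<in> {lo T j..hi T j}" "z + t *\<^sub>R v = wall T j r"
    using t(2) unfolding frontier_region by auto
  show ?thesis
  proof (cases "nice j r \<and> v \<bullet> normal T j r \<noteq> 0")
    case True
    have "\<not> 0 < v \<bullet> normal T j r"
    proof
      assume "0 < v \<bullet> normal T j r"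
      then obtain \<theta> where \<theta>: "0 < \<theta>" "\<And>u. 0 < u \<Longrightarrow> u < \<theta> \<Longrightarrow> wall T j r - u *\<^sub>R v \<notin> region T"
        using ray_enters_domain[of j r v] True by metis
      define u where "u = min \<theta> t / 2"
      have u: "0 < u" "u < \<theta>" "u < t" using \<theta>(1) t(1) \<eta>(1) by (auto simp: u_def)
      have "wall T j r - u *\<^sub>R v = z + (t - u) *\<^sub>R v"
        unfolding j(3)[symmetric] by (simp add: algebra_simps)
      then show False using \<theta>(2)[OF u(1,2)] dom[of "t - u"] u interior_subset[of "region T"] by auto
    qed
    then have "hit z v j r t"
      unfolding hit_def using True t(1) \<eta>(1) dom j by auto
    then show ?thesis by blast
  next
    case False
    then have "bad_point v (z + t *\<^sub>R v)"
      unfolding bad_point_def using j by blast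
    then show ?thesis using t(1) \<eta>(1) by (intro disjI2 exI[of _ t]) auto
  qed
qed

text \<open>A perturbed ray stays in the interior until shortly before the old hit, being close to a
  compact segment, and is outside the region shortly after it. So it leaves in between, close to the
  old point, where the frontier consists of a single arc of the same curve \<open>j\<close>;
  transversality persists by continuity.\<close>

lemma open_hit:
  assumes z: "z \<in> domain" and h: "hit z v j r t"
  shows "\<forall>\<^sub>F w in nhds (z, v). \<exists>r' t'. hit (fst w) (snd w) j r' t'"
proof -
  let ?p = "wall T j r"
  have r: "nice j r" and vn: "v \<bullet> normal T j r < 0" and t: "0 < t" "z + t *\<^sub>R v = ?p"
    and dom: "\<And>u. 0 < u \<Longrightarrow> u < t \<Longrightarrow> z + u *\<^sub>R v \<in> domain"
    using h by (auto simp: hit_def)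
  have v0: "v \<noteq> 0" using vn by auto
  have "((\<lambda>w. fst w) \<longlongrightarrow> v) (nhds (v, r))" and s: "((\<lambda>w. snd w) \<longlongrightarrow> r) (nhds (v, r))"
    using tendsto_fst[OF filterlim_ident, of "(v, r)"] tendsto_snd[OF filterlim_ident, of "(v, r)"] by auto
  then have "((\<lambda>w. fst w \<bullet> normal T j (snd w)) \<longlongrightarrow> v \<bullet> normal T j r) (nhds (v, r))"
    by (intro tendsto_inner isCont_tendsto_compose[OF isCont_normal[OF nice_smooth[OF r]]])
  then have "\<forall>\<^sub>F w in nhds (v, r). fst w \<bullet> normal T j (snd w) < 0"
    by (rule order_tendstoD) (rule vn)
  then obtain d1 where d1: "0 < d1" "\<And>w. dist w (v, r) < d1 \<Longrightarrow> fst w \<bullet> normal T j (snd w) < 0"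
    by (auto simp: eventually_nhds_metric)
  obtain d2 where d2: "0 < d2" "ball r d2 \<subseteq> {r. nice j r}"
    using open_nice[of j] r open_contains_ball by blast
  define \<delta> where "\<delta> = min (d1 / 2) d2"
  have \<delta>: "0 < \<delta>" using d1 d2 by (simp add: \<delta>_def)
  have near: "nice j r' \<and> v' \<bullet> normal T j r' < 0" if "\<bar>r' - r\<bar> < \<delta>" "norm (v' - v) < d1 / 2" for r' v'
  proof -
    have "dist (v', r') (v, r) \<le> dist v' v + dist r' r"
      unfolding dist_Pair_Pair by (intro sqrt_sum_squares_le_sum) auto
    also have "\<dots> < d1" using that by (simp add: \<delta>_def dist_norm)
    finally show ?thesis using d1(2)[of "(v', r')"] d2(2) that by (force simp: \<delta>_def dist_real_def)
  qed
  obtain \<beta> where b: "0 < \<beta>" "frontier (region T) \<inter> ball ?p \<beta> \<subseteq> wall T j ` {r - \<delta><..<r + \<delta>}"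
    using nice_isolated[OF r \<delta>] by metis
  obtain \<theta> where th: "0 < \<theta>" "\<And>u. 0 < u \<Longrightarrow> u < \<theta> \<Longrightarrow> ?p - u *\<^sub>R (- v) \<notin> region T"
    using ray_enters_domain[OF r, of "- v"] vn by (metis inner_minus_left neg_0_less_iff_less)
  \<comment> \<open>A time margin on both sides of the old hit: below \<open>\<theta>\<close> so
    that the old ray is outside afterwards, below \<open>t\<close>, and short enough to move the
    point by at most \<open>\<beta> / 4\<close>.\<close>
  define t1 where "t1 = min (min (\<theta> / 2) (t / 2)) (\<beta> / (4 * norm v))"
  have t1: "0 < t1" "t1 < \<theta>" "t1 < t" "t1 * norm v \<le> \<beta> / 4"
  proof -
    show "0 < t1" "t1 < \<theta>" "t1 < t" using th(1) t(1) b(1) v0 by (auto simp: t1_def min_less_iff_disj)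
    have "t1 \<le> \<beta> / (4 * norm v)" by (simp add: t1_def)
    then show "t1 * norm v \<le> \<beta> / 4" using v0 by (simp add: field_simps)
  qed
  have out: "z + (t + t1) *\<^sub>R v \<in> - region T"
    using th(2)[OF t1(1,2)] unfolding t(2)[symmetric] by (simp add: algebra_simps)
  obtain \<epsilon>1 where e1: "0 < \<epsilon>1" "\<And>y. dist (z + (t + t1) *\<^sub>R v) y < \<epsilon>1 \<Longrightarrow> y \<in> - region T"
    using openE[OF _ out] closed_region by (metis mem_ball open_Compl subsetD)
  define K where "K = (\<lambda>u. z + u *\<^sub>R v) ` {0..t - t1}"
  have "compact K" unfolding K_def by (intro compact_continuous_image continuous_intros) auto
  moreover have "K \<subseteq> domain"
  proof
    fix x assume "x \<in> K"
    then obtain u where "0 \<le> u" "u \<le> t - t1" "x = z + u *\<^sub>R v" by (auto simp: K_def)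
    then show "x \<in> domain" using dom[of u] z t1(1) by (cases "u = 0") auto
  qed
  ultimately obtain \<epsilon>2 where e2: "0 < \<epsilon>2" "\<And>x y. x \<in> K \<Longrightarrow> dist x y < \<epsilon>2 \<Longrightarrow> y \<in> domain"
    using compact_subset_open_thicken[of K domain] by (metis open_interior)
  define \<epsilon> where "\<epsilon> = min (min \<epsilon>1 \<epsilon>2) (\<beta> / 4)"
  have e: "0 < \<epsilon>" using e1 e2 b by (simp add: \<epsilon>_def)
  have F: "((\<lambda>w. fst w) \<longlongrightarrow> z) (nhds (z, v))" and S: "((\<lambda>w. snd w) \<longlongrightarrow> v) (nhds (z, v))"
    using tendsto_fst[OF filterlim_ident, of "(z, v)"] tendsto_snd[OF filterlim_ident, of "(z, v)"] by auto
  have "((\<lambda>w. norm (fst w - z) + (t + t1) * norm (snd w - v)) \<longlongrightarrow> norm (z - z) + (t + t1) * norm (v - v)) (nhds (z, v))"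
    by (intro tendsto_add tendsto_mult_left tendsto_norm tendsto_diff tendsto_const F S)
  then have "((\<lambda>w. norm (fst w - z) + (t + t1) * norm (snd w - v)) \<longlongrightarrow> 0) (nhds (z, v))" by simp
  then have "\<forall>\<^sub>F w in nhds (z, v). norm (fst w - z) + (t + t1) * norm (snd w - v) < \<epsilon>"
    by (rule order_tendstoD) fact
  moreover have "\<forall>\<^sub>F w in nhds (z, v). norm (snd w - v) < d1 / 2"
    using tendstoD[OF S, of "d1 / 2"] d1 by (simp add: dist_norm)
  ultimately show ?thesis
  proof eventually_elim
    case (elim w)
    obtain z' v' where w: "w = (z', v')" by (cases w)
    have close: "norm (z' - z) + (t + t1) * norm (v' - v) < \<epsilon>" and v': "norm (v' - v) < d1 / 2"
      using elim by (simp_all add: w)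
    have diff: "norm ((z' + u *\<^sub>R v') - (z + u *\<^sub>R v)) < \<epsilon>" if "0 \<le> u" "u \<le> t + t1" for u
    proof -
      have "(z' + u *\<^sub>R v') - (z + u *\<^sub>R v) = (z' - z) + u *\<^sub>R (v' - v)" by (simp add: algebra_simps)
      then have "norm ((z' + u *\<^sub>R v') - (z + u *\<^sub>R v)) \<le> norm (z' - z) + norm (u *\<^sub>R (v' - v))"
        by (metis norm_triangle_ineq)
      also have "norm (u *\<^sub>R (v' - v)) \<le> (t + t1) * norm (v' - v)"
        using that by (simp add: mult_right_mono)
      finally show ?thesis using close by linarith
    qed
    have in_dom: "z' + u *\<^sub>R v' \<in> domain" if "0 \<le> u" "u \<le> t - t1" for u
    proof (rule e2(2))
      show "z + u *\<^sub>R v \<in> K" using that by (auto simp: K_def)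
      show "dist (z + u *\<^sub>R v) (z' + u *\<^sub>R v') < \<epsilon>2"
        using diff[of u] that t1(1) by (simp add: \<epsilon>_def dist_norm norm_minus_commute)
    qed
    have "z' + (t + t1) *\<^sub>R v' \<in> - region T"
      using diff[of "t + t1"] t t1(1)
      by (intro e1(2)) (simp add: \<epsilon>_def dist_norm norm_minus_commute)
    then have "z' + (t + t1) *\<^sub>R v' \<notin> domain" using interior_subset by blast
    then obtain t' where t': "t - t1 < t'" "t' \<le> t + t1" "z' + t' *\<^sub>R v' \<in> frontier (region T)"
      "\<And>u. t - t1 \<le> u \<Longrightarrow> u < t' \<Longrightarrow> z' + u *\<^sub>R v' \<in> domain"
      using first_exit[of "t - t1" "t + t1" z' v'] in_dom[of "t - t1"] t1 by auto
    have "norm ((z' + t' *\<^sub>R v') - ?p) \<le> norm ((z' + t' *\<^sub>R v') - (z + t' *\<^sub>R v)) + norm ((t' - t) *\<^sub>R v)"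
    proof -
      have "(z' + t' *\<^sub>R v') - ?p = ((z' + t' *\<^sub>R v') - (z + t' *\<^sub>R v)) + (t' - t) *\<^sub>R v"
        unfolding t(2)[symmetric] by (simp add: algebra_simps)
      then show ?thesis by (metis norm_triangle_ineq)
    qed
    also have "\<dots> < \<epsilon> + \<beta> / 4"
    proof (rule add_less_le_mono)
      show "norm ((z' + t' *\<^sub>R v') - (z + t' *\<^sub>R v)) < \<epsilon>" using diff[of t'] t' t1 by simp
      have "\<bar>t' - t\<bar> * norm v \<le> t1 * norm v" using t' by (intro mult_right_mono) auto
      then show "norm ((t' - t) *\<^sub>R v) \<le> \<beta> / 4" using t1(4) by simp
    qed
    also have "\<dots> \<le> \<beta>" using b(1) by (simp add: \<epsilon>_def)
    finally have "z' + t' *\<^sub>R v' \<in> ball ?p \<beta>" by (simp add: dist_norm norm_minus_commute)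
    then obtain r' where r': "\<bar>r' - r\<bar> < \<delta>" "wall T j r' = z' + t' *\<^sub>R v'"
      using b(2) t'(3) by (force simp: abs_less_iff)
    have "hit z' v' j r' t'"
      unfolding hit_def
    proof (intro conjI allI impI)
      show "0 < t'" using t' t1 by simp
      show "z' + t' *\<^sub>R v' = wall T j r'" using r' by simp
      show "nice j r'" "v' \<bullet> normal T j r' < 0" using near[OF r'(1) v'] by auto
      fix u assume "0 < u \<and> u < t'"
      then show "z' + u *\<^sub>R v' \<in> domain" using in_dom[of u] t'(4)[of u] by (cases "u \<le> t - t1") auto
    qed
    then show ?case unfolding w by auto
  qed
qed

section \<open>Chords between two boundary points\<close>

definition chord :: "nat \<Rightarrow> real \<Rightarrow> nat \<Rightarrow> real \<Rightarrow> bool" where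
  "chord i r j r' \<longleftrightarrow> nice i r \<and> nice j r' \<and>
    (let d = wall T j r' - wall T i r in
      (\<forall>u. 0 < u \<and> u < 1 \<longrightarrow> wall T i r + u *\<^sub>R d \<in> domain) \<and>
      0 < d \<bullet> normal T i r \<and> d \<bullet> normal T j r' < 0)"

lemma chord_sym_imp:
  assumes c: "chord i r j r'"
  shows "chord j r' i r"
proof -
  have neg: "(wall T i r - wall T j r') \<bullet> x = - ((wall T j r' - wall T i r) \<bullet> x)" for x
    by (simp add: inner_diff_left)
  have "wall T j r' + u *\<^sub>R (wall T i r - wall T j r') \<in> domain" if u: "0 < u" "u < 1" for u
  proof -
    have "wall T j r' + u *\<^sub>R (wall T i r - wall T j r') = wall T i r + (1 - u) *\<^sub>R (wall T j r' - wall T i r)"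
      by (simp add: algebra_simps)
    then show ?thesis using c u unfolding chord_def Let_def by simp
  qed
  then show ?thesis using c unfolding chord_def Let_def neg by simp
qed

lemma chord_sym: "chord i r j r' \<longleftrightarrow> chord j r' i r"
  using chord_sym_imp by blast

lemma chord_distinct: "chord i r j r' \<Longrightarrow> wall T j r' \<noteq> wall T i r"
  unfolding chord_def Let_def by auto

lemma chord_of_hits:
  assumes "z \<in> domain" "hit z v j r t" "hit z (- v) i r0 t0"
  shows "chord i r0 j r"
proof -
  have h: "0 < t" "z + t *\<^sub>R v = wall T j r" "\<And>u. 0 < u \<Longrightarrow> u < t \<Longrightarrow> z + u *\<^sub>R v \<in> domain"
    "nice j r" "v \<bullet> normal T j r < 0"
    "0 < t0" "z - t0 *\<^sub>R v = wall T i r0" "\<And>u. 0 < u \<Longrightarrow> u < t0 \<Longrightarrow> z - u *\<^sub>R v \<in> domain"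
    "nice i r0" "0 < v \<bullet> normal T i r0"
    using assms(2,3) by (auto simp: hit_def)
  have d: "wall T j r - wall T i r0 = (t + t0) *\<^sub>R v"
    unfolding h(2,7)[symmetric] by (simp add: algebra_simps)
  have seg: "wall T i r0 + u *\<^sub>R ((t + t0) *\<^sub>R v) \<in> domain" if u: "0 < u" "u < 1" for u
  proof -
    define x where "x = u * (t + t0) - t0"
    have "wall T i r0 + u *\<^sub>R ((t + t0) *\<^sub>R v) = z + x *\<^sub>R v"
      unfolding h(7)[symmetric] by (simp add: x_def algebra_simps)
    moreover have "x < t"
    proof -
      have "u * (t + t0) < 1 * (t + t0)" using u h(1,6) by (intro mult_strict_right_mono) auto
      then show ?thesis by (simp add: x_def)
    qed
    moreover have "- t0 < x" using u h(1,6) by (simp add: x_def)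
    ultimately show ?thesis using h(3)[of x] h(8)[of "- x"] assms(1)
      by (cases "x = 0"; cases "0 < x") auto
  qed
  show ?thesis
    unfolding chord_def Let_def d using h seg by (auto simp: mult_pos_neg)
qed

lemma chord_of_hit:
  assumes "nice i r" "0 < v \<bullet> normal T i r" "hit (wall T i r) v j r' t"
  shows "chord i r j r'"
proof -
  have h: "0 < t" "wall T i r + t *\<^sub>R v = wall T j r'"
    "\<And>u. 0 < u \<Longrightarrow> u < t \<Longrightarrow> wall T i r + u *\<^sub>R v \<in> domain"
    "nice j r'" "v \<bullet> normal T j r' < 0"
    using assms(3) by (auto simp: hit_def)
  have d: "wall T j r' - wall T i r = t *\<^sub>R v" using h(2) by (simp add: algebra_simps)
  show ?thesis unfolding chord_def Let_def d
    using assms h h(3)[of "_ * t"] by (auto simp: mult_pos_neg)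
qed

text \<open>Near its ends a perturbed segment stays in the cones of \<open>nice_local\<close>, whose
  base points may vary; its middle part is close to a compact segment of the interior.\<close>

lemma open_chord: "open {p. chord i (fst p) j (snd p)}"
proof (rule open_nhdsI, safe)
  fix r r' assume c: "chord i (fst (r, r')) j (snd (r, r'))"
  let ?q = "wall T i" and ?q' = "wall T j"
  define d where "d = ?q' r' - ?q r"
  have r: "nice i r" "nice j r'" and dn: "0 < d \<bullet> normal T i r" "d \<bullet> normal T j r' < 0"
    and seg: "\<And>u. 0 < u \<Longrightarrow> u < 1 \<Longrightarrow> ?q r + u *\<^sub>R d \<in> domain"
    using c by (auto simp: chord_def Let_def d_def)
  have d0: "0 < norm d" using dn by auto
  define e1 where "e1 = (d \<bullet> normal T i r) / (2 * norm d)"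
  have e1: "0 < e1" "e1 * norm d < d \<bullet> normal T i r" using dn d0 by (auto simp: e1_def)
  define e2 where "e2 = (- d \<bullet> normal T j r') / (2 * norm d)"
  have e2: "0 < e2" "e2 * norm d < - d \<bullet> normal T j r'" using dn d0 by (auto simp: e2_def divide_neg_pos)
  obtain \<delta>1 \<rho>1 where 1: "0 < \<delta>1" "0 < \<rho>1"
    "\<And>r1 x. \<bar>r1 - r\<bar> < \<delta>1 \<Longrightarrow> norm x < \<rho>1 \<Longrightarrow> e1 * norm x < x \<bullet> normal T i r \<Longrightarrow> ?q r1 + x \<in> domain"
    using nice_local[OF r(1) e1(1)] by metis
  obtain \<delta>2 \<rho>2 where 2: "0 < \<delta>2" "0 < \<rho>2"
    "\<And>r1 x. \<bar>r1 - r'\<bar> < \<delta>2 \<Longrightarrow> norm x < \<rho>2 \<Longrightarrow> e2 * norm x < x \<bullet> normal T j r' \<Longrightarrow> ?q' r1 + x \<in> domain"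
    using nice_local[OF r(2) e2(1)] by metis
  \<comment> \<open>The bound \<open>1/3\<close> keeps the two end pieces disjoint; the other bound
    makes the end pieces of every segment with \<open>norm (D p) < norm d + 1\<close> shorter than
    both radii.\<close>
  define a where "a = min (1/3) (min \<rho>1 \<rho>2 / (norm d + 1))"
  have a: "0 < a" "a < 1 / 2" "a * (norm d + 1) \<le> \<rho>1" "a * (norm d + 1) \<le> \<rho>2"
  proof -
    show "0 < a" using 1 2 by (auto simp: a_def min_def add_nonneg_pos)
    show "a < 1 / 2" by (simp add: a_def min_def)
    have "a * (norm d + 1) \<le> min \<rho>1 \<rho>2 / (norm d + 1) * (norm d + 1)"
      unfolding a_def by (intro mult_right_mono) auto
    also have "\<dots> = min \<rho>1 \<rho>2"
    proof -
      have "norm d + 1 \<noteq> 0" using d0 by linarith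
      then show ?thesis by simp
    qed
    finally show "a * (norm d + 1) \<le> \<rho>1" "a * (norm d + 1) \<le> \<rho>2" by auto
  qed
  define K where "K = (\<lambda>u. ?q r + u *\<^sub>R d) ` {a..1 - a}"
  have "compact K" unfolding K_def by (intro compact_continuous_image continuous_intros) auto
  moreover have "K \<subseteq> domain" using seg a by (auto simp: K_def)
  ultimately obtain \<epsilon> where eps: "0 < \<epsilon>" "\<And>x y. x \<in> K \<Longrightarrow> dist x y < \<epsilon> \<Longrightarrow> y \<in> domain"
    using compact_subset_open_thicken[of K domain] by (metis open_interior)
  define D where "D p = ?q' (snd p) - ?q (fst p)" for p
  have f: "((\<lambda>p. fst p) \<longlongrightarrow> r) (nhds (r, r'))" and s: "((\<lambda>p. snd p) \<longlongrightarrow> r') (nhds (r, r'))"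
    using tendsto_fst[OF filterlim_ident, of "(r, r')"] tendsto_snd[OF filterlim_ident, of "(r, r')"] by auto
  have q: "((\<lambda>p. ?q (fst p)) \<longlongrightarrow> ?q r) (nhds (r, r'))"
    and q': "((\<lambda>p. ?q' (snd p)) \<longlongrightarrow> ?q' r') (nhds (r, r'))"
    using isCont_tendsto_compose[OF isCont_wall[OF nice_smooth[OF r(1)]] f]
      isCont_tendsto_compose[OF isCont_wall[OF nice_smooth[OF r(2)]] s] by auto
  have n: "((\<lambda>p. normal T i (fst p)) \<longlongrightarrow> normal T i r) (nhds (r, r'))"
    and n': "((\<lambda>p. normal T j (snd p)) \<longlongrightarrow> normal T j r') (nhds (r, r'))"
    using isCont_tendsto_compose[OF isCont_normal[OF nice_smooth[OF r(1)]] f]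
      isCont_tendsto_compose[OF isCont_normal[OF nice_smooth[OF r(2)]] s] by auto
  have D: "(D \<longlongrightarrow> d) (nhds (r, r'))" unfolding D_def[abs_def] d_def by (intro tendsto_diff q q')
  have "\<forall>\<^sub>F p in nhds (r, r'). nice i (fst p)"
    using topological_tendstoD[OF f open_nice[of i]] r by simp
  moreover have "\<forall>\<^sub>F p in nhds (r, r'). nice j (snd p)"
    using topological_tendstoD[OF s open_nice[of j]] r by simp
  moreover have "\<forall>\<^sub>F p in nhds (r, r'). \<bar>fst p - r\<bar> < \<delta>1"
    using tendstoD[OF f 1(1)] by (simp add: dist_real_def)
  moreover have "\<forall>\<^sub>F p in nhds (r, r'). \<bar>snd p - r'\<bar> < \<delta>2"
    using tendstoD[OF s 2(1)] by (simp add: dist_real_def)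
  moreover have "\<forall>\<^sub>F p in nhds (r, r'). norm (D p) < norm d + 1"
    by (rule order_tendstoD[OF tendsto_norm[OF D]]) simp
  moreover have "\<forall>\<^sub>F p in nhds (r, r'). 0 < D p \<bullet> normal T i r - e1 * norm (D p)"
    by (rule order_tendstoD[where y="d \<bullet> normal T i r - e1 * norm d"])
      (use e1 in \<open>auto intro!: tendsto_intros D\<close>)
  moreover have "\<forall>\<^sub>F p in nhds (r, r'). 0 < - D p \<bullet> normal T j r' - e2 * norm (D p)"
    by (rule order_tendstoD[where y="- d \<bullet> normal T j r' - e2 * norm d"])
      (use e2 in \<open>auto intro!: tendsto_intros D\<close>)
  moreover have "\<forall>\<^sub>F p in nhds (r, r'). 0 < D p \<bullet> normal T i (fst p)"
    by (rule order_tendstoD[OF tendsto_inner[OF D n]]) (use dn in simp)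
  moreover have "\<forall>\<^sub>F p in nhds (r, r'). D p \<bullet> normal T j (snd p) < 0"
    by (rule order_tendstoD[OF tendsto_inner[OF D n']]) (use dn in simp)
  moreover have "\<forall>\<^sub>F p in nhds (r, r'). dist (?q (fst p)) (?q r) < \<epsilon> / 2"
    by (rule tendstoD[OF q]) (use eps in simp)
  moreover have "\<forall>\<^sub>F p in nhds (r, r'). dist (D p) d < \<epsilon> / 2"
    by (rule tendstoD[OF D]) (use eps in simp)
  ultimately show "\<forall>\<^sub>F p in nhds (r, r'). p \<in> {p. chord i (fst p) j (snd p)}"
  proof eventually_elim
    case (elim p)
    have "?q (fst p) + u *\<^sub>R D p \<in> domain" if u: "0 < u" "u < 1" for u
    proof -
      consider "u < a" | "1 - a < u" | "a \<le> u" "u \<le> 1 - a" by linarith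
      then show ?thesis
      proof cases
        case 1
        have "norm (u *\<^sub>R D p) \<le> a * norm (D p)" using 1 u by (simp add: mult_right_mono)
        also have "\<dots> < a * (norm d + 1)" using elim a by simp
        also have "\<dots> \<le> \<rho>1" by (rule a)
        finally have "norm (u *\<^sub>R D p) < \<rho>1" .
        moreover have "e1 * norm (u *\<^sub>R D p) < (u *\<^sub>R D p) \<bullet> normal T i r"
        proof -
          have "u * (e1 * norm (D p)) < u * (D p \<bullet> normal T i r)"
            using elim u by (intro mult_strict_left_mono) auto
          then show ?thesis using u by (simp add: mult.left_commute)
        qed
        ultimately show ?thesis using \<open>0 < \<delta>1\<close> \<open>\<bar>fst p - r\<bar> < \<delta>1\<close>
          by (intro \<open>\<And>r1 x. \<bar>r1 - r\<bar> < \<delta>1 \<Longrightarrow> norm x < \<rho>1 \<Longrightarrow> e1 * norm x < x \<bullet> normal T i r \<Longrightarrow> ?q r1 + x \<in> domain\<close>)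
      next
        case 2
        let ?x = "(1 - u) *\<^sub>R (- D p)"
        have "norm ?x \<le> a * norm (D p)" using 2 u by (simp add: mult_right_mono)
        also have "\<dots> < a * (norm d + 1)" using elim a by simp
        also have "\<dots> \<le> \<rho>2" by (rule a)
        finally have "norm ?x < \<rho>2" .
        moreover have "e2 * norm ?x < ?x \<bullet> normal T j r'"
        proof -
          have "(1 - u) * (e2 * norm (D p)) < (1 - u) * (- D p \<bullet> normal T j r')"
            using elim u by (intro mult_strict_left_mono) auto
          then show ?thesis using u by (simp add: mult.left_commute)
        qed
        ultimately have "?q' (snd p) + ?x \<in> domain" using \<open>\<bar>snd p - r'\<bar> < \<delta>2\<close>
          by (intro \<open>\<And>r1 x. \<bar>r1 - r'\<bar> < \<delta>2 \<Longrightarrow> norm x < \<rho>2 \<Longrightarrow> e2 * norm x < x \<bullet> normal T j r' \<Longrightarrow> ?q' r1 + x \<in> domain\<close>)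
        moreover have "?q' (snd p) + ?x = ?q (fst p) + u *\<^sub>R D p"
          by (simp add: D_def algebra_simps)
        ultimately show ?thesis by simp
      next
        case 3
        have "dist (?q r + u *\<^sub>R d) (?q (fst p) + u *\<^sub>R D p) \<le> dist (?q r) (?q (fst p)) + dist (u *\<^sub>R d) (u *\<^sub>R D p)"
          by (rule dist_triangle_add)
        also have "dist (u *\<^sub>R d) (u *\<^sub>R D p) = u * dist d (D p)"
          using u by (simp add: dist_norm scaleR_diff_right[symmetric])
        also have "\<dots> \<le> dist d (D p)" using u by (simp add: mult_left_le_one_le)
        finally have "dist (?q r + u *\<^sub>R d) (?q (fst p) + u *\<^sub>R D p) < \<epsilon>"
          using elim by (simp add: dist_commute)
        moreover have "?q r + u *\<^sub>R d \<in> K" using 3 by (auto simp: K_def)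
        ultimately show ?thesis using eps(2) by blast
      qed
    qed
    then show ?case using elim by (simp add: chord_def Let_def D_def)
  qed
qed

end

section \<open>Change of variables and a Sard lemma on the line\<close>

text \<open>The vector form of Sard's lemma is applied on \<open>real^1\<close>, where a zero
  derivative has rank \<open>0 < 1\<close>, and the result is read back through the
  coordinate.\<close>

lemma negligible_zero_derivative_image:
  fixes g :: "real \<Rightarrow> real"
  assumes "\<And>x. x \<in> S \<Longrightarrow> (g has_field_derivative 0) (at x within S)"
  shows "negligible (g ` S)"
proof -
  let ?h = "\<lambda>x :: real^1. g (x $ 1) *\<^sub>R vec 1 :: real^1"
  have "negligible (?h ` (vec ` S))"
  proof (rule baby_Sard[where f'="\<lambda>_ _. 0"])
    fix x :: "real^1" assume "x \<in> vec ` S"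
    then have x: "x $ 1 \<in> S" by auto
    have "((\<lambda>y. y $ 1) has_derivative (\<lambda>h. h $ 1)) (at x within vec ` S)"
      by (intro bounded_linear_imp_has_derivative bounded_linear_vec_nth)
    moreover have "(g has_derivative (\<lambda>_. 0)) (at (x $ 1) within (\<lambda>y. y $ 1) ` (vec ` S :: (real^1) set))"
      using assms[OF x] by (simp add: has_field_derivative_def image_image lambda_zero)
    ultimately have "((\<lambda>y. g (y $ 1)) has_derivative (\<lambda>_. 0)) (at x within vec ` S)"
      by (rule has_derivative_in_compose)
    from has_derivative_scaleR_left[OF this, of "vec 1 :: real^1"]
    show "(?h has_derivative (\<lambda>_. 0)) (at x within vec ` S)" by simp
    show "rank (matrix (\<lambda>_ :: real^1. 0 :: real^1)) < CARD(1)"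
    proof -
      have "matrix (\<lambda>_ :: real^1. 0 :: real^1) = 0" by (simp add: matrix_def vec_eq_iff)
      then show ?thesis by (simp add: rank_eq_0[THEN iffD2])
    qed
  qed simp
  moreover have "(\<lambda>y :: real^1. y $ 1) differentiable_on (?h ` (vec ` S))"
    by (intro differentiable_at_imp_differentiable_on ballI bounded_linear_imp_differentiable bounded_linear_vec_nth)
  ultimately have "negligible ((\<lambda>y. y $ 1) ` (?h ` (vec ` S)))"
    by (rule negligible_differentiable_image_negligible[rotated]) simp
  moreover have "(\<lambda>y. y $ 1) ` (?h ` (vec ` S)) = g ` S" by (simp add: image_image)
  ultimately show ?thesis by simp
qed

text \<open>Change of variables for the constant function \<open>1\<close> identifies the image
  under \<open>g\<close> of the measure with density \<open>\<bar>g'\<bar>\<close> on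
  \<open>S\<close> with Lebesgue measure on the image of \<open>S\<close>. This is shown on bounded
  sets, where the measures are finite, and extended by exhaustion; integrating \<open>h\<close>
  against the two equal measures gives the formula for every nonnegative Borel function.\<close>

lemma nn_integral_substitution_open:
  fixes g g' :: "real \<Rightarrow> real" and h :: "real \<Rightarrow> ennreal"
  assumes S: "open S" and der: "\<And>x. x \<in> S \<Longrightarrow> (g has_field_derivative g' x) (at x)"
    and inj: "inj_on g S" and cont': "continuous_on S g'" and h: "h \<in> borel_measurable borel"
  shows "g ` S \<in> sets borel"
    and "(\<integral>\<^sup>+x. indicator S x * ennreal \<bar>g' x\<bar> * h (g x) \<partial>lborel) = (\<integral>\<^sup>+y. indicator (g ` S) y * h y \<partial>lborel)"
proof -
  have cont: "continuous_on S g"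
    by (intro continuous_at_imp_continuous_on ballI DERIV_isCont[OF der])
  have "open (g ` S)" by (rule invariance_of_domain[OF cont S inj])
  then show gS: "g ` S \<in> sets borel" by simp
  have SB [measurable]: "S \<in> sets borel" using S by simp
  \<comment> \<open>\<open>G\<close> and \<open>w\<close> extend the map and the density by zero off
    \<open>S\<close>, which makes them Borel on the whole line; the factor \<open>w\<close> removes
    the arbitrary values of \<open>G\<close>.\<close>
  define G where "G x = indicator S x *\<^sub>R g x" for x
  have Gm [measurable]: "G \<in> borel_measurable borel"
    unfolding G_def[abs_def] using borel_measurable_continuous_on_indicator[OF SB cont] by simp
  define w where "w x = ennreal \<bar>indicator S x *\<^sub>R g' x\<bar>" for x
  have wm [measurable]: "w \<in> borel_measurable borel"
    unfolding w_def using borel_measurable_continuous_on_indicator[OF SB cont'] by measurable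
  have w: "indicator S x * ennreal \<bar>g' x\<bar> * k (g x) = w x * k (G x)" for k :: "real \<Rightarrow> ennreal" and x
    by (simp add: w_def G_def indicator_def)
  have key: "(\<integral>\<^sup>+x. w x * indicator B (G x) \<partial>lborel) = emeasure lborel (g ` S \<inter> B)"
    if B: "B \<in> sets borel" "bounded B" for B
  proof -
    let ?C = "S \<inter> G -` B"
    have C: "?C \<in> sets borel" using measurable_sets[OF Gm B(1)] SB by auto
    have img: "g ` ?C = g ` S \<inter> B" by (auto simp: G_def)
    have fin: "emeasure lborel (g ` S \<inter> B) < \<infinity>"
      by (rule emeasure_bounded_finite) (use B(2) in \<open>auto intro: bounded_subset\<close>)
    have gSB: "g ` S \<inter> B \<in> sets borel" using gS B(1) by auto
    have lm: "g ` ?C \<in> lmeasurable"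
      unfolding img using gSB fin by (intro fmeasurableI) (auto simp: emeasure_completion)
    then have "(\<lambda>x. 1 :: real) absolutely_integrable_on (g ` ?C) \<and> integral (g ` ?C) (\<lambda>x. 1) = measure lebesgue (g ` ?C)"
      by (simp add: lmeasure_integral absolutely_integrable_on_const)
    then have "(\<lambda>x. \<bar>g' x\<bar> * 1) absolutely_integrable_on ?C \<and> integral ?C (\<lambda>x. \<bar>g' x\<bar> * 1) = measure lebesgue (g ` ?C)"
    proof (subst has_absolute_integral_change_of_variables_1'[of ?C g g' "\<lambda>_. 1" "measure lebesgue (g ` ?C)"])
      show "?C \<in> sets lebesgue" using C by simp
      show "inj_on g ?C" using inj by (rule inj_on_subset) auto
      show "(g has_field_derivative g' x) (at x within ?C)" if "x \<in> ?C" for x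
        using der[of x] that by (auto intro: has_field_derivative_at_within)
    qed
    then have "((\<lambda>x. \<bar>g' x\<bar>) has_integral measure lebesgue (g ` ?C)) ?C"
      by (simp add: has_integral_iff absolutely_integrable_on_def)
    then have "(\<integral>\<^sup>+x. indicator ?C x * ennreal \<bar>g' x\<bar> \<partial>lborel) = ennreal (measure lborel (g ` S \<inter> B))"
    proof -
      assume hi: "((\<lambda>x. \<bar>g' x\<bar>) has_integral measure lebesgue (g ` ?C)) ?C"
      have "((\<lambda>x. indicator ?C x *\<^sub>R \<bar>g' x\<bar>) has_integral measure lebesgue (g ` ?C)) UNIV"
      proof -
        have "(\<lambda>x. indicator ?C x *\<^sub>R \<bar>g' x\<bar>) = (\<lambda>x. if x \<in> ?C then \<bar>g' x\<bar> else 0)"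
          by (auto simp: indicator_def)
        then show ?thesis using hi by (simp only: has_integral_restrict_UNIV)
      qed
      moreover have "(\<lambda>x. indicator ?C x *\<^sub>R \<bar>g' x\<bar>) \<in> borel_measurable borel"
      proof -
        have "(\<lambda>x. indicator ?C x *\<^sub>R \<bar>indicator S x *\<^sub>R g' x\<bar>) \<in> borel_measurable borel"
          using borel_measurable_continuous_on_indicator[OF SB cont'] C by measurable
        also have "(\<lambda>x. indicator ?C x *\<^sub>R \<bar>indicator S x *\<^sub>R g' x\<bar>) = (\<lambda>x. indicator ?C x *\<^sub>R \<bar>g' x\<bar>)"
          by (auto simp: indicator_def fun_eq_iff)
        finally show ?thesis .
      qed
      ultimately have "(\<integral>\<^sup>+x. ennreal (indicator ?C x *\<^sub>R \<bar>g' x\<bar>) \<partial>lborel) = ennreal (measure lebesgue (g ` ?C))"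
        by (intro nn_integral_has_integral_lborel) auto
      moreover have "ennreal (indicator ?C x *\<^sub>R \<bar>g' x\<bar>) = indicator ?C x * ennreal \<bar>g' x\<bar>" for x
        by (simp add: indicator_def)
      ultimately show ?thesis unfolding img using gSB by (simp add: measure_completion)
    qed
    moreover have "(\<lambda>x. w x * indicator B (G x)) = (\<lambda>x. indicator ?C x * ennreal \<bar>g' x\<bar>)"
      by (auto simp: fun_eq_iff indicator_def w_def G_def)
    ultimately show ?thesis using fin by (simp add: emeasure_eq_ennreal_measure)
  qed
  define \<mu> where "\<mu> = distr (density lborel w) borel G"
  define \<nu> where "\<nu> = density lborel (indicator (g ` S) :: real \<Rightarrow> ennreal)"
  have \<mu>: "emeasure \<mu> B = (\<integral>\<^sup>+x. w x * indicator B (G x) \<partial>lborel)" if B [measurable]: "B \<in> sets borel" for B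
  proof -
    have "emeasure \<mu> B = (\<integral>\<^sup>+y. indicator B y \<partial>\<mu>)" by (simp add: \<mu>_def B)
    also have "\<dots> = (\<integral>\<^sup>+x. indicator B (G x) \<partial>density lborel w)"
      unfolding \<mu>_def by (rule nn_integral_distr) auto
    also have "\<dots> = (\<integral>\<^sup>+x. w x * indicator B (G x) \<partial>lborel)"
      by (rule nn_integral_density) auto
    finally show ?thesis .
  qed
  have \<nu>: "emeasure \<nu> B = emeasure lborel (g ` S \<inter> B)" if B: "B \<in> sets borel" for B
  proof -
    have "emeasure \<nu> B = (\<integral>\<^sup>+x. indicator (g ` S) x * indicator B x \<partial>lborel)"
      unfolding \<nu>_def by (rule emeasure_density) (use gS B in auto)
    also have "\<dots> = (\<integral>\<^sup>+x. indicator (g ` S \<inter> B) x \<partial>lborel)" by (simp only: indicator_inter_arith)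
    also have "\<dots> = emeasure lborel (g ` S \<inter> B)" using gS B by (intro nn_integral_indicator) auto
    finally show ?thesis .
  qed
  have "\<mu> = \<nu>"
  proof (rule measure_eqI)
    show "sets \<mu> = sets \<nu>" by (simp add: \<mu>_def \<nu>_def)
    fix B assume "B \<in> sets \<mu>"
    then have B: "B \<in> sets borel" by (simp add: \<mu>_def)
    define Bn where "Bn n = B \<inter> {- real n..real n}" for n
    have Bn: "Bn n \<in> sets borel" "bounded (Bn n)" for n
      using B by (auto simp: Bn_def intro: bounded_subset[OF bounded_closed_interval])
    have inc: "incseq Bn" by (rule incseq_SucI) (auto simp: Bn_def)
    have un: "(\<Union>n. Bn n) = B"
    proof
      show "B \<subseteq> (\<Union>n. Bn n)"
      proof
        fix x assume "x \<in> B"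
        obtain n where "\<bar>x\<bar> \<le> real n" using real_arch_simple by blast
        then show "x \<in> (\<Union>n. Bn n)" using \<open>x \<in> B\<close> by (intro UN_I[of n]) (auto simp: Bn_def abs_le_iff)
      qed
    qed (auto simp: Bn_def)
    have "emeasure \<mu> (Bn n) = emeasure \<nu> (Bn n)" for n using \<mu> \<nu> key Bn by simp
    moreover have "(SUP n. emeasure \<mu> (Bn n)) = emeasure \<mu> B" "(SUP n. emeasure \<nu> (Bn n)) = emeasure \<nu> B"
      using SUP_emeasure_incseq[OF _ inc, of \<mu>] SUP_emeasure_incseq[OF _ inc, of \<nu>] Bn un
      by (auto simp: \<mu>_def \<nu>_def)
    ultimately show "emeasure \<mu> B = emeasure \<nu> B" by simp
  qed
  have "(\<integral>\<^sup>+x. indicator S x * ennreal \<bar>g' x\<bar> * h (g x) \<partial>lborel) = (\<integral>\<^sup>+x. w x * h (G x) \<partial>lborel)"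
    by (simp only: w)
  also have "\<dots> = (\<integral>\<^sup>+x. h (G x) \<partial>density lborel w)"
    using h by (intro nn_integral_density[symmetric]) auto
  also have "\<dots> = (\<integral>\<^sup>+y. h y \<partial>\<mu>)"
    unfolding \<mu>_def using h by (intro nn_integral_distr[symmetric]) auto
  also have "\<dots> = (\<integral>\<^sup>+y. indicator (g ` S) y * h y \<partial>lborel)"
    unfolding \<open>\<mu> = \<nu>\<close> \<nu>_def using h gS by (intro nn_integral_density) auto
  finally show "(\<integral>\<^sup>+x. indicator S x * ennreal \<bar>g' x\<bar> * h (g x) \<partial>lborel) = (\<integral>\<^sup>+y. indicator (g ` S) y * h y \<partial>lborel)" .
qed

section \<open>Flight directions\<close>

text \<open>With \<open>a\<close> the tangent this is \<open>out_velocity\<close>. A free unit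
  vector \<open>a\<close> also allows half of the directions at an interior point to be
  parametrized.\<close>

definition velocity :: "plane \<Rightarrow> real \<Rightarrow> plane" where
  "velocity a s = sqrt (1 - s\<^sup>2) *\<^sub>R (- snd a, fst a) + s *\<^sub>R a"

lemma velocity_props:
  assumes a: "norm a = 1" and s: "- 1 < s" "s < 1"
  shows "norm (velocity a s) = 1" "velocity a s \<bullet> a = s" "0 < velocity a s \<bullet> (- snd a, fst a)"
proof -
  let ?n = "(- snd a, fst a) :: plane"
  have n: "norm ?n = 1" using a by (simp add: norm_rot)
  have aa: "a \<bullet> a = 1" "?n \<bullet> ?n = 1" using a n by (simp_all only: dot_square_norm) simp_all
  have s2: "0 < 1 - s\<^sup>2" using s by (simp add: abs_square_less_1 abs_less_iff)
  have va: "velocity a s \<bullet> a = s" and vn: "velocity a s \<bullet> ?n = sqrt (1 - s\<^sup>2)"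
    unfolding velocity_def using aa by (simp_all only: inner_add_left inner_scaleR_left inner_rot)
  then show "velocity a s \<bullet> a = s" "0 < velocity a s \<bullet> ?n" using s2 by simp_all
  have "velocity a s \<bullet> velocity a s = sqrt (1 - s\<^sup>2) * (velocity a s \<bullet> ?n) + s * (velocity a s \<bullet> a)"
    by (subst (2) velocity_def) (simp only: inner_add_right inner_scaleR_right)
  also have "\<dots> = 1" unfolding va vn using s2 by (simp add: power2_eq_square[symmetric])
  finally show "norm (velocity a s) = 1" by (simp add: norm_eq_1)
qed

text \<open>In the frame of \<open>a\<close> and its rotation the normal component of
  \<open>v\<close> is the positive square root of \<open>1 - (v \<bullet> a)^2\<close>. Together
  with \<open>velocity_props\<close>, \<open>s\<close> parametrizes exactly an open half
  circle.\<close>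

lemma velocity_unique:
  assumes a: "norm a = 1" and v: "norm v = 1" "0 < v \<bullet> (- snd a, fst a)"
  shows "velocity a (v \<bullet> a) = v" "- 1 < v \<bullet> a" "v \<bullet> a < 1"
proof -
  let ?n = "(- snd a, fst a) :: plane"
  have f: "v = (v \<bullet> a) *\<^sub>R a + (v \<bullet> ?n) *\<^sub>R ?n" by (rule plane_frame[OF a])
  have "v \<bullet> v = (v \<bullet> a) * (v \<bullet> a) + (v \<bullet> ?n) * (v \<bullet> ?n)"
    by (subst (2) f) (simp only: inner_add_right inner_scaleR_right)
  then have eq: "1 - (v \<bullet> a)\<^sup>2 = (v \<bullet> ?n)\<^sup>2" using v(1) by (simp add: norm_eq_1 power2_eq_square)
  then have "sqrt (1 - (v \<bullet> a)\<^sup>2) = v \<bullet> ?n" using v(2) by simp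
  then show "velocity a (v \<bullet> a) = v" unfolding velocity_def using f by (simp add: add.commute)
  have "0 < (v \<bullet> ?n)\<^sup>2" using v(2) by simp
  then have "(v \<bullet> a)\<^sup>2 < 1" using eq by linarith
  then have "\<bar>v \<bullet> a\<bar> < 1" by (simp add: abs_square_less_1)
  then show "- 1 < v \<bullet> a" "v \<bullet> a < 1" by auto
qed

text \<open>The derivative of \<open>sgn\<close> removes the radial part and divides by the
  distance; in the plane what remains is a product of components along rotated vectors. Its second
  factor vanishes where the ray from \<open>z\<close> is tangent to the curve.\<close>

lemma direction_derivative:
  fixes a b z :: plane
  assumes f: "(f has_vector_derivative b) (at r)" and z: "f r \<noteq> z"
  shows "((\<lambda>r. sgn (f r - z) \<bullet> a) has_field_derivative
    ((sgn (f r - z) \<bullet> (- snd a, fst a)) * (sgn (f r - z) \<bullet> (- snd b, fst b)) / norm (f r - z))) (at r)"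
proof -
  define X where "X r = fst (f r) - fst z" for r
  define Y where "Y r = snd (f r) - snd z" for r
  have fd: "(f has_derivative (\<lambda>h. h *\<^sub>R b)) (at r)" using f by (simp add: has_vector_derivative_def)
  have "((\<lambda>r. fst (f r)) has_derivative (\<lambda>h. fst (h *\<^sub>R b))) (at r)"
    "((\<lambda>r. snd (f r)) has_derivative (\<lambda>h. snd (h *\<^sub>R b))) (at r)"
    using has_derivative_fst[OF fd] has_derivative_snd[OF fd] by auto
  then have "((\<lambda>r. fst (f r)) has_field_derivative fst b) (at r)"
    "((\<lambda>r. snd (f r)) has_field_derivative snd b) (at r)"
    by (simp_all add: has_field_derivative_def mult.commute[of _ "fst b"] mult.commute[of _ "snd b"])
  then have X: "(X has_field_derivative fst b) (at r)" and Y: "(Y has_field_derivative snd b) (at r)"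
    unfolding X_def[abs_def] Y_def[abs_def] by (auto intro!: derivative_eq_intros)
  define L where "L r = sqrt ((X r)\<^sup>2 + (Y r)\<^sup>2)" for r
  have L: "norm (f x - z) = L x" for x
    by (simp add: L_def X_def Y_def norm_prod_def)
  have L0: "0 < L r" using z L[of r] by (metis right_minus_eq zero_less_norm_iff)
  then have Q: "0 < (X r)\<^sup>2 + (Y r)\<^sup>2" by (simp add: L_def)
  have LL: "L r * L r = X r * X r + Y r * Y r"
    using Q by (simp add: L_def power2_eq_square)
  have "(L has_field_derivative ((X r * fst b + Y r * snd b) / L r)) (at r)"
    unfolding L_def[abs_def] using Q
    by (auto intro!: derivative_eq_intros X Y simp: divide_simps)
  then have "((\<lambda>r. (X r * fst a + Y r * snd a) / L r) has_field_derivative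
     ((fst b * fst a + snd b * snd a) * L r - (X r * fst a + Y r * snd a) * ((X r * fst b + Y r * snd b) / L r)) / (L r * L r)) (at r)"
    using L0 by (auto intro!: derivative_eq_intros X Y)
  moreover have "((fst b * fst a + snd b * snd a) * L r - (X r * fst a + Y r * snd a) * ((X r * fst b + Y r * snd b) / L r)) / (L r * L r)
    = ((Y r * fst a - X r * snd a) / L r) * ((Y r * fst b - X r * snd b) / L r) / L r"
  proof -
    \<comment> \<open>Lagrange's identity in the plane, after replacing the squared distance by the
      sum of squares.\<close>
    have "(fst b * fst a + snd b * snd a) * (L r * L r) - (X r * fst a + Y r * snd a) * (X r * fst b + Y r * snd b)
      = (Y r * fst a - X r * snd a) * (Y r * fst b - X r * snd b)"
      unfolding LL by (simp add: algebra_simps)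
    then show ?thesis using L0 by (simp add: divide_simps)
  qed
  moreover have "sgn (f x - z) \<bullet> a = (X x * fst a + Y x * snd a) / L x" for x
    by (simp add: sgn_div_norm L X_def Y_def inner_prod_def divide_inverse algebra_simps)
  moreover have "sgn (f r - z) \<bullet> (- snd c, fst c) = (Y r * fst c - X r * snd c) / L r" for c :: plane
    by (simp add: sgn_div_norm L X_def Y_def inner_prod_def divide_inverse algebra_simps)
  ultimately show ?thesis by (simp only: L)
qed

context classical_billiard
begin

section \<open>Almost every direction ends in a proper hit\<close>

text \<open>A tangential direction is a critical value of the direction as a function of the
  boundary parameter, so the Sard lemma applies on each curve; the parameters that are not nice
  contribute finitely many directions.\<close>

lemma negligible_bad_directions:
  assumes a: "norm a = 1"
  shows "negligible {sgn (p - z) \<bullet> a | p. p \<noteq> z \<and> bad_point (sgn (p - z)) p}" (is "negligible ?B")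
proof -
  define S where "S j = {r. nice j r \<and> wall T j r \<noteq> z \<and> sgn (wall T j r - z) \<bullet> normal T j r = 0}" for j
  define F where "F = (\<Union>j<N. wall T j ` {r \<in> {lo T j..hi T j}. \<not> nice j r})"
  have "negligible ((\<lambda>r. sgn (wall T j r - z) \<bullet> a) ` S j)" for j
  proof (rule negligible_zero_derivative_image)
    fix r assume r: "r \<in> S j"
    then have "((\<lambda>r. sgn (wall T j r - z) \<bullet> a) has_field_derivative
        ((sgn (wall T j r - z) \<bullet> (- snd a, fst a)) * (sgn (wall T j r - z) \<bullet> normal T j r) / norm (wall T j r - z))) (at r)"
      unfolding normal_def S_def by (intro direction_derivative smooth_derivatives nice_smooth) auto
    then show "((\<lambda>r. sgn (wall T j r - z) \<bullet> a) has_field_derivative 0) (at r within S j)"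
      using r by (auto simp: S_def intro: has_field_derivative_at_within)
  qed
  then have "negligible (\<Union>j<N. (\<lambda>r. sgn (wall T j r - z) \<bullet> a) ` S j)"
    by (intro negligible_Union) auto
  moreover have "finite F" unfolding F_def using finite_not_nice by auto
  then have "negligible ((\<lambda>p. sgn (p - z) \<bullet> a) ` F)" by (intro negligible_finite) auto
  moreover have "?B \<subseteq> (\<Union>j<N. (\<lambda>r. sgn (wall T j r - z) \<bullet> a) ` S j) \<union> (\<lambda>p. sgn (p - z) \<bullet> a) ` F"
  proof
    fix s assume "s \<in> ?B"
    then obtain p j r where p: "s = sgn (p - z) \<bullet> a" "p \<noteq> z" "j < N" "r \<in> {lo T j..hi T j}" "p = wall T j r"
      "\<not> nice j r \<or> sgn (p - z) \<bullet> normal T j r = 0"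
      unfolding bad_point_def by blast
    show "s \<in> (\<Union>j<N. (\<lambda>r. sgn (wall T j r - z) \<bullet> a) ` S j) \<union> (\<lambda>p. sgn (p - z) \<bullet> a) ` F"
    proof (cases "nice j r")
      case True
      then have "r \<in> S j" using p by (auto simp: S_def)
      then show ?thesis using p by auto
    next
      case False
      then have "p \<in> F" using p by (auto simp: F_def)
      then show ?thesis using p by auto
    qed
  qed
  ultimately show ?thesis by (meson negligible_Un negligible_subset)
qed

text \<open>A direction without a proper hit has a bad point \<open>p\<close> on its ray; its
  parameter \<open>s\<close> is then \<open>sgn (p - z) \<bullet> a\<close>, an element of the null
  set of bad directions.\<close>

lemma AE_ray_hit:
  assumes a: "norm a = 1"
    and enter: "\<And>s. - 1 < s \<Longrightarrow> s < 1 \<Longrightarrow> \<exists>\<eta>>0. \<forall>u. 0 < u \<and> u < \<eta> \<longrightarrow> z + u *\<^sub>R velocity a s \<in> domain"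
  shows "AE s in lborel. - 1 < s \<and> s < 1 \<longrightarrow> (\<exists>j r t. hit z (velocity a s) j r t)"
proof -
  let ?B = "{sgn (p - z) \<bullet> a | p. p \<noteq> z \<and> bad_point (sgn (p - z)) p}"
  have "?B \<in> null_sets lebesgue"
    using negligible_bad_directions[OF a, of z] by (simp add: negligible_iff_null_sets)
  then have "AE s in lebesgue. s \<notin> ?B" by (rule AE_not_in)
  then have "AE s in lborel. s \<notin> ?B" by (simp add: AE_completion_iff)
  then show ?thesis
  proof (rule AE_mp, intro AE_I2 impI)
    fix s assume nb: "s \<notin> ?B" and s: "- 1 < s \<and> s < 1"
    let ?v = "velocity a s"
    have v: "norm ?v = 1" "?v \<bullet> a = s" using velocity_props[OF a] s by auto
    obtain \<eta> where "0 < \<eta>" "\<And>u. 0 < u \<Longrightarrow> u < \<eta> \<Longrightarrow> z + u *\<^sub>R ?v \<in> domain"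
      using enter[of s] s by blast
    from ray_hit[OF _ this] v consider "\<exists>j r t. hit z ?v j r t" | t where "0 < t" "bad_point ?v (z + t *\<^sub>R ?v)"
      by fastforce
    then show "\<exists>j r t. hit z ?v j r t"
    proof cases
      case 2
      have sg: "sgn (z + t *\<^sub>R ?v - z) = ?v" using 2(1) v(1) by (simp add: sgn_scaleR sgn_div_norm)
      have "z + t *\<^sub>R ?v \<noteq> z" using 2(1) v(1) by auto
      then have "sgn (z + t *\<^sub>R ?v - z) \<bullet> a \<in> ?B" using 2(2) sg by (intro CollectI exI[of _ "z + t *\<^sub>R ?v"]) auto
      then show ?thesis using nb v(2) unfolding sg by simp
    qed
  qed
qed

lemma hit_unique:
  assumes "hit z v j r t" "hit z v j' r' t'"
  shows "t' = t \<and> j' = j \<and> r' = r"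
proof -
  have "\<not> t1 < t2" if "hit z v j1 r1 t1" "hit z v j2 r2 t2" for j1 r1 t1 j2 r2 t2
  proof
    assume "t1 < t2"
    then have "wall T j1 r1 \<in> domain" using that unfolding hit_def by metis
    moreover have "wall T j1 r1 \<in> frontier (region T)" using that nice_frontier unfolding hit_def by blast
    ultimately show False by (simp add: frontier_def)
  qed
  from this[OF assms] this[OF assms(2) assms(1)] have t: "t' = t" by simp
  then have "wall T j r = wall T j' r'" "nice j r" "nice j' r'" using assms unfolding hit_def by metis+
  then show ?thesis using t nice_unique[of j r j' r'] nice_bounds[of j' r'] by auto
qed

section \<open>Chords as coordinates on outgoing collisions\<close>

text \<open>The coordinate \<open>s\<close> at the end \<open>(i, r)\<close> of the chord to
  \<open>(j, r')\<close>.\<close>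

definition sine :: "nat \<Rightarrow> real \<Rightarrow> nat \<Rightarrow> real \<Rightarrow> real" where
  "sine i r j r' = sgn (wall T j r' - wall T i r) \<bullet> tangent T i r"

text \<open>The absolute value of the derivative of \<open>s\<close> with respect to
  \<open>r'\<close> along chords, so that \<open>ds\<close> becomes \<open>jac\<close> times
  \<open>dr'\<close>. The second inner product is negative on a chord, whence the minus sign. The
  formula is symmetric in the two ends.\<close>

definition jac :: "nat \<Rightarrow> real \<Rightarrow> nat \<Rightarrow> real \<Rightarrow> real" where
  "jac i r j r' = - ((sgn (wall T j r' - wall T i r) \<bullet> normal T i r) *
     (sgn (wall T j r' - wall T i r) \<bullet> normal T j r')) / norm (wall T j r' - wall T i r)"

lemma sgn_inner_pos: "0 < x \<bullet> y \<Longrightarrow> 0 < sgn x \<bullet> (y :: plane)" and sgn_inner_neg: "x \<bullet> y < 0 \<Longrightarrow> sgn x \<bullet> (y :: plane) < 0"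
  by (cases "x = 0"; simp add: sgn_div_norm zero_less_mult_iff mult_less_0_iff)+

lemma chord_hit:
  assumes c: "chord i r j r'"
  shows "hit (wall T i r) (sgn (wall T j r' - wall T i r)) j r' (norm (wall T j r' - wall T i r))"
    and "0 < sgn (wall T j r' - wall T i r) \<bullet> normal T i r"
    and "sgn (wall T j r' - wall T i r) \<bullet> normal T j r' < 0"
proof -
  let ?d = "wall T j r' - wall T i r"
  have d: "0 < norm ?d" using chord_distinct[OF c] by simp
  show 1: "0 < sgn ?d \<bullet> normal T i r" "sgn ?d \<bullet> normal T j r' < 0"
    using c sgn_inner_pos sgn_inner_neg unfolding chord_def Let_def by auto
  have "wall T i r + u *\<^sub>R sgn ?d \<in> domain" if "0 < u" "u < norm ?d" for u
  proof -
    have "u *\<^sub>R sgn ?d = (u / norm ?d) *\<^sub>R ?d" by (simp add: sgn_div_norm divide_inverse)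
    moreover have "0 < u / norm ?d" "u / norm ?d < 1" using that d by auto
    ultimately show ?thesis using c unfolding chord_def Let_def by auto
  qed
  moreover have "wall T i r + norm ?d *\<^sub>R sgn ?d = wall T j r'" using d by (simp add: sgn_div_norm)
  ultimately show "hit (wall T i r) (sgn ?d) j r' (norm ?d)"
    unfolding hit_def using c d 1 by (auto simp: chord_def)
qed

lemma chord_velocity:
  assumes c: "chord i r j r'"
  shows "velocity (tangent T i r) (sine i r j r') = sgn (wall T j r' - wall T i r)"
    and "- 1 < sine i r j r'" "sine i r j r' < 1"
proof -
  let ?d = "wall T j r' - wall T i r"
  have a: "norm (tangent T i r) = 1" using c norm_tangent nice_smooth unfolding chord_def by blast
  have "norm (sgn ?d) = 1" using chord_distinct[OF c] by (simp add: norm_sgn)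
  from velocity_unique[OF a this] chord_hit(2)[OF c]
  show "velocity (tangent T i r) (sine i r j r') = sgn ?d" "- 1 < sine i r j r'" "sine i r j r' < 1"
    unfolding sine_def normal_def by auto
qed

lemma jac_sym: "jac i r j r' = jac j r' i r"
proof -
  have "wall T i r - wall T j r' = - (wall T j r' - wall T i r)" by simp
  then show ?thesis unfolding jac_def
    by (simp only: sgn_minus inner_minus_left norm_minus_cancel) (simp add: mult.commute)
qed

lemma jac_pos: "chord i r j r' \<Longrightarrow> 0 < jac i r j r'"
  using chord_hit(2,3)[of i r j r'] chord_distinct[of i r j r']
  unfolding jac_def by (auto intro!: divide_neg_pos mult_pos_neg)

lemma chord_of_hit_velocity:
  assumes r: "nice i r" and s: "- 1 < s" "s < 1" and h: "hit (wall T i r) (velocity (tangent T i r) s) j r' t"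
  shows "chord i r j r'" "sine i r j r' = s"
proof -
  let ?v = "velocity (tangent T i r) s"
  have a: "norm (tangent T i r) = 1" using r norm_tangent nice_smooth by blast
  note v = velocity_props[OF a s]
  show "chord i r j r'" using chord_of_hit[OF r _ h] v(3) by (simp add: normal_def)
  have "wall T j r' - wall T i r = t *\<^sub>R ?v" "0 < t" using h unfolding hit_def by (auto simp: algebra_simps)
  then have "sgn (wall T j r' - wall T i r) = ?v" using v(1) by (simp add: sgn_scaleR sgn_div_norm)
  then show "sine i r j r' = s" unfolding sine_def using v(2) by simp
qed

text \<open>Reflection keeps the tangential component, so the new \<open>s\<close> is read off the
  incoming velocity; along the reversed chord it appears with the opposite sign. Any competing
  collision ends at a frontier point, which fixes the flight time, and \<open>nice_unique\<close>
  then fixes curve and parameter.\<close>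

lemma next_collision_chord:
  assumes c: "chord i r j r'"
  shows "billiard_map T (i, r, sine i r j r') = (j, r', - sine j r' i r)"
proof -
  let ?d = "wall T j r' - wall T i r"
  let ?v = "sgn ?d"
  have ij: "nice i r" "nice j r'" using c by (auto simp: chord_def)
  have v: "out_velocity T (i, r, sine i r j r') = ?v"
    using chord_velocity(1)[OF c] unfolding out_velocity_def velocity_def normal_def by simp
  note h = chord_hit[OF c]
  have refl: "sin_angle (reflect w (normal T k x)) (normal T k x) = w \<bullet> tangent T k x" for w k x
    unfolding sin_angle_def reflect_def normal_def by (simp add: inner_prod_def algebra_simps)
  have s': "- sine j r' i r = ?v \<bullet> tangent T j r'"
  proof -
    have "wall T i r - wall T j r' = - ?d" by simp
    then show ?thesis unfolding sine_def by (simp only: sgn_minus inner_minus_left)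
  qed
  have "next_collision T (i, r, sine i r j r') (j, r', - sine j r' i r)"
    unfolding next_collision_def Let_def prod.case v refl s'
    using chord_velocity(2,3)[OF c] ij nice_smooth h unfolding hit_def
    by (auto intro!: exI[of _ "norm ?d"])
  moreover have "y = (j, r', - sine j r' i r)" if n: "next_collision T (i, r, sine i r j r') y" for y
  proof -
    obtain k x s where y: "y = (k, x, s)" by (cases y)
    obtain t where t: "0 < t" "wall T i r + t *\<^sub>R ?v = wall T k x"
      "\<And>u. 0 < u \<Longrightarrow> u < t \<Longrightarrow> wall T i r + u *\<^sub>R ?v \<in> domain"
      and kx: "smooth_point T k x" and s: "s = ?v \<bullet> tangent T k x"
      using n unfolding y next_collision_def Let_def prod.case v refl by auto
    have "wall T k x \<in> frontier (region T)"
      using smooth_bounds[OF kx] by (intro wall_frontier) auto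
    moreover have "wall T j r' \<in> frontier (region T)" by (rule nice_frontier[OF ij(2)])
    ultimately have "t = norm ?d"
      using t h(1) unfolding hit_def frontier_def by (metis DiffE linorder_neqE_linordered_idom)
    then have "wall T j r' = wall T k x" using t(2) h(1) unfolding hit_def by simp
    then have "k = j \<and> x = r'" using nice_unique[OF ij(2)] smooth_bounds[OF kx] by auto
    then show ?thesis unfolding y s s' by simp
  qed
  ultimately show ?thesis unfolding billiard_map_def by (rule the_equality)
qed

lemma open_chord_slice: "open {r'. chord i r j r'}"
proof -
  have "open ((\<lambda>r'. (r, r')) -` {p. chord i (fst p) j (snd p)})"
    by (intro open_vimage open_chord continuous_intros)
  then show ?thesis by (simp add: vimage_def)
qed

text \<open>For a fixed starting point, \<open>r'\<close> and \<open>s\<close> are two parametrizations of the outgoing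
  directions, up to a null set.\<close>

lemma nn_integral_directions:
  assumes r: "nice i r" and h: "h \<in> borel_measurable borel"
  shows "(\<Sum>j<N. \<integral>\<^sup>+r'. indicator {r'. chord i r j r'} r' * ennreal (jac i r j r') * h (sine i r j r') \<partial>lborel) =
    (\<integral>\<^sup>+s. indicator {-1..1} s * h s \<partial>lborel)"
proof -
  let ?a = "tangent T i r" and ?z = "wall T i r"
  have a: "norm ?a = 1" using r norm_tangent nice_smooth by blast
  define S where "S j = {r'. chord i r j r'}" for j
  define g' where "g' j r' = (sgn (wall T j r' - ?z) \<bullet> normal T i r) * (sgn (wall T j r' - ?z) \<bullet> normal T j r') /
    norm (wall T j r' - ?z)" for j r'
  have S: "open (S j)" for j unfolding S_def by (rule open_chord_slice)
  have Sn: "nice j r'" "wall T j r' \<noteq> ?z" if "r' \<in> S j" for j r'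
    using that chord_distinct unfolding S_def by (auto simp: chord_def)
  have jac: "\<bar>g' j r'\<bar> = jac i r j r'" if "r' \<in> S j" for j r'
  proof -
    have "g' j r' = - jac i r j r'" by (simp add: jac_def g'_def)
    then show ?thesis using jac_pos[of i r j r'] that unfolding S_def by simp
  qed
  have der: "(sine i r j has_field_derivative g' j r') (at r')" if "r' \<in> S j" for j r'
    unfolding sine_def[abs_def] g'_def normal_def
    by (intro direction_derivative smooth_derivatives nice_smooth Sn[OF that])
  \<comment> \<open>The value of \<open>s\<close> determines the direction and hence the hit; so
    each map is injective and the images for different curves are disjoint.\<close>
  have same: "j1 = j2 \<and> r1 = r2" if "r1 \<in> S j1" "r2 \<in> S j2" "sine i r j1 r1 = sine i r j2 r2" for j1 j2 r1 r2
    using that chord_velocity(1) chord_hit(1) hit_unique unfolding S_def by (metis mem_Collect_eq)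
  have inj: "inj_on (sine i r j) (S j)" for j by (rule inj_onI) (use same in blast)
  have cont: "continuous_on (S j) (g' j)" for j
    unfolding g'_def[abs_def] sgn_div_norm
    by (intro continuous_intros continuous_at_imp_continuous_on ballI isCont_wall isCont_normal nice_smooth)
      (use Sn in auto)
  have sub: "(\<integral>\<^sup>+r'. indicator {r'. chord i r j r'} r' * ennreal (jac i r j r') * h (sine i r j r') \<partial>lborel) =
    (\<integral>\<^sup>+s. indicator (sine i r j ` S j) s * h s \<partial>lborel)" for j
  proof -
    have "(\<integral>\<^sup>+r'. indicator {r'. chord i r j r'} r' * ennreal (jac i r j r') * h (sine i r j r') \<partial>lborel) =
      (\<integral>\<^sup>+r'. indicator (S j) r' * ennreal \<bar>g' j r'\<bar> * h (sine i r j r') \<partial>lborel)"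
      by (intro nn_integral_cong) (use jac in \<open>auto simp: S_def split: split_indicator\<close>)
    also have "\<dots> = (\<integral>\<^sup>+s. indicator (sine i r j ` S j) s * h s \<partial>lborel)"
      by (rule nn_integral_substitution_open(2)[OF S der inj cont h])
    finally show ?thesis .
  qed
  have img: "sine i r j ` S j \<in> sets borel" for j
    by (rule nn_integral_substitution_open(1)[OF S der inj cont h])
  have "AE s in lborel. - 1 < s \<and> s < 1 \<longrightarrow> (\<exists>j r' t. hit ?z (velocity ?a s) j r' t)"
  proof (rule AE_ray_hit[OF a])
    fix s :: real assume "- 1 < s" "s < 1"
    then have "0 < velocity ?a s \<bullet> normal T i r" using velocity_props(3)[OF a] by (simp add: normal_def)
    then show "\<exists>\<eta>>0. \<forall>u. 0 < u \<and> u < \<eta> \<longrightarrow> ?z + u *\<^sub>R velocity ?a s \<in> domain"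
      using ray_enters_domain[OF r] by metis
  qed
  \<comment> \<open>The values \<open>-1\<close> and \<open>1\<close> are the grazing directions,
    about which \<open>AE_ray_hit\<close> says nothing.\<close>
  moreover have "AE s in lborel. s \<noteq> (-1 :: real)" "AE s in lborel. s \<noteq> (1 :: real)"
    by (rule AE_lborel_singleton)+
  ultimately have ae: "AE s in lborel. (\<Sum>j<N. indicator (sine i r j ` S j) s * h s) = indicator {-1..1} s * h s"
  proof eventually_elim
    case (elim s)
    show ?case
    proof (cases "- 1 < s \<and> s < 1")
      case True
      then obtain j r' t where hit: "hit ?z (velocity ?a s) j r' t" using elim by auto
      note ch = chord_of_hit_velocity[OF r _ _ hit]
      have r': "r' \<in> S j" "sine i r j r' = s" using ch True by (auto simp: S_def)
      have jN: "j < N" using nice_bounds[OF Sn(1)[OF r'(1)]] by simp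
      have "(\<Sum>k<N. indicator (sine i r k ` S k) s * h s) = (\<Sum>k<N. if k = j then h s else 0)"
      proof (rule sum.cong[OF refl])
        fix k
        have "s \<in> sine i r k ` S k \<longleftrightarrow> k = j" using r' same by fastforce
        then show "indicator (sine i r k ` S k) s * h s = (if k = j then h s else 0)"
          by (cases "k = j") simp_all
      qed
      then show ?thesis using True jN by simp
    next
      case False
      then have s: "s \<notin> {-1..1}" using elim by auto
      have "s \<notin> sine i r k ` S k" for k
        using chord_velocity(2,3)[of i r k] s unfolding S_def by force
      then show ?thesis using s by simp
    qed
  qed
  have "(\<Sum>j<N. \<integral>\<^sup>+r'. indicator {r'. chord i r j r'} r' * ennreal (jac i r j r') * h (sine i r j r') \<partial>lborel) =
    (\<Sum>j<N. \<integral>\<^sup>+s. indicator (sine i r j ` S j) s * h s \<partial>lborel)"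
    unfolding sub ..
  also have "\<dots> = (\<integral>\<^sup>+s. (\<Sum>j<N. indicator (sine i r j ` S j) s * h s) \<partial>lborel)"
    using img h by (intro nn_integral_sum[symmetric]) auto
  also have "\<dots> = (\<integral>\<^sup>+s. indicator {-1..1} s * h s \<partial>lborel)"
    by (rule nn_integral_cong_AE[OF ae])
  finally show ?thesis .
qed

end

section \<open>The billiard map preserves the measure\<close>

text \<open>Every set of natural numbers is Borel; this reconciles the two descriptions of
  collisions, by \<open>borel\<close> and by a product with \<open>count_space\<close>.\<close>

lemma sets_count_lborel: "sets (count_space UNIV \<Otimes>\<^sub>M lborel) = sets (borel :: (nat \<times> 'a::euclidean_space) measure)"
proof -
  have "sets (count_space (UNIV :: nat set) \<Otimes>\<^sub>M (lborel :: 'a measure)) = sets (borel \<Otimes>\<^sub>M borel)"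
    by (intro sets_pair_measure_cong sets_borel_eq_count_space[symmetric] sets_lborel)
  then show ?thesis by (simp only: borel_prod)
qed

lemma nn_integral_lborel_swap:
  fixes f :: "real \<times> real \<Rightarrow> ennreal"
  assumes f: "f \<in> borel_measurable borel"
  shows "(\<integral>\<^sup>+p. f (snd p, fst p) \<partial>lborel) = (\<integral>\<^sup>+p. f p \<partial>lborel)"
proof -
  have f': "f \<in> borel_measurable (lborel \<Otimes>\<^sub>M lborel)" using f by (simp add: lborel_prod)
  have "(\<integral>\<^sup>+p. f p \<partial>(lborel \<Otimes>\<^sub>M lborel)) =
    (\<integral>\<^sup>+p. f p \<partial>distr (lborel \<Otimes>\<^sub>M lborel) (lborel \<Otimes>\<^sub>M lborel) (\<lambda>(x, y). (y, x)))"
    by (simp only: lborel_pair.distr_pair_swap[symmetric])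
  also have "\<dots> = (\<integral>\<^sup>+p. f (snd p, fst p) \<partial>(lborel \<Otimes>\<^sub>M lborel))"
    using f' by (subst nn_integral_distr) (simp_all add: split_beta)
  finally show ?thesis by (simp add: lborel_prod)
qed

context classical_billiard
begin

section \<open>Integrals against \<open>dr ds\<close>\<close>

lemma sets_collisions: "collisions T \<in> sets borel"
proof -
  have "collisions T = (\<Union>i<N. {i} \<times> ({lo T i..<hi T i} \<times> {-1..1}))"
    by (auto simp: collisions_def)
  moreover have "{i} \<times> ({lo T i..<hi T i} \<times> {-1..1::real}) \<in> sets borel" for i
    by (intro borel_Times) auto
  ultimately show ?thesis by simp
qed

lemma space_collision_space: "space (collision_space T) = collisions T"
  by (simp add: collision_space_def space_restrict_space)

lemma sets_collision_space: "sets (collision_space T) = {B. B \<subseteq> collisions T \<and> B \<in> sets borel}"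
  using sets_collisions by (auto simp: collision_space_def sets_restrict_space_iff)

lemma sets_billiard_measure: "sets (billiard_measure T) = sets (collision_space T)"
  unfolding billiard_measure_def collision_space_def
  by (simp add: sets_restrict_space sets_count_lborel)

lemma space_billiard_measure: "space (billiard_measure T) = collisions T"
  using sets_eq_imp_space_eq[OF sets_billiard_measure] by (simp add: space_collision_space)

lemma perimeter_pos: "0 < perimeter T"
  unfolding perimeter_def using lo_less_hi N_pos by (intro sum_pos) (auto simp: lessThan_empty_iff)

text \<open>The integral of \<open>h\<close> against \<open>dr ds\<close>, without the factor
  \<open>1 / (2 * perimeter T)\<close>. The order of integration is such that, for a fixed start
  \<open>r\<close>, the integral over \<open>s\<close> can be replaced by one over chords.\<close>

definition unnormalized :: "(collision \<Rightarrow> ennreal) \<Rightarrow> ennreal" where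
  "unnormalized h = (\<Sum>i<N. \<integral>\<^sup>+r. indicator {lo T i..<hi T i} r * (\<integral>\<^sup>+s. indicator {-1..1} s * h (i, r, s) \<partial>lborel) \<partial>lborel)"

lemma slice_measurable: "(\<lambda>x. h (i, x)) \<in> borel_measurable borel" if "h \<in> borel_measurable borel"
  for i :: nat and h :: "collision \<Rightarrow> ennreal"
  by (rule measurable_compose[OF _ that]) (intro borel_measurable_continuous_onI continuous_intros)

lemma unnormalized_plane:
  assumes h: "h \<in> borel_measurable borel"
  shows "unnormalized h = (\<Sum>i<N. \<integral>\<^sup>+x. indicator ({lo T i..<hi T i} \<times> {-1..1}) x * h (i, x) \<partial>lborel)"
  unfolding unnormalized_def
proof (rule sum.cong[OF refl])
  fix i
  have R: "{lo T i..<hi T i} \<times> {-1..1::real} \<in> sets borel" by (intro borel_Times) auto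
  have m: "(\<lambda>x. indicator ({lo T i..<hi T i} \<times> {-1..1}) x * h (i, x)) \<in> borel_measurable borel"
    using slice_measurable[OF h, of i] R by simp
  have "(\<integral>\<^sup>+x. indicator ({lo T i..<hi T i} \<times> {-1..1}) x * h (i, x) \<partial>lborel) =
    (\<integral>\<^sup>+x. indicator ({lo T i..<hi T i} \<times> {-1..1}) x * h (i, x) \<partial>(lborel \<Otimes>\<^sub>M lborel))"
    by (simp add: lborel_prod)
  also have "\<dots> = (\<integral>\<^sup>+r. \<integral>\<^sup>+s. indicator ({lo T i..<hi T i} \<times> {-1..1}) (r, s) * h (i, r, s) \<partial>lborel \<partial>lborel)"
    by (rule lborel.nn_integral_fst[symmetric]) (use m in \<open>simp add: lborel_prod\<close>)
  also have "\<dots> = (\<integral>\<^sup>+r. \<integral>\<^sup>+s. indicator {lo T i..<hi T i} r * (indicator {-1..1} s * h (i, r, s)) \<partial>lborel \<partial>lborel)"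
    by (intro nn_integral_cong) (auto simp: indicator_def)
  also have "\<dots> = (\<integral>\<^sup>+r. indicator {lo T i..<hi T i} r * (\<integral>\<^sup>+s. indicator {-1..1} s * h (i, r, s) \<partial>lborel) \<partial>lborel)"
  proof (intro nn_integral_cong nn_integral_cmult)
    fix r :: real
    have "(\<lambda>s. h (i, r, s)) \<in> borel_measurable borel"
      by (rule measurable_compose[OF _ h]) (intro borel_measurable_continuous_onI continuous_intros)
    then show "(\<lambda>s. indicator {-1..1} s * h (i, r, s)) \<in> borel_measurable lborel" by simp
  qed
  finally show "(\<integral>\<^sup>+r. indicator {lo T i..<hi T i} r * (\<integral>\<^sup>+s. indicator {-1..1} s * h (i, r, s) \<partial>lborel) \<partial>lborel) =
      (\<integral>\<^sup>+x. indicator ({lo T i..<hi T i} \<times> {-1..1}) x * h (i, x) \<partial>lborel)" ..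
qed

lemma nn_integral_billiard_measure:
  assumes h: "h \<in> borel_measurable borel"
  shows "(\<integral>\<^sup>+x. h x \<partial>billiard_measure T) = ennreal (1 / (2 * perimeter T)) * unnormalized h"
proof -
  let ?C = "count_space (UNIV :: nat set)"
  have C: "collisions T \<in> sets (?C \<Otimes>\<^sub>M lborel)" using sets_collisions by (simp only: sets_count_lborel)
  have hm: "h \<in> borel_measurable (?C \<Otimes>\<^sub>M lborel)"
    using h by (simp only: measurable_cong_sets[OF sets_count_lborel refl])
  have hC: "(\<lambda>x. h x * indicator (collisions T) x) \<in> borel_measurable (?C \<Otimes>\<^sub>M lborel)"
    using hm C by simp
  have "(\<integral>\<^sup>+x. h x \<partial>billiard_measure T) = ennreal (1 / (2 * perimeter T)) *
      (\<integral>\<^sup>+x. h x \<partial>restrict_space (?C \<Otimes>\<^sub>M lborel) (collisions T))"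
    unfolding billiard_measure_def
    by (rule nn_integral_scale_measure) (use hm in \<open>simp add: measurable_restrict_space1\<close>)
  also have "(\<integral>\<^sup>+x. h x \<partial>restrict_space (?C \<Otimes>\<^sub>M lborel) (collisions T)) =
      (\<integral>\<^sup>+x. h x * indicator (collisions T) x \<partial>(?C \<Otimes>\<^sub>M lborel))"
    by (rule nn_integral_restrict_space) (use C in simp)
  also have "\<dots> = (\<integral>\<^sup>+i. \<integral>\<^sup>+x. h (i, x) * indicator (collisions T) (i, x) \<partial>lborel \<partial>?C)"
    by (rule lborel.nn_integral_fst[symmetric, OF hC])
  also have "\<dots> = (\<Sum>i<N. \<integral>\<^sup>+x. h (i, x) * indicator (collisions T) (i, x) \<partial>lborel)"
    by (rule nn_integral_count_space') (auto simp: collisions_def indicator_def)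
  also have "\<dots> = unnormalized h"
    unfolding unnormalized_plane[OF h]
    by (intro sum.cong refl nn_integral_cong) (auto simp: collisions_def indicator_def)
  finally show ?thesis .
qed

lemma prob_space_billiard_measure: "prob_space (billiard_measure T)"
proof
  have "emeasure (billiard_measure T) (space (billiard_measure T)) = (\<integral>\<^sup>+x. 1 \<partial>billiard_measure T)" by simp
  also have "\<dots> = ennreal (1 / (2 * perimeter T)) * unnormalized (\<lambda>_. 1)"
    by (rule nn_integral_billiard_measure) simp
  also have "unnormalized (\<lambda>_. 1) = (\<Sum>i<N. ennreal (2 * (hi T i - lo T i)))"
    unfolding unnormalized_def
  proof (rule sum.cong[OF refl])
    fix i assume "i \<in> {..<N}"
    then have "lo T i < hi T i" using lo_less_hi by simp
    have s: "(\<integral>\<^sup>+s. indicator {-1..1::real} s * 1 \<partial>lborel) = ennreal 2"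
      using nn_integral_indicator[of "{-1..1::real}" lborel] by simp
    have r: "(\<integral>\<^sup>+r. indicator {lo T i..<hi T i} r * ennreal 2 \<partial>lborel) = emeasure lborel {lo T i..<hi T i} * ennreal 2"
      by (subst nn_integral_multc) simp_all
    show "(\<integral>\<^sup>+r. indicator {lo T i..<hi T i} r * (\<integral>\<^sup>+s. indicator {-1..1::real} s * 1 \<partial>lborel) \<partial>lborel) = ennreal (2 * (hi T i - lo T i))"
    proof -
      have "emeasure lborel {lo T i..<hi T i} = ennreal (hi T i - lo T i)"
        using \<open>lo T i < hi T i\<close> by simp
      moreover have "ennreal (hi T i - lo T i) * ennreal 2 = ennreal ((hi T i - lo T i) * 2)"
        using \<open>lo T i < hi T i\<close> by (intro ennreal_mult[symmetric]) auto
      ultimately show ?thesis unfolding s r by (simp only: mult.commute)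
    qed
  qed
  also have "\<dots> = ennreal (2 * perimeter T)"
    unfolding perimeter_def sum_distrib_left using lo_less_hi
    by (subst sum_ennreal) (auto intro: less_imp_le)
  also have "ennreal (1 / (2 * perimeter T)) * ennreal (2 * perimeter T) = 1"
    using perimeter_pos by (simp add: ennreal_mult[symmetric])
  finally show "emeasure (billiard_measure T) (space (billiard_measure T)) = 1" .
qed

section \<open>The measure in chord coordinates\<close>

text \<open>The density of \<open>dr ds\<close> in the coordinates \<open>(r, r')\<close>, extended
  by zero off the chords.\<close>

definition weight :: "nat \<Rightarrow> nat \<Rightarrow> real \<times> real \<Rightarrow> ennreal" where
  "weight i j p = indicator {p. chord i (fst p) j (snd p)} p * ennreal (jac i (fst p) j (snd p))"

text \<open>A Borel substitute for \<open>sine\<close> on the whole plane: it keeps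
  \<open>sine\<close> on the open set of chords, where it is continuous, and is \<open>0\<close>
  elsewhere. Under the factor \<open>weight\<close> the two are interchangeable.\<close>

definition bsine :: "nat \<Rightarrow> nat \<Rightarrow> real \<times> real \<Rightarrow> real" where
  "bsine i j p = indicator {p. chord i (fst p) j (snd p)} p *\<^sub>R sine i (fst p) j (snd p)"

lemma continuous_on_chords:
  shows "continuous_on {p. chord i (fst p) j (snd p)} (\<lambda>p. jac i (fst p) j (snd p))"
    and "continuous_on {p. chord i (fst p) j (snd p)} (\<lambda>p. sine i (fst p) j (snd p))"
proof -
  let ?S = "{p. chord i (fst p) j (snd p)}"
  have c: "continuous_on ?S (\<lambda>p. f (fst p))" if "\<And>r. nice i r \<Longrightarrow> isCont f r" for f :: "real \<Rightarrow> plane"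
    by (rule continuous_on_compose2[of "{r. nice i r}" f])
      (use that in \<open>auto simp: chord_def intro!: continuous_at_imp_continuous_on continuous_on_fst\<close>)
  have c': "continuous_on ?S (\<lambda>p. f (snd p))" if "\<And>r. nice j r \<Longrightarrow> isCont f r" for f :: "real \<Rightarrow> plane"
    by (rule continuous_on_compose2[of "{r. nice j r}" f])
      (use that in \<open>auto simp: chord_def intro!: continuous_at_imp_continuous_on continuous_on_snd\<close>)
  note w = c[OF isCont_wall[OF nice_smooth]] c'[OF isCont_wall[OF nice_smooth]]
    c[OF isCont_normal[OF nice_smooth]] c'[OF isCont_normal[OF nice_smooth]] c[OF isCont_tangent[OF nice_smooth]]
  have ne: "\<forall>p\<in>?S. norm (wall T j (snd p) - wall T i (fst p)) \<noteq> 0"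
    using chord_distinct by auto
  show "continuous_on ?S (\<lambda>p. jac i (fst p) j (snd p))"
    unfolding jac_def sgn_div_norm by (intro continuous_intros w ne)
  show "continuous_on ?S (\<lambda>p. sine i (fst p) j (snd p))"
    unfolding sine_def sgn_div_norm by (intro continuous_intros w ne)
qed

lemma measurable_weight [measurable]: "weight i j \<in> borel_measurable borel"
proof -
  let ?S = "{p. chord i (fst p) j (snd p)}"
  have S: "?S \<in> sets borel" using open_chord by simp
  have "(\<lambda>p. ennreal (indicator ?S p *\<^sub>R jac i (fst p) j (snd p))) \<in> borel_measurable borel"
    using borel_measurable_continuous_on_indicator[OF S continuous_on_chords(1)] by measurable
  also have "(\<lambda>p. ennreal (indicator ?S p *\<^sub>R jac i (fst p) j (snd p))) = weight i j"
    by (auto simp: weight_def fun_eq_iff indicator_def)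
  finally show ?thesis .
qed

lemma measurable_bsine [measurable]: "bsine i j \<in> borel_measurable borel"
proof -
  have S: "{p. chord i (fst p) j (snd p)} \<in> sets borel" using open_chord by simp
  show ?thesis unfolding bsine_def[abs_def]
    using borel_measurable_continuous_on_indicator[OF S continuous_on_chords(2)] by simp
qed

lemma weight_sym: "weight i j p = weight j i (snd p, fst p)"
  using chord_sym[of i "fst p" j "snd p"] jac_sym[of i "fst p" j "snd p"]
  by (simp add: weight_def indicator_def)

lemma weight_bsine: "weight i j p * f (sine i (fst p) j (snd p)) = weight i j p * f (bsine i j p)"
  by (simp add: weight_def bsine_def indicator_def)

lemma measurable_collision: "(\<lambda>p. (i, fst p, g p)) \<in> borel_measurable borel"
  if "g \<in> borel_measurable borel" for i :: nat and g :: "real \<times> real \<Rightarrow> real"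
proof -
  have "(\<lambda>p. (fst p, g p)) \<in> borel_measurable borel"
    using that by (intro borel_measurable_Pair) (simp_all add: borel_measurable_continuous_onI continuous_on_fst)
  moreover have "(\<lambda>x :: plane. (i, x)) \<in> borel_measurable borel"
    by (intro borel_measurable_continuous_onI continuous_intros)
  ultimately show ?thesis by (rule measurable_compose)
qed

definition chord_integral :: "(nat \<Rightarrow> real \<Rightarrow> nat \<Rightarrow> real \<Rightarrow> ennreal) \<Rightarrow> ennreal" where
  "chord_integral f = (\<Sum>i<N. \<Sum>j<N. \<integral>\<^sup>+p. weight i j p * f i (fst p) j (snd p) \<partial>lborel)"

text \<open>For each nice start the inner integral is exchanged by
  \<open>nn_integral_directions\<close>, and Tonelli joins the two parameters; the remaining starts
  are finitely many.\<close>

lemma unnormalized_chord: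
  assumes h: "h \<in> borel_measurable borel"
  shows "unnormalized h = chord_integral (\<lambda>i r j r'. h (i, r, sine i r j r'))"
  unfolding unnormalized_def chord_integral_def
proof (rule sum.cong[OF refl])
  fix i assume i: "i \<in> {..<N}"
  define F where "F j p = weight i j p * h (i, fst p, bsine i j p)" for j p
  have F [measurable]: "F j \<in> borel_measurable borel" for j
    unfolding F_def[abs_def]
    by (intro borel_measurable_times_ennreal measurable_weight measurable_compose[OF measurable_collision h] measurable_bsine)
  have Fs: "F j p = weight i j p * h (i, fst p, sine i (fst p) j (snd p))" for j p
    unfolding F_def by (rule weight_bsine[symmetric])
  have Fr: "(\<lambda>r'. F j (r, r')) \<in> borel_measurable borel" for j r
    by (rule measurable_compose[OF _ F]) (intro borel_measurable_continuous_onI continuous_intros)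
  have "finite {r \<in> {lo T i..hi T i}. \<not> nice i r}" using finite_not_nice i by simp
  then have "AE r in lborel. r \<notin> {r \<in> {lo T i..hi T i}. \<not> nice i r}"
    by (intro AE_not_in finite_imp_null_set_lborel)
  then have ae: "AE r in lborel. indicator {lo T i..<hi T i} r * (\<integral>\<^sup>+s. indicator {-1..1} s * h (i, r, s) \<partial>lborel) =
      (\<Sum>j<N. \<integral>\<^sup>+r'. F j (r, r') \<partial>lborel)"
  proof eventually_elim
    case (elim r)
    show ?case
    proof (cases "nice i r")
      case True
      have hr: "(\<lambda>s. h (i, r, s)) \<in> borel_measurable borel"
        by (rule measurable_compose[OF _ h]) (intro borel_measurable_continuous_onI continuous_intros)
      have "(\<integral>\<^sup>+s. indicator {-1..1} s * h (i, r, s) \<partial>lborel) =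
        (\<Sum>j<N. \<integral>\<^sup>+r'. indicator {r'. chord i r j r'} r' * ennreal (jac i r j r') * h (i, r, sine i r j r') \<partial>lborel)"
        by (rule nn_integral_directions[OF True hr, symmetric])
      also have "\<dots> = (\<Sum>j<N. \<integral>\<^sup>+r'. F j (r, r') \<partial>lborel)"
        by (intro sum.cong refl nn_integral_cong) (simp add: Fs weight_def indicator_def)
      finally show ?thesis using nice_bounds[OF True] by simp
    next
      case False
      then have "F j (r, r') = 0" for j r' by (simp add: F_def weight_def chord_def)
      then show ?thesis using False elim by (auto simp: indicator_def)
    qed
  qed
  have "(\<integral>\<^sup>+r. indicator {lo T i..<hi T i} r * (\<integral>\<^sup>+s. indicator {-1..1} s * h (i, r, s) \<partial>lborel) \<partial>lborel) =
    (\<integral>\<^sup>+r. (\<Sum>j<N. \<integral>\<^sup>+r'. F j (r, r') \<partial>lborel) \<partial>lborel)"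
    by (rule nn_integral_cong_AE[OF ae])
  also have "\<dots> = (\<Sum>j<N. \<integral>\<^sup>+r. \<integral>\<^sup>+r'. F j (r, r') \<partial>lborel \<partial>lborel)"
  proof (rule nn_integral_sum)
    fix j
    have "F j \<in> borel_measurable (lborel \<Otimes>\<^sub>M lborel)" using F by (simp add: lborel_prod)
    then show "(\<lambda>r. \<integral>\<^sup>+r'. F j (r, r') \<partial>lborel) \<in> borel_measurable lborel"
      by (rule lborel.borel_measurable_nn_integral_fst)
  qed
  also have "\<dots> = (\<Sum>j<N. \<integral>\<^sup>+p. F j p \<partial>lborel)"
  proof (rule sum.cong[OF refl])
    fix j
    have "F j \<in> borel_measurable (lborel \<Otimes>\<^sub>M lborel)" using F by (simp add: lborel_prod)
    from lborel.nn_integral_fst[OF this] show "(\<integral>\<^sup>+r. \<integral>\<^sup>+r'. F j (r, r') \<partial>lborel \<partial>lborel) = (\<integral>\<^sup>+p. F j p \<partial>lborel)"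
      by (simp add: lborel_prod)
  qed
  finally show "(\<integral>\<^sup>+r. indicator {lo T i..<hi T i} r * (\<integral>\<^sup>+s. indicator {-1..1} s * h (i, r, s) \<partial>lborel) \<partial>lborel) =
      (\<Sum>j<N. \<integral>\<^sup>+p. weight i j p * h (i, fst p, sine i (fst p) j (snd p)) \<partial>lborel)"
    by (simp add: Fs)
qed

text \<open>Reversing a chord exchanges outgoing and incoming data and keeps the weight.\<close>

lemma chord_integral_arrival:
  assumes g: "g \<in> borel_measurable borel"
  shows "chord_integral (\<lambda>i r j r'. g (j, r', - sine j r' i r)) = unnormalized g"
proof -
  define h where "h = (\<lambda>(i :: nat, r :: real, s :: real). g (i, r, - s))"
  have h: "h \<in> borel_measurable borel"
    unfolding h_def split_beta
    by (rule measurable_compose[OF _ g]) (intro borel_measurable_continuous_onI continuous_intros)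
  define F where "F i j p = weight i j p * g (i, fst p, - bsine i j p)" for i j p
  have F: "F i j \<in> borel_measurable borel" for i j
    unfolding F_def[abs_def]
    by (intro borel_measurable_times_ennreal measurable_weight measurable_compose[OF measurable_collision g] borel_measurable_uminus measurable_bsine)
  have Fs: "F i j p = weight i j p * g (i, fst p, - sine i (fst p) j (snd p))" for i j p
    unfolding F_def by (rule weight_bsine[symmetric, where f="\<lambda>s. g (i, fst p, - s)"])
  have "(\<integral>\<^sup>+p. weight i j p * g (j, snd p, - sine j (snd p) i (fst p)) \<partial>lborel) = (\<integral>\<^sup>+p. F j i p \<partial>lborel)" for i j
  proof -
    have "(\<integral>\<^sup>+p. weight i j p * g (j, snd p, - sine j (snd p) i (fst p)) \<partial>lborel) = (\<integral>\<^sup>+p. F j i (snd p, fst p) \<partial>lborel)"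
      unfolding Fs weight_sym[of i j] by simp
    also have "\<dots> = (\<integral>\<^sup>+p. F j i p \<partial>lborel)" by (rule nn_integral_lborel_swap[OF F])
    finally show ?thesis .
  qed
  then have "chord_integral (\<lambda>i r j r'. g (j, r', - sine j r' i r)) = (\<Sum>i<N. \<Sum>j<N. \<integral>\<^sup>+p. F j i p \<partial>lborel)"
    unfolding chord_integral_def by simp
  also have "\<dots> = (\<Sum>j<N. \<Sum>i<N. \<integral>\<^sup>+p. F j i p \<partial>lborel)" by (rule sum.swap)
  also have "\<dots> = unnormalized h"
    unfolding unnormalized_chord[OF h] chord_integral_def Fs by (simp add: h_def)
  also have "\<dots> = unnormalized g"
  proof -
    have inner: "(\<integral>\<^sup>+s. indicator {-1..1} s * h (i, r, s) \<partial>lborel) = (\<integral>\<^sup>+s. indicator {-1..1} s * g (i, r, s) \<partial>lborel)" for i r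
    proof -
    have "(\<lambda>s. g (i, r, s)) \<in> borel_measurable borel"
      by (rule measurable_compose[OF _ g]) (intro borel_measurable_continuous_onI continuous_intros)
    then have "(\<lambda>s. indicator {-1..1} s * g (i, r, s)) \<in> borel_measurable borel" by simp
    from nn_integral_real_affine[OF this, of "-1" 0]
    have "(\<integral>\<^sup>+s. indicator {-1..1} s * g (i, r, s) \<partial>lborel) = (\<integral>\<^sup>+s. indicator {-1..1} (- s) * g (i, r, - s) \<partial>lborel)"
      by simp
    also have "\<dots> = (\<integral>\<^sup>+s. indicator {-1..1} s * h (i, r, s) \<partial>lborel)"
      by (intro nn_integral_cong) (auto simp: h_def indicator_def)
      finally show ?thesis ..
    qed
    show ?thesis unfolding unnormalized_def inner ..
  qed
  finally show ?thesis .
qed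

lemma chord_collision: "chord i r j r' \<Longrightarrow> (i, r, sine i r j r') \<in> collisions T"
  using chord_velocity[of i r j r'] nice_bounds[of i r] by (auto simp: collisions_def chord_def)

text \<open>An exceptional null set has zero integral over the chords, and the weight is positive on
  every chord. This carries almost everywhere statements about collisions to Lebesgue almost every
  pair of end points.\<close>

lemma AE_chord_departure:
  assumes Q: "AE x in billiard_measure T. Q x" and ij: "i < N" "j < N"
  shows "AE p in lborel. chord i (fst p) j (snd p) \<longrightarrow> Q (i, fst p, sine i (fst p) j (snd p))"
proof -
  obtain N0 where N0: "{x \<in> collisions T. \<not> Q x} \<subseteq> N0" "emeasure (billiard_measure T) N0 = 0" "N0 \<in> sets (billiard_measure T)"
    using Q by (rule AE_E) (simp add: space_billiard_measure)
  have N0b: "N0 \<in> sets borel" using N0(3) by (simp add: sets_billiard_measure sets_collision_space)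
  have ind: "indicator N0 \<in> borel_measurable borel" using N0b by simp
  have "(\<integral>\<^sup>+x. indicator N0 x \<partial>billiard_measure T) = 0" using N0 by simp
  then have "unnormalized (indicator N0) = 0"
    unfolding nn_integral_billiard_measure[OF ind] using perimeter_pos by simp
  then have "chord_integral (\<lambda>i r j r'. indicator N0 (i, r, sine i r j r')) = 0"
    unfolding unnormalized_chord[OF ind] .
  then have z: "(\<integral>\<^sup>+p. weight i j p * indicator N0 (i, fst p, sine i (fst p) j (snd p)) \<partial>lborel) = 0"
    unfolding chord_integral_def using ij by simp
  have m: "(\<lambda>p. weight i j p * indicator N0 (i, fst p, bsine i j p)) \<in> borel_measurable borel"
    by (intro borel_measurable_times_ennreal measurable_weight measurable_compose[OF measurable_collision ind] measurable_bsine)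
  have "AE p in lborel. weight i j p * indicator N0 (i, fst p, bsine i j p) = 0"
    using z unfolding weight_bsine[where f="\<lambda>s. indicator N0 (i, fst _, s)"]
    by (subst (asm) nn_integral_0_iff_AE) (use m in auto)
  then show ?thesis
  proof eventually_elim
    case (elim p)
    show ?case
    proof
      assume c: "chord i (fst p) j (snd p)"
      then have "0 < weight i j p" using jac_pos by (simp add: weight_def)
      then have "(i, fst p, sine i (fst p) j (snd p)) \<notin> N0"
        using elim c by (auto simp: bsine_def indicator_def split: if_splits)
      then show "Q (i, fst p, sine i (fst p) j (snd p))" using N0(1) chord_collision[OF c] by blast
    qed
  qed
qed

text \<open>The composite with \<open>billiard_map\<close> enters only through a Borel function
  \<open>h\<close> equal to it almost everywhere, so measurability of the map itself is never at
  issue. In chord coordinates the integrand is the same, read once at departure and once at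
  arrival.\<close>

theorem billiard_map_preserves:
  assumes h: "h \<in> borel_measurable borel" and g: "g \<in> borel_measurable borel"
    and eq: "AE x in billiard_measure T. h x = g (billiard_map T x)"
  shows "(\<integral>\<^sup>+x. h x \<partial>billiard_measure T) = (\<integral>\<^sup>+x. g x \<partial>billiard_measure T)"
proof -
  have "chord_integral (\<lambda>i r j r'. h (i, r, sine i r j r')) = chord_integral (\<lambda>i r j r'. g (j, r', - sine j r' i r))"
    unfolding chord_integral_def
  proof (intro sum.cong refl nn_integral_cong_AE)
    fix i j assume "i \<in> {..<N}" "j \<in> {..<N}"
    then have "AE p in lborel. chord i (fst p) j (snd p) \<longrightarrow>
        h (i, fst p, sine i (fst p) j (snd p)) = g (billiard_map T (i, fst p, sine i (fst p) j (snd p)))"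
      by (intro AE_chord_departure[OF eq]) auto
    then show "AE p in lborel. weight i j p * h (i, fst p, sine i (fst p) j (snd p)) =
        weight i j p * g (j, snd p, - sine j (snd p) i (fst p))"
    proof eventually_elim
      case (elim p)
      then show ?case using next_collision_chord[of i "fst p" j "snd p"]
        by (cases "chord i (fst p) j (snd p)") (simp_all add: weight_def)
    qed
  qed
  then have "unnormalized h = unnormalized g"
    unfolding unnormalized_chord[OF h] chord_integral_arrival[OF g] .
  then show ?thesis
    unfolding nn_integral_billiard_measure[OF h] nn_integral_billiard_measure[OF g] by simp
qed

end

section \<open>All boundary curves are linked by chords\<close>

lemma countable_isolated:
  fixes S :: "'a :: {metric_space, second_countable_topology} set"
  assumes "\<And>x. x \<in> S \<Longrightarrow> \<exists>d>0. \<forall>y\<in>S. dist y x < d \<longrightarrow> y = x"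
  shows "countable S"
proof -
  obtain d where d: "\<And>x. x \<in> S \<Longrightarrow> 0 < d x" "\<And>x y. x \<in> S \<Longrightarrow> y \<in> S \<Longrightarrow> dist y x < d x \<Longrightarrow> y = x"
    using assms by metis
  obtain F where F: "F \<subseteq> (\<lambda>x. ball x (d x)) ` S" "countable F" "\<Union>F = \<Union>((\<lambda>x. ball x (d x)) ` S)"
    by (rule Lindelof[of "(\<lambda>x. ball x (d x)) ` S"]) auto
  have "countable (B \<inter> S)" if B: "B \<in> F" for B
  proof -
    obtain x where "x \<in> S" "B = ball x (d x)" using F(1) B by auto
    then have "B \<inter> S \<subseteq> {x}" using d(2) by (auto simp: dist_commute)
    then show ?thesis by (rule countable_subset) simp
  qed
  then have "countable (\<Union>B\<in>F. B \<inter> S)" by (rule countable_UN[OF F(2)])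
  moreover have "S \<subseteq> (\<Union>B\<in>F. B \<inter> S)"
  proof
    fix x assume x: "x \<in> S"
    then have "x \<in> \<Union>((\<lambda>x. ball x (d x)) ` S)" using d(1) by (intro UN_I[of x]) auto
    then show "x \<in> (\<Union>B\<in>F. B \<inter> S)" using x unfolding F(3)[symmetric] by blast
  qed
  ultimately show ?thesis by (rule countable_subset[rotated])
qed

text \<open>An injective derivative is bounded below by some \<open>B > 0\<close>. A second zero
  close by would have to satisfy \<open>B * norm (y - x) \<le> B / 2 * norm (y - x)\<close>, so
  these zeros are isolated.\<close>

lemma countable_nondegenerate_zeros:
  fixes f :: "'a::euclidean_space \<Rightarrow> 'b::euclidean_space"
  shows "countable {x. f x = 0 \<and> (\<exists>D. (f has_derivative D) (at x) \<and> inj D)}" (is "countable ?S")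
proof (rule countable_isolated)
  fix x assume "x \<in> ?S"
  then obtain D where x: "f x = 0" "(f has_derivative D) (at x)" "inj D" by auto
  have lin: "linear D" using x(2) by (rule has_derivative_linear)
  obtain B where B: "0 < B" "\<And>h. B * norm h \<le> norm (D h)"
    using linear_inj_bounded_below_pos[OF lin x(3)] by metis
  obtain d where d: "0 < d" "\<And>y. norm (y - x) < d \<Longrightarrow> norm (f y - f x - D (y - x)) \<le> (B / 2) * norm (y - x)"
    using x(2) B(1) unfolding has_derivative_within_alt by (metis UNIV_I half_gt_zero)
  show "\<exists>d>0. \<forall>y\<in>?S. dist y x < d \<longrightarrow> y = x"
  proof (intro exI conjI ballI impI)
    show "0 < d" by fact
    fix y assume "y \<in> ?S" "dist y x < d"
    then have "norm (D (y - x)) \<le> (B / 2) * norm (y - x)"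
      using d(2)[of y] x(1) by (simp add: dist_norm)
    with B(2)[of "y - x"] have "(B / 2) * norm (y - x) \<le> 0" by linarith
    then have "norm (y - x) \<le> 0" using B(1) by (simp add: mult_le_0_iff)
    then show "y = x" by simp
  qed
qed

lemma negligible_UN_finite:
  "finite X \<Longrightarrow> (\<And>x. x \<in> X \<Longrightarrow> negligible (f x)) \<Longrightarrow> negligible (\<Union>x\<in>X. f x)"
  by (intro negligible_Union) auto

lemma negligible_line: "negligible {p + t *\<^sub>R v | t. True}" for p v :: plane
proof -
  have "negligible ((\<lambda>t::real. p + t *\<^sub>R v) ` UNIV)"
    by (rule negligible_differentiable_image_lowdim)
      (auto intro!: differentiable_at_imp_differentiable_on derivative_intros)
  then show ?thesis by (simp add: full_SetCompr_eq)
qed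

text \<open>Sard's theorem for the map \<open>(r, t) \<mapsto> q r + t q' r\<close>, which is singular where the curvature
  vanishes.\<close>

lemma negligible_flat_tangents:
  fixes q a :: "real \<Rightarrow> plane"
  assumes q: "\<And>r. r \<in> S \<Longrightarrow> (q has_vector_derivative a r) (at r)"
    and a: "\<And>r. r \<in> S \<Longrightarrow> (a has_vector_derivative 0) (at r)"
  shows "negligible {q r + t *\<^sub>R a r | r t. r \<in> S}"
proof -
  \<comment> \<open>The plane is identified with \<open>real^2\<close>, where the vector form of
    Sard's lemma applies.\<close>
  define emb :: "plane \<Rightarrow> real^2" where "emb x = fst x *\<^sub>R axis 1 1 + snd x *\<^sub>R axis 2 1" for x
  define prj :: "real^2 \<Rightarrow> plane" where "prj y = (y $ 1, y $ 2)" for y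
  have pe: "prj (emb x) = x" for x by (simp add: prj_def emb_def axis_def)
  have emb_lin: "bounded_linear emb"
    unfolding emb_def[abs_def]
    by (intro bounded_linear_add bounded_linear_scaleR_const bounded_linear_fst bounded_linear_snd)
  have prj_lin: "bounded_linear prj"
    unfolding prj_def[abs_def] by (intro bounded_linear_Pair bounded_linear_vec_nth)
  define S2 :: "(real^2) set" where "S2 = {x. x $ 1 \<in> S}"
  let ?f = "\<lambda>x :: real^2. emb (q (x $ 1) + (x $ 2) *\<^sub>R a (x $ 1))"
  have "negligible (?f ` S2)"
  proof (rule baby_Sard[where f'="\<lambda>x h. (h $ 1 + h $ 2) *\<^sub>R emb (a (x $ 1))"])
    fix x :: "real^2" assume "x \<in> S2"
    then have xS: "x $ 1 \<in> S" by (simp add: S2_def)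
    have n1: "((\<lambda>y :: real^2. y $ 1) has_derivative (\<lambda>h. h $ 1)) (at x within S2)"
      and n2: "((\<lambda>y :: real^2. y $ 2) has_derivative (\<lambda>h. h $ 2)) (at x within S2)"
      by (intro bounded_linear_imp_has_derivative bounded_linear_vec_nth)+
    have "(q has_derivative (\<lambda>h. h *\<^sub>R a (x $ 1))) (at (x $ 1))" "(a has_derivative (\<lambda>h. 0)) (at (x $ 1))"
      using q[OF xS] a[OF xS] by (simp_all add: has_vector_derivative_def)
    then have dq: "((\<lambda>y. q (y $ 1)) has_derivative (\<lambda>h. (h $ 1) *\<^sub>R a (x $ 1))) (at x within S2)"
      and da: "((\<lambda>y. a (y $ 1)) has_derivative (\<lambda>h. 0)) (at x within S2)"
      using has_derivative_compose[OF n1] by fast+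
    have "((\<lambda>y. q (y $ 1) + (y $ 2) *\<^sub>R a (y $ 1)) has_derivative
        (\<lambda>h. (h $ 1) *\<^sub>R a (x $ 1) + ((x $ 2) *\<^sub>R 0 + (h $ 2) *\<^sub>R a (x $ 1)))) (at x within S2)"
      by (intro has_derivative_add dq has_derivative_scaleR n2 da)
    then have "((\<lambda>y. q (y $ 1) + (y $ 2) *\<^sub>R a (y $ 1)) has_derivative
        (\<lambda>h. (h $ 1 + h $ 2) *\<^sub>R a (x $ 1))) (at x within S2)"
      by (simp add: scaleR_add_left)
    from bounded_linear.has_derivative[OF emb_lin this]
    show "(?f has_derivative (\<lambda>h. (h $ 1 + h $ 2) *\<^sub>R emb (a (x $ 1)))) (at x within S2)"
      by (simp add: linear_cmul bounded_linear.linear[OF emb_lin])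
    \<comment> \<open>The derivative maps into the line spanned by the image of \<open>a\<close>,
      hence is singular.\<close>
    have "det (matrix (\<lambda>h :: real^2. (h $ 1 + h $ 2) *\<^sub>R emb (a (x $ 1)))) = 0"
      by (simp add: det_2 matrix_def axis_def)
    then show "rank (matrix (\<lambda>h :: real^2. (h $ 1 + h $ 2) *\<^sub>R emb (a (x $ 1)))) < CARD(2)"
      by (simp only: det_eq_0_rank)
  qed simp
  moreover have "prj differentiable_on ?f ` S2"
    by (intro differentiable_at_imp_differentiable_on ballI bounded_linear_imp_differentiable prj_lin)
  ultimately have "negligible (prj ` (?f ` S2))"
    by (rule negligible_differentiable_image_negligible[rotated]) simp
  moreover have "{q r + t *\<^sub>R a r | r t. r \<in> S} \<subseteq> prj ` (?f ` S2)"
  proof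
    fix z assume "z \<in> {q r + t *\<^sub>R a r | r t. r \<in> S}"
    then obtain r t where rt: "z = q r + t *\<^sub>R a r" "r \<in> S" by blast
    define x :: "real^2" where "x = r *\<^sub>R axis 1 1 + t *\<^sub>R axis 2 1"
    have "x $ 1 = r" "x $ 2 = t" by (simp_all add: x_def axis_def)
    then have x: "x \<in> S2" and "prj (?f x) = z" using rt by (simp_all add: S2_def pe)
    moreover from x have "prj (?f x) \<in> prj ` (?f ` S2)" by (intro imageI)
    ultimately show "z \<in> prj ` (?f ` S2)" by (simp only:)
  qed
  ultimately show ?thesis by (rule negligible_subset)
qed

context classical_billiard
begin

lemma parallel_of_normal_orthogonal:
  assumes "norm a = 1" "x \<bullet> (- snd a, fst a) = 0"
  shows "x = (x \<bullet> a) *\<^sub>R (a :: plane)"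
  using plane_frame[OF assms(1), of x] assms(2) by (metis add.right_neutral scaleR_zero_left)

section \<open>Curvature and tangent lines\<close>

definition curvature :: "nat \<Rightarrow> real \<Rightarrow> real" where
  "curvature i r = vector_derivative (tangent T i) (at r) \<bullet> normal T i r"

text \<open>Frenet's equation: the derivative of a unit vector is orthogonal to it, which in the
  plane leaves only the normal direction.\<close>

lemma tangent_derivative:
  assumes r: "nice i r"
  shows "(tangent T i has_vector_derivative curvature i r *\<^sub>R normal T i r) (at r)"
proof -
  let ?t' = "vector_derivative (tangent T i) (at r)"
  obtain t' where "(tangent T i has_vector_derivative t') (at r)"
    using smooth_derivatives(2)[OF nice_smooth[OF r]] by blast
  then have t': "(tangent T i has_vector_derivative ?t') (at r)"
    by (simp add: vector_derivative_at)
  have "((\<lambda>x. tangent T i x \<bullet> tangent T i x) has_vector_derivative (tangent T i r \<bullet> ?t' + ?t' \<bullet> tangent T i r)) (at r)"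
    using has_derivative_inner[OF t'[unfolded has_vector_derivative_def] t'[unfolded has_vector_derivative_def]]
    unfolding has_vector_derivative_def by (simp add: algebra_simps inner_commute)
  moreover have "((\<lambda>x. tangent T i x \<bullet> tangent T i x) has_vector_derivative 0) (at r)"
  proof (rule has_vector_derivative_transform_within_open[OF has_vector_derivative_const])
    show "open {x. nice i x}" "r \<in> {x. nice i x}" using open_nice r by auto
    show "1 = tangent T i x \<bullet> tangent T i x" if "x \<in> {x. nice i x}" for x
      using norm_tangent[of i x] that nice_smooth by (simp add: norm_eq_1)
  qed
  ultimately have "?t' \<bullet> tangent T i r = 0"
    using vector_derivative_unique_at by (fastforce simp: inner_commute)
  then have "?t' = curvature i r *\<^sub>R normal T i r"
    using plane_frame[OF norm_tangent[OF nice_smooth[OF r]], of ?t'] unfolding curvature_def normal_def by simp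
  then show ?thesis using t' by simp
qed

text \<open>The second Frenet equation is the first one rotated by a quarter turn.\<close>

lemma normal_derivative:
  assumes r: "nice i r"
  shows "(normal T i has_vector_derivative - curvature i r *\<^sub>R tangent T i r) (at r)"
proof -
  have "((\<lambda>x. (- snd (tangent T i x), fst (tangent T i x))) has_derivative
      (\<lambda>h. (- snd (h *\<^sub>R (curvature i r *\<^sub>R normal T i r)), fst (h *\<^sub>R (curvature i r *\<^sub>R normal T i r))))) (at r)"
    using tangent_derivative[OF r] unfolding has_vector_derivative_def
    by (intro has_derivative_Pair has_derivative_minus has_derivative_snd has_derivative_fst)
  moreover have "(- snd (h *\<^sub>R (curvature i r *\<^sub>R normal T i r)), fst (h *\<^sub>R (curvature i r *\<^sub>R normal T i r))) =
      h *\<^sub>R (- curvature i r *\<^sub>R tangent T i r)" for h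
    by (simp add: normal_def prod_eq_iff)
  ultimately show ?thesis
    unfolding has_vector_derivative_def normal_def[abs_def] by simp
qed

text \<open>The zeros of this function are the parameters whose tangent line passes through
  \<open>p\<close>. The motion of the foot is tangential and contributes nothing, so only the
  rotation of the normal remains.\<close>

lemma tangency_derivative:
  assumes r: "nice i r"
  shows "((\<lambda>x. normal T i x \<bullet> (p - wall T i x)) has_derivative
      (\<lambda>h. h * (- curvature i r * (tangent T i r \<bullet> (p - wall T i r))))) (at r)"
proof -
  have n: "(normal T i has_derivative (\<lambda>h. h *\<^sub>R (- curvature i r *\<^sub>R tangent T i r))) (at r)"
    using normal_derivative[OF r] by (simp add: has_vector_derivative_def)
  have w: "(wall T i has_derivative (\<lambda>h. h *\<^sub>R tangent T i r)) (at r)"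
    using smooth_derivatives(1)[OF nice_smooth[OF r]] by (simp add: has_vector_derivative_def)
  have "((\<lambda>x. normal T i x \<bullet> (p - wall T i x)) has_derivative
      (\<lambda>h. normal T i r \<bullet> (0 - h *\<^sub>R tangent T i r) + (h *\<^sub>R (- curvature i r *\<^sub>R tangent T i r)) \<bullet> (p - wall T i r))) (at r)"
    by (intro has_derivative_inner n has_derivative_diff has_derivative_const w)
  moreover have "normal T i r \<bullet> tangent T i r = 0" unfolding normal_def by (rule inner_rot)
  ultimately show ?thesis by (simp add: mult.assoc)
qed

text \<open>At such a parameter the vector from the curve to \<open>p\<close> is a nonzero multiple
  of the tangent, so with nonzero curvature the zero of the tangency function is
  nondegenerate.\<close>

lemma countable_tangents_through_point:
  "countable {r. nice i r \<and> p \<noteq> wall T i r \<and> curvature i r \<noteq> 0 \<and> normal T i r \<bullet> (p - wall T i r) = 0}"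
proof (rule countable_subset[OF _ countable_nondegenerate_zeros[of "\<lambda>x. normal T i x \<bullet> (p - wall T i x)"]], safe)
  fix r assume r: "nice i r" "p \<noteq> wall T i r" "curvature i r \<noteq> 0" "normal T i r \<bullet> (p - wall T i r) = 0"
  have "p - wall T i r = ((p - wall T i r) \<bullet> tangent T i r) *\<^sub>R tangent T i r"
    by (rule parallel_of_normal_orthogonal[OF norm_tangent[OF nice_smooth[OF r(1)]]])
      (use r(4) in \<open>simp only: normal_def inner_commute\<close>)
  then have "tangent T i r \<bullet> (p - wall T i r) \<noteq> 0" using r(2) by (auto simp: inner_commute)
  then have "inj (\<lambda>h. h * (- curvature i r * (tangent T i r \<bullet> (p - wall T i r))))"
    using r(3) by (intro injI) simp
  then show "\<exists>D. ((\<lambda>x. normal T i x \<bullet> (p - wall T i x)) has_derivative D) (at r) \<and> inj D"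
    using tangency_derivative[OF r(1)] by blast
qed

definition bitangent :: "nat \<Rightarrow> nat \<Rightarrow> (real \<times> real) set" where
  "bitangent i j = {(r, r'). nice i r \<and> nice j r' \<and> wall T i r \<noteq> wall T j r' \<and>
     curvature i r \<noteq> 0 \<and> curvature j r' \<noteq> 0 \<and>
     normal T i r \<bullet> (wall T j r' - wall T i r) = 0 \<and> normal T j r' \<bullet> (wall T i r - wall T j r') = 0}"

text \<open>Two equations in two unknowns. On a common tangent line both tangents are orthogonal to
  both normals, so moving one foot does not affect the other equation to first order: the derivative
  is diagonal, and its entries are nonzero because the curvatures are and the feet are
  distinct.\<close>

lemma countable_bitangent: "countable (bitangent i j)"
proof (rule countable_subset[OF _ countable_nondegenerate_zeros[of
      "\<lambda>x. (normal T i (fst x) \<bullet> (wall T j (snd x) - wall T i (fst x)),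
        normal T j (snd x) \<bullet> (wall T i (fst x) - wall T j (snd x)))"]])
  let ?f = "\<lambda>x. (normal T i (fst x) \<bullet> (wall T j (snd x) - wall T i (fst x)),
        normal T j (snd x) \<bullet> (wall T i (fst x) - wall T j (snd x)))"
  show "bitangent i j \<subseteq> {x. ?f x = 0 \<and> (\<exists>D. (?f has_derivative D) (at x) \<and> inj D)}"
  proof
    fix x assume "x \<in> bitangent i j"
    then obtain r r' where x: "x = (r, r')" and r: "nice i r" "nice j r'" and ne: "wall T i r \<noteq> wall T j r'"
      and k: "curvature i r \<noteq> 0" "curvature j r' \<noteq> 0"
      and o: "normal T i r \<bullet> (wall T j r' - wall T i r) = 0" "normal T j r' \<bullet> (wall T i r - wall T j r') = 0"
      by (auto simp: bitangent_def)
    let ?d = "wall T j r' - wall T i r"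
    let ?k = "curvature i r" and ?k' = "curvature j r'" and ?a = "tangent T i r" and ?a' = "tangent T j r'"
    have d: "?d = (?d \<bullet> ?a) *\<^sub>R ?a"
      by (rule parallel_of_normal_orthogonal[OF norm_tangent[OF nice_smooth[OF r(1)]]])
        (use o(1) in \<open>simp only: normal_def inner_commute\<close>)
    have d': "- ?d = ((- ?d) \<bullet> ?a') *\<^sub>R ?a'"
      by (rule parallel_of_normal_orthogonal[OF norm_tangent[OF nice_smooth[OF r(2)]]])
        (use o(2) in \<open>simp only: normal_def inner_commute minus_diff_eq\<close>)
    have da: "?d \<bullet> ?a \<noteq> 0" using d ne by auto
    have da': "(- ?d) \<bullet> ?a' \<noteq> 0"
    proof
      assume "(- ?d) \<bullet> ?a' = 0"
      then have "- ?d = 0" using d' by (metis scaleR_zero_left)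
      then show False using ne by simp
    qed
    have nt: "normal T i r \<bullet> ?a = 0" "normal T j r' \<bullet> ?a' = 0" unfolding normal_def by (rule inner_rot)+
    have nt': "normal T i r \<bullet> ?a' = 0"
    proof -
      have "normal T i r \<bullet> (- ?d) = 0" using o(1) by (simp add: inner_diff_right)
      then have "((- ?d) \<bullet> ?a') * (normal T i r \<bullet> ?a') = 0" by (subst (asm) d') simp
      then show ?thesis using da' by simp
    qed
    have nt'': "normal T j r' \<bullet> ?a = 0"
    proof -
      have "normal T j r' \<bullet> ?d = 0" using o(2) by (simp add: inner_diff_right)
      then have "(?d \<bullet> ?a) * (normal T j r' \<bullet> ?a) = 0" by (subst (asm) d) simp
      then show ?thesis using da by simp
    qed
    have fs: "(fst has_derivative fst) (at x)" "(snd has_derivative snd) (at x)"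
      by (intro bounded_linear_imp_has_derivative bounded_linear_fst bounded_linear_snd)+
    have d: "(normal T i has_derivative (\<lambda>h. h *\<^sub>R (- ?k *\<^sub>R ?a))) (at (fst x))"
      "(wall T i has_derivative (\<lambda>h. h *\<^sub>R ?a)) (at (fst x))"
      "(normal T j has_derivative (\<lambda>h. h *\<^sub>R (- ?k' *\<^sub>R ?a'))) (at (snd x))"
      "(wall T j has_derivative (\<lambda>h. h *\<^sub>R ?a')) (at (snd x))"
      using normal_derivative[OF r(1)] normal_derivative[OF r(2)] smooth_derivatives(1)[OF nice_smooth[OF r(1)]]
        smooth_derivatives(1)[OF nice_smooth[OF r(2)]] unfolding x fst_conv snd_conv has_vector_derivative_def by auto
    note n = has_derivative_compose[OF fs(1) d(1)] and w = has_derivative_compose[OF fs(1) d(2)]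
      and n' = has_derivative_compose[OF fs(2) d(3)] and w' = has_derivative_compose[OF fs(2) d(4)]
    have "(?f has_derivative (\<lambda>h. (normal T i (fst x) \<bullet> (snd h *\<^sub>R ?a' - fst h *\<^sub>R ?a) +
          (fst h *\<^sub>R (- ?k *\<^sub>R ?a)) \<bullet> (wall T j (snd x) - wall T i (fst x)),
        normal T j (snd x) \<bullet> (fst h *\<^sub>R ?a - snd h *\<^sub>R ?a') +
          (snd h *\<^sub>R (- ?k' *\<^sub>R ?a')) \<bullet> (wall T i (fst x) - wall T j (snd x))))) (at x)"
      by (intro has_derivative_Pair has_derivative_inner has_derivative_diff n w n' w')
    moreover have "(normal T i (fst x) \<bullet> (snd h *\<^sub>R ?a' - fst h *\<^sub>R ?a) +
          (fst h *\<^sub>R (- ?k *\<^sub>R ?a)) \<bullet> (wall T j (snd x) - wall T i (fst x)),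
        normal T j (snd x) \<bullet> (fst h *\<^sub>R ?a - snd h *\<^sub>R ?a') +
          (snd h *\<^sub>R (- ?k' *\<^sub>R ?a')) \<bullet> (wall T i (fst x) - wall T j (snd x))) =
        (fst h * (- ?k * (?d \<bullet> ?a)), snd h * (- ?k' * ((- ?d) \<bullet> ?a')))" for h
      unfolding x by (simp add: inner_diff_right nt nt' nt'' inner_commute)
    ultimately have D: "(?f has_derivative (\<lambda>h. (fst h * (- ?k * (?d \<bullet> ?a)), snd h * (- ?k' * ((- ?d) \<bullet> ?a'))))) (at x)"
      by simp
    have "inj (\<lambda>h. (fst h * (- ?k * (?d \<bullet> ?a)), snd h * (- ?k' * ((- ?d) \<bullet> ?a'))))"
      using k da da' by (intro injI) (auto simp: prod_eq_iff)
    moreover have "?f x = 0" using o unfolding x by (simp add: zero_prod_def)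
    ultimately show "x \<in> {x. ?f x = 0 \<and> (\<exists>D. (?f has_derivative D) (at x) \<and> inj D)}"
      using D by blast
  qed
qed

section \<open>Lines with two bad points\<close>

text \<open>The bad points may lie anywhere on the two sides of \<open>z\<close>, also beyond the
  first boundary point; the lines in question are thus found in families that ignore
  visibility.\<close>

definition doubly_bad :: "plane \<Rightarrow> bool" where
  "doubly_bad z \<longleftrightarrow> (\<exists>v t t'. norm v = 1 \<and> 0 < t \<and> 0 < t' \<and> bad_point v (z + t *\<^sub>R v) \<and> bad_point v (z - t' *\<^sub>R v))"

text \<open>A line with two bad points is tangent at a point of zero curvature, joins two exceptional
  points, or belongs to one of countably many isolated families of lines.\<close>

lemma negligible_doubly_bad: "negligible {z. doubly_bad z}"
proof -
  define F where "F = (\<Union>j<N. wall T j ` {r \<in> {lo T j..hi T j}. \<not> nice j r})"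
  have F: "finite F" unfolding F_def using finite_not_nice by auto
  define line where "line p p' = {p + t *\<^sub>R (p' - p) | t. True}" for p p' :: plane
  define flat where "flat j = {wall T j r + t *\<^sub>R tangent T j r | r t. r \<in> {r. nice j r \<and> curvature j r = 0}}" for j
  define A where "A j p = {r. nice j r \<and> p \<noteq> wall T j r \<and> curvature j r \<noteq> 0 \<and> normal T j r \<bullet> (p - wall T j r) = 0}" for j p
  let ?U = "(\<Union>j<N. flat j) \<union> (\<Union>p\<in>F. \<Union>p'\<in>F. line p p') \<union> (\<Union>p\<in>F. \<Union>j<N. \<Union>r\<in>A j p. line p (wall T j r))
    \<union> (\<Union>i<N. \<Union>j<N. \<Union>x\<in>bitangent i j. line (wall T i (fst x)) (wall T j (snd x)))"
  have flat: "negligible (flat j)" for j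
    unfolding flat_def
  proof (rule negligible_flat_tangents)
    fix r assume "r \<in> {r. nice j r \<and> curvature j r = 0}"
    then show "(wall T j has_vector_derivative tangent T j r) (at r)" "(tangent T j has_vector_derivative 0) (at r)"
      using smooth_derivatives(1) nice_smooth tangent_derivative[of j r] by auto
  qed
  have line: "negligible (line p p')" for p p' unfolding line_def by (rule negligible_line)
  have cA: "countable (A j p)" for j p unfolding A_def by (rule countable_tangents_through_point)
  have tangents: "negligible (\<Union>r\<in>A j p. line p (wall T j r))" for p j
    by (intro negligible_countable_Union countable_image cA) (use line in blast)
  have bitangents: "negligible (\<Union>x\<in>bitangent i j. line (wall T i (fst x)) (wall T j (snd x)))" for i j
    by (intro negligible_countable_Union countable_image countable_bitangent) (use line in blast)
  have neg: "negligible ?U"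
    by (intro negligible_Un negligible_UN_finite[OF finite_lessThan] negligible_UN_finite[OF F]
        flat line tangents bitangents)
  have "{z. doubly_bad z} \<subseteq> ?U"
  proof
    fix z assume "z \<in> {z. doubly_bad z}"
    then obtain v t t' where v: "norm v = 1" "0 < t" "0 < t'"
      and b: "bad_point v (z + t *\<^sub>R v)" "bad_point v (z - t' *\<^sub>R v)" unfolding doubly_bad_def by blast
    define p where "p = z + t *\<^sub>R v"
    define p' where "p' = z - t' *\<^sub>R v"
    have pp: "p - p' = (t + t') *\<^sub>R v" by (simp add: p_def p'_def algebra_simps)
    then have ne: "p \<noteq> p'" using v by auto
    have "z = p + (t / (t + t')) *\<^sub>R (p' - p)"
    proof -
      have "p' - p = - ((t + t') *\<^sub>R v)" using pp by (metis minus_diff_eq)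
      then have "(t / (t + t')) *\<^sub>R (p' - p) = - (t *\<^sub>R v)" using v by simp
      then show ?thesis by (simp add: p_def)
    qed
    then have z1: "z \<in> line p p'" unfolding line_def by blast
    have "z = p' + (t' / (t + t')) *\<^sub>R (p - p')"
    proof -
      have "(t' / (t + t')) *\<^sub>R (p - p') = t' *\<^sub>R v" using v unfolding pp by simp
      then show ?thesis by (simp add: p'_def)
    qed
    then have z2: "z \<in> line p' p" unfolding line_def by blast
    have cases: "x \<in> F \<or> (\<exists>j<N. \<exists>r. nice j r \<and> x = wall T j r \<and> v \<bullet> normal T j r = 0)" if "bad_point v x" for x
      using that unfolding bad_point_def F_def by blast
    \<comment> \<open>A line tangent at a point of zero curvature is one of the lines swept out in
      \<open>flat j\<close>.\<close>
    have flatz: "z \<in> flat j" if "nice j r" "curvature j r = 0" "v \<bullet> normal T j r = 0"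
      "wall T j r = z + s *\<^sub>R v" for j r s
    proof -
      have "v = (v \<bullet> tangent T j r) *\<^sub>R tangent T j r"
        using parallel_of_normal_orthogonal[OF norm_tangent[OF nice_smooth[OF that(1)]], of v] that(3) by (simp add: normal_def)
      then have "z = wall T j r + (- s * (v \<bullet> tangent T j r)) *\<^sub>R tangent T j r"
        using that(4) by (metis add_diff_cancel_right' diff_conv_add_uminus mult_minus_left scaleR_minus_left scaleR_scaleR)
      then show ?thesis unfolding flat_def using that(1,2) by blast
    qed
    have perp: "normal T j r \<bullet> (x - y) = 0" if "v \<bullet> normal T j r = 0" "x - y = s *\<^sub>R v" for j r x y s
      using that by (simp add: inner_commute)
    have "p' - p = (- (t + t')) *\<^sub>R v" using pp by (metis minus_diff_eq scaleR_minus_left)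
    note pp' = this
    consider "p \<in> F" "p' \<in> F"
      | j r where "p \<in> F" "j < N" "nice j r" "p' = wall T j r" "v \<bullet> normal T j r = 0"
      | j r where "p' \<in> F" "j < N" "nice j r" "p = wall T j r" "v \<bullet> normal T j r = 0"
      | i j r r' where "i < N" "nice i r" "p = wall T i r" "v \<bullet> normal T i r = 0"
          "j < N" "nice j r'" "p' = wall T j r'" "v \<bullet> normal T j r' = 0"
      using cases[of p] cases[of p'] b unfolding p_def[symmetric] p'_def[symmetric] by blast
    then show "z \<in> ?U"
    proof cases
      case 1
      then show ?thesis using z1 by blast
    next
      case 2
      show ?thesis
      proof (cases "curvature j r = 0")
        case True
        then have "z \<in> flat j" using flatz[of j r "- t'"] 2 by (simp add: p'_def)
        then show ?thesis using 2 by blast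
      next
        case False
        then have "r \<in> A j p" unfolding A_def using 2 ne perp[OF 2(5), of p p' "t + t'"] pp by auto
        moreover have "z \<in> line p (wall T j r)" using z1 2 by simp
        ultimately show ?thesis using 2 by blast
      qed
    next
      case 3
      show ?thesis
      proof (cases "curvature j r = 0")
        case True
        then have "z \<in> flat j" using flatz[of j r t] 3 by (simp add: p_def)
        then show ?thesis using 3 by blast
      next
        case False
        then have "r \<in> A j p'" unfolding A_def using 3 ne perp[OF 3(5) pp'] by auto
        moreover have "z \<in> line p' (wall T j r)" using z2 3 by simp
        ultimately show ?thesis using 3 by blast
      qed
    next
      case 4
      show ?thesis
      proof (cases "curvature i r = 0 \<or> curvature j r' = 0")
        case True
        then have "z \<in> flat i \<or> z \<in> flat j"
          using flatz[of i r t] flatz[of j r' "- t'"] 4 by (auto simp: p_def p'_def)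
        then show ?thesis using 4 by blast
      next
        case False
        then have "(r, r') \<in> bitangent i j"
          unfolding bitangent_def using 4 ne perp[OF 4(4) pp'] perp[OF 4(8) pp] by auto
        moreover have "z \<in> line (wall T i (fst (r, r'))) (wall T j (snd (r, r')))" using z1 4 by simp
        ultimately have "z \<in> (\<Union>x\<in>bitangent i j. line (wall T i (fst x)) (wall T j (snd x)))" (is "_ \<in> ?B i j")
          by (rule UN_I)
        then have "z \<in> (\<Union>j<N. ?B i j)" using 4(5) by (intro UN_I[of j "{..<N}" z "?B i"]) simp_all
        then have "z \<in> (\<Union>i<N. \<Union>j<N. ?B i j)"
          using 4(1) by (intro UN_I[of i "{..<N}" z "\<lambda>i. \<Union>j<N. ?B i j"]) simp_all
        then show ?thesis by (rule UnI2)
      qed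
    qed
  qed
  with neg show ?thesis by (rule negligible_subset)
qed

section \<open>Colourings of the curves that agree along chords\<close>

context
  fixes c :: "nat \<Rightarrow> 'c"
  assumes colour: "\<And>i r j r'. chord i r j r' \<Longrightarrow> c i = c j"
begin

text \<open>Around a point that is not doubly bad every line has a proper end, and near that end the
  curve that is hit does not change; so the colour does not depend on the direction.\<close>

lemma colour_unique:
  assumes z: "z \<in> domain" "\<not> doubly_bad z" and v: "norm v = 1" "norm w = 1"
    and h: "hit z v j r t" "hit z w j' r' t'"
  shows "c j = c j'"
proof -
  \<comment> \<open>\<open>H v x\<close> says that the line through \<open>z\<close> in direction
    \<open>v\<close> has a proper hit on a curve of colour \<open>x\<close> at one of its ends; it
    does not distinguish \<open>v\<close> from \<open>- v\<close>.\<close>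
  define H where "H v x \<longleftrightarrow> (\<exists>j r t. (hit z v j r t \<or> hit z (- v) j r t) \<and> c j = x)" for v x
  have uniq: "x = y" if "H v x" "H v y" for v x y
  proof -
    have "c j = c j'" if "hit z v j r t" "hit z v j' r' t'" for v j r t j' r' t'
      using hit_unique[OF that] by simp
    moreover have "c j = c j'" if "hit z v j r t" "hit z (- v) j' r' t'" for v j r t j' r' t'
      using colour[OF chord_of_hits[OF z(1) that]] by simp
    ultimately show ?thesis using that unfolding H_def by metis
  qed
  obtain e where e: "0 < e" "ball z e \<subseteq> domain" using z(1) open_interior open_contains_ball by blast
  have enter: "z + u *\<^sub>R v \<in> domain" if "norm v = 1" "0 < u" "u < e" for v u
    using e(2) that by (auto simp: dist_norm)
  have total: "\<exists>x. H v x" if v: "norm v = 1" for v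
  proof (rule ccontr)
    assume no: "\<not> (\<exists>x. H v x)"
    have "v \<noteq> 0" "- v \<noteq> 0" using v by auto
    then obtain t t' where "0 < t" "bad_point v (z + t *\<^sub>R v)" "0 < t'" "bad_point (- v) (z + t' *\<^sub>R (- v))"
      using ray_hit[OF \<open>v \<noteq> 0\<close> e(1), of z] ray_hit[OF \<open>- v \<noteq> 0\<close> e(1), of z]
        enter[OF v] enter[of "- v"] v no unfolding H_def by (metis norm_minus_cancel)
    moreover have "bad_point (- v) x = bad_point v x" for x by (simp add: bad_point_def)
    moreover have "z + t' *\<^sub>R (- v) = z - t' *\<^sub>R v" by simp
    ultimately have "doubly_bad z" unfolding doubly_bad_def using v by metis
    then show False using z(2) by simp
  qed
  define f where "f v = (THE x. H v x)" for v
  have f: "f v = x" if "H v x" for v x unfolding f_def using that uniq by blast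
  have near: "\<forall>\<^sub>F w in nhds v. H w (c j)" if "hit z v j r t" for v j r t
  proof -
    have "\<forall>\<^sub>F w in nhds (z, v). \<exists>r' t'. hit (fst w) (snd w) j r' t'" by (rule open_hit[OF z(1) that])
    moreover have "filterlim (\<lambda>w. (z, w)) (nhds (z, v)) (nhds v)"
      by (intro tendsto_Pair tendsto_const filterlim_ident)
    ultimately have "\<forall>\<^sub>F w in nhds v. \<exists>r' t'. hit (fst (z, w)) (snd (z, w)) j r' t'"
      by (rule eventually_compose_filterlim)
    then show ?thesis by eventually_elim (auto simp: H_def)
  qed
  \<comment> \<open>The colour is locally constant on the unit circle, which is connected.\<close>
  have "f v = f w"
  proof (rule connected_local_const[of "sphere 0 1"])
    show "connected (sphere (0 :: plane) 1)" by (rule connected_sphere) simp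
    show "v \<in> sphere 0 1" "w \<in> sphere 0 1" using v by auto
    show "\<forall>a\<in>sphere 0 1. \<forall>\<^sub>F b in at a within sphere 0 1. f a = f b"
    proof
      fix a :: plane assume "a \<in> sphere 0 1"
      then have "norm a = 1" by simp
      then obtain x where x: "H a x" using total[of a] by blast
      then obtain j r t where j: "hit z a j r t \<or> hit z (- a) j r t" "c j = x" unfolding H_def by blast
      have "\<forall>\<^sub>F b in nhds a. H b x"
        using j(1)
      proof
        assume "hit z a j r t"
        from near[OF this] show ?thesis using j(2) by simp
      next
        assume "hit z (- a) j r t"
        from near[OF this] have "\<forall>\<^sub>F b in nhds (- a). H b x" using j(2) by simp
        moreover have "filterlim uminus (nhds (- a)) (nhds a)"
          by (intro tendsto_minus filterlim_ident)
        ultimately have "\<forall>\<^sub>F b in nhds a. H (- b) x" by (rule eventually_compose_filterlim)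
        then show ?thesis by eventually_elim (auto simp: H_def)
      qed
      then have "\<forall>\<^sub>F b in at a within sphere 0 1. H b x"
        unfolding eventually_at_filter by eventually_elim simp
      then show "\<forall>\<^sub>F b in at a within sphere 0 1. f a = f b"
        by eventually_elim (use f x in simp)
    qed
  qed
  moreover have "H v (c j)" "H w (c j')" unfolding H_def using h by blast+
  then have "f v = c j" "f w = c j'" using f by blast+
  ultimately show ?thesis by simp
qed

text \<open>The points that see the colour \<open>c i\<close>, and those that see another colour,
  form two open sets by \<open>open_hit\<close>; they cover the interior since almost every ray has
  a proper hit. An overlap would be open and so contain a point that is not doubly bad, against
  \<open>colour_unique\<close>. Each curve is seen from points just inside it, so connectedness
  leaves a single colour.\<close>

lemma colour_const:
  assumes ij: "i < N" "j < N"
  shows "c i = c j"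
proof -
  define O' where "O' X = {z \<in> domain. \<exists>v j r t. norm v = 1 \<and> hit z v j r t \<and> c j \<in> X}" for X
  have opn: "open (O' X)" for X
  proof (rule open_nhdsI)
    fix z assume "z \<in> O' X"
    then obtain v j r t where z: "z \<in> domain" "norm v = 1" "hit z v j r t" "c j \<in> X" by (auto simp: O'_def)
    have "filterlim (\<lambda>w. (w, v)) (nhds (z, v)) (nhds z)"
      by (intro tendsto_Pair tendsto_const filterlim_ident)
    with open_hit[OF z(1,3)] have "\<forall>\<^sub>F w in nhds z. \<exists>r' t'. hit (fst (w, v)) (snd (w, v)) j r' t'"
      by (rule eventually_compose_filterlim)
    moreover have "\<forall>\<^sub>F w in nhds z. w \<in> domain" using z(1) by (auto simp: eventually_nhds)
    ultimately show "\<forall>\<^sub>F w in nhds z. w \<in> O' X"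
    proof eventually_elim
      case (elim w)
      then obtain r' t' where "hit w v j r' t'" by auto
      then show ?case unfolding O'_def using z(2,4) elim(2) by blast
    qed
  qed
  have nonempty: "O' X \<noteq> {}" if iN: "i < N" and ci: "c i \<in> X" for i X
  proof -
    have "infinite {lo T i..hi T i}" by (rule infinite_Icc[OF lo_less_hi[OF iN]])
    then have "{r \<in> {lo T i..hi T i}. \<not> nice i r} \<noteq> {lo T i..hi T i}"
      using finite_not_nice[OF iN] by metis
    then obtain r where r: "nice i r" by blast
    have n1: "norm (normal T i r) = 1" by (rule norm_normal[OF nice_smooth[OF r]])
    then have nn: "normal T i r \<bullet> normal T i r = 1" by (simp add: norm_eq_1)
    then obtain \<eta> where e: "0 < \<eta>" "\<And>u. 0 < u \<Longrightarrow> u < \<eta> \<Longrightarrow> wall T i r + u *\<^sub>R normal T i r \<in> domain"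
      using ray_enters_domain[OF r, of "normal T i r"] by (metis zero_less_one)
    define z where "z = wall T i r + (\<eta> / 2) *\<^sub>R normal T i r"
    have "hit z (- normal T i r) i r (\<eta> / 2)"
      unfolding hit_def
    proof (intro conjI allI impI)
      fix u assume "0 < u \<and> u < \<eta> / 2"
      moreover have "z + u *\<^sub>R - normal T i r = wall T i r + (\<eta> / 2 - u) *\<^sub>R normal T i r"
        by (simp add: z_def algebra_simps)
      ultimately show "z + u *\<^sub>R - normal T i r \<in> domain" using e by simp
    qed (use e r nn in \<open>auto simp: z_def\<close>)
    moreover have "z \<in> domain" using e by (simp add: z_def)
    moreover have "norm (- normal T i r) = 1" using n1 by simp
    ultimately have "z \<in> O' X" unfolding O'_def using ci by blast
    then show ?thesis by blast
  qed
  have cover: "domain \<subseteq> O' {c i} \<union> O' (- {c i})"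
  proof
    fix z assume z: "z \<in> domain"
    let ?a = "(1, 0) :: plane"
    have a: "norm ?a = 1" by (simp add: norm_Pair)
    obtain e where e: "0 < e" "ball z e \<subseteq> domain" using z open_interior open_contains_ball by blast
    have "AE s in lborel. - 1 < s \<and> s < 1 \<longrightarrow> (\<exists>j r t. hit z (velocity ?a s) j r t)"
    proof (rule AE_ray_hit[OF a])
      fix s :: real assume "- 1 < s" "s < 1"
      then have "norm (velocity ?a s) = 1" by (rule velocity_props[OF a])
      then have "\<forall>u. 0 < u \<and> u < e \<longrightarrow> z + u *\<^sub>R velocity ?a s \<in> domain"
        using e(2) by (auto simp: dist_norm)
      then show "\<exists>\<eta>>0. \<forall>u. 0 < u \<and> u < \<eta> \<longrightarrow> z + u *\<^sub>R velocity ?a s \<in> domain" using e(1) by blast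
    qed
    then have "\<exists>s. - 1 < s \<and> s < 1 \<and> (\<exists>j r t. hit z (velocity ?a s) j r t)"
    proof (rule contrapos_pp)
      assume "\<not> (\<exists>s. - 1 < s \<and> s < 1 \<and> (\<exists>j r t. hit z (velocity ?a s) j r t))"
      then have no: "\<And>s. - 1 < s \<Longrightarrow> s < 1 \<Longrightarrow> \<not> (\<exists>j r t. hit z (velocity ?a s) j r t)" by blast
      show "\<not> (AE s in lborel. - 1 < s \<and> s < 1 \<longrightarrow> (\<exists>j r t. hit z (velocity ?a s) j r t))"
      proof
        assume "AE s in lborel. - 1 < s \<and> s < 1 \<longrightarrow> (\<exists>j r t. hit z (velocity ?a s) j r t)"
        then have "AE s in lborel. s \<notin> {-1<..<1::real}" by eventually_elim (use no in auto)
        then have "{-1<..<1::real} \<in> null_sets lborel" by (subst AE_iff_null_sets) auto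
        then have "emeasure lborel {-1<..<1::real} = 0" by (rule null_setsD1)
        then show False by simp
      qed
    qed
    then obtain s j r t where s: "- 1 < s" "s < 1" "hit z (velocity ?a s) j r t" by blast
    then have "norm (velocity ?a s) = 1" using velocity_props[OF a] by blast
    then have "z \<in> O' X" if "c j \<in> X" for X unfolding O'_def using s z that by blast
    from this[of "{c i}"] this[of "- {c i}"] show "z \<in> O' {c i} \<union> O' (- {c i})"
      by (cases "c j = c i") simp_all
  qed
  have disj: "O' {c i} \<inter> O' (- {c i}) = {}"
  proof (rule ccontr)
    assume "O' {c i} \<inter> O' (- {c i}) \<noteq> {}"
    then have "\<not> negligible (O' {c i} \<inter> O' (- {c i}))"
      using opn by (intro open_not_negligible open_Int)
    then obtain z where z: "z \<in> O' {c i}" "z \<in> O' (- {c i})" "\<not> doubly_bad z"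
      using negligible_subset[OF negligible_doubly_bad, of "O' {c i} \<inter> O' (- {c i})"] by blast
    then show False using colour_unique unfolding O'_def by fastforce
  qed
  have "O' (- {c i}) = {}"
  proof (rule ccontr)
    assume "O' (- {c i}) \<noteq> {}"
    moreover have "O' {c i} \<noteq> {}" by (rule nonempty[OF ij(1)]) simp
    moreover have "O' X \<subseteq> domain" for X by (auto simp: O'_def)
    ultimately show False
      using connectedD[OF connected_domain opn[of "{c i}"] opn[of "- {c i}"]] cover disj by blast
  qed
  then show ?thesis using nonempty[OF ij(2), of "- {c i}"] by force
qed

end

end

section \<open>The perturbation preserves the measure\<close>

lemma AE_lborel_negligible: "negligible S \<Longrightarrow> AE x in lborel. x \<notin> S"
  by (subst AE_completion_iff[symmetric], rule AE_not_in) (simp_all add: negligible_iff_null_sets)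

lemma AE_coordinates: "AE x in (lborel :: plane measure). fst x \<noteq> c" "AE x in (lborel :: plane measure). snd x \<noteq> c"
proof -
  have "{x :: plane. fst x = c} \<subseteq> {(c, 0) + t *\<^sub>R (0, 1) | t. True}"
    by (auto simp: prod_eq_iff)
  then have "negligible {x :: plane. fst x = c}" by (rule negligible_subset[OF negligible_line])
  from AE_lborel_negligible[OF this] show "AE x in (lborel :: plane measure). fst x \<noteq> c" by simp
  have "{x :: plane. snd x = c} \<subseteq> {(0, c) + t *\<^sub>R (1, 0) | t. True}"
    by (auto simp: prod_eq_iff)
  then have "negligible {x :: plane. snd x = c}" by (rule negligible_subset[OF negligible_line])
  from AE_lborel_negligible[OF this] show "AE x in (lborel :: plane measure). snd x \<noteq> c" by simp
qed

lemma nn_integral_lborel_translation: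
  fixes f :: "plane \<Rightarrow> ennreal"
  assumes f: "f \<in> borel_measurable borel"
  shows "(\<integral>\<^sup>+x. f (c + x) \<partial>lborel) = (\<integral>\<^sup>+x. f x \<partial>lborel)"
proof -
  have "(\<integral>\<^sup>+x. f x \<partial>distr lborel borel ((+) c)) = (\<integral>\<^sup>+x. f (c + x) \<partial>lborel)"
    using f by (intro nn_integral_distr) auto
  then show ?thesis by (simp add: lborel_distr_plus)
qed

section \<open>Tiling the plane by the lattice\<close>

definition lattice_vector :: "real \<Rightarrow> int \<times> int \<Rightarrow> plane" where
  "lattice_vector w m = (of_int (fst m) * w, of_int (snd m) * 2)"

text \<open>The floor of each coordinate, measured in periods from the lower corner, is the only
  possible index, the rectangle being half-open in both coordinates.\<close>

lemma lattice_representative: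
  assumes w: "0 < w"
  shows "\<exists>!m. z - lattice_vector w m \<in> {a..<a + w} \<times> {-1..<1}"
proof -
  have iff: "z - lattice_vector w m \<in> {a..<a + w} \<times> {-1..<1} \<longleftrightarrow>
    fst m = \<lfloor>(fst z - a) / w\<rfloor> \<and> snd m = \<lfloor>(snd z + 1) / 2\<rfloor>" for m
  proof -
    have "fst m = \<lfloor>(fst z - a) / w\<rfloor> \<longleftrightarrow> of_int (fst m) * w \<le> fst z - a \<and> fst z - a < (of_int (fst m) + 1) * w"
      using w by (simp add: eq_commute[of "fst m"] floor_eq_iff pos_le_divide_eq pos_divide_less_eq)
    moreover have "snd m = \<lfloor>(snd z + 1) / 2\<rfloor> \<longleftrightarrow> of_int (snd m) * 2 \<le> snd z + 1 \<and> snd z + 1 < (of_int (snd m) + 1) * 2"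
      by (simp add: eq_commute[of "snd m"] floor_eq_iff pos_le_divide_eq pos_divide_less_eq)
    ultimately show ?thesis by (cases z) (auto simp: lattice_vector_def algebra_simps)
  qed
  show ?thesis unfolding iff by (metis fst_conv prod.collapse snd_conv)
qed

text \<open>The rectangle is a fundamental domain of the lattice.\<close>

lemma lattice_tiling:
  fixes B :: "plane set"
  assumes w: "0 < w" and B: "B \<in> sets borel" "B \<subseteq> {a..<a + w} \<times> {-1..1}"
  shows "(\<integral>\<^sup>+x. indicator ({a..<a + w} \<times> {-1..1}) x * indicator {z. \<exists>m. z + lattice_vector w m \<in> B} (u + x) \<partial>lborel) =
    emeasure lborel B"
proof -
  let ?V = "lattice_vector w"
  \<comment> \<open>The rectangle of collisions is closed in \<open>s\<close>; dropping the null
    edge \<open>s = 1\<close> makes representatives unique.\<close>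
  define R where "R = {a..<a + w} \<times> {-1..<1::real}"
  have R: "R \<in> sets borel" unfolding R_def by (intro borel_Times) auto
  define B' where "B' = B \<inter> R"
  have B': "B' \<in> sets borel" using B R by (auto simp: B'_def)
  have rep: "\<exists>!m. z - ?V m \<in> R" for z unfolding R_def by (rule lattice_representative[OF w])
  have neg: "?V (- m) = - ?V m" for m by (simp add: lattice_vector_def)
  have uniq: "m = m'" if "z + ?V m \<in> R" "z + ?V m' \<in> R" for z m m'
  proof -
    have "z - ?V (- m) \<in> R" "z - ?V (- m') \<in> R" using that by (simp_all add: neg)
    then have "- m = - m'" using rep[of z] by blast
    then show ?thesis by simp
  qed
  \<comment> \<open>\<open>B'\<close> lies in one cell, so at most one lattice translate of
    \<open>z\<close> falls into it and the sum over the lattice is an indicator.\<close>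
  have count1: "(\<integral>\<^sup>+m. indicator B' (z + ?V m) \<partial>count_space UNIV) = indicator {z. \<exists>m. z + ?V m \<in> B'} z" for z
  proof (cases "\<exists>m. z + ?V m \<in> B'")
    case True
    then obtain m0 where m0: "z + ?V m0 \<in> B'" by blast
    have "(\<integral>\<^sup>+m. indicator B' (z + ?V m) \<partial>count_space UNIV) = (\<integral>\<^sup>+m. indicator {m0} m \<partial>count_space UNIV)"
      using m0 uniq[of z _ m0] by (intro nn_integral_cong) (auto simp: indicator_def B'_def)
    also have "\<dots> = 1" by (subst nn_integral_indicator) simp_all
    finally show ?thesis using True by simp
  next
    case False
    then have "indicator B' (z + ?V m) = (0 :: ennreal)" for m by (metis indicator_simps(2))
    then show ?thesis using False by simp
  qed
  have count2: "(\<integral>\<^sup>+m. indicator R (z - ?V m) \<partial>count_space UNIV) = (1 :: ennreal)" for z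
  proof -
    obtain m0 where m0: "z - ?V m \<in> R \<longleftrightarrow> m = m0" for m using rep[of z] by blast
    have "(\<integral>\<^sup>+m. indicator R (z - ?V m) \<partial>count_space UNIV) = (\<integral>\<^sup>+m. indicator {m0} m \<partial>count_space UNIV)"
      by (intro nn_integral_cong) (simp add: indicator_def m0)
    also have "\<dots> = 1" by (subst nn_integral_indicator) simp_all
    finally show ?thesis .
  qed
  have transl: "(\<lambda>x :: plane. c + x) \<in> borel_measurable borel" "(\<lambda>x :: plane. x - c) \<in> borel_measurable borel" for c
    by (intro borel_measurable_continuous_onI continuous_intros)+
  have iR: "(indicator R :: plane \<Rightarrow> ennreal) \<in> borel_measurable borel"
    and iB: "(indicator B' :: plane \<Rightarrow> ennreal) \<in> borel_measurable borel" using R B' by simp_all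
  have ae: "AE x in lborel. \<forall>m. snd (u + x + ?V m) \<noteq> 1"
    unfolding AE_all_countable
  proof
    fix m
    from AE_coordinates(2)[of "1 - snd u - snd (?V m)"]
    show "AE x in lborel. snd (u + x + ?V m) \<noteq> 1" by eventually_elim (simp add: algebra_simps)
  qed
  have "(\<integral>\<^sup>+x. indicator ({a..<a + w} \<times> {-1..1}) x * indicator {z. \<exists>m. z + ?V m \<in> B} (u + x) \<partial>lborel) =
    (\<integral>\<^sup>+x. \<integral>\<^sup>+m. indicator R x * indicator B' (u + x + ?V m) \<partial>count_space UNIV \<partial>lborel)"
  proof (rule nn_integral_cong_AE)
    show "AE x in lborel. indicator ({a..<a + w} \<times> {-1..1}) x * indicator {z. \<exists>m. z + ?V m \<in> B} (u + x) =
      (\<integral>\<^sup>+m. indicator R x * indicator B' (u + x + ?V m) \<partial>count_space UNIV)"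
      using AE_coordinates(2)[of 1] ae
    proof eventually_elim
      case (elim x)
      have i1: "indicator ({a..<a + w} \<times> {-1..1}) x = (indicator R x :: ennreal)"
        using elim(1) by (cases x) (auto simp: R_def indicator_def)
      have i2: "u + x + ?V m \<in> B \<longleftrightarrow> u + x + ?V m \<in> B'" for m
        using elim(2)[rule_format, of m] B(2) unfolding B'_def R_def by (cases "u + x + ?V m") force
      have i3: "indicator {z. \<exists>m. z + ?V m \<in> B} (u + x) = (\<integral>\<^sup>+m. indicator B' (u + x + ?V m) \<partial>count_space UNIV)"
        unfolding count1 by (simp only: indicator_def mem_Collect_eq i2)
      show ?case unfolding i1 i3 by (rule nn_integral_cmult[symmetric]) simp
    qed
  qed
  also have "\<dots> = (\<integral>\<^sup>+m. \<integral>\<^sup>+x. indicator R x * indicator B' (u + x + ?V m) \<partial>lborel \<partial>count_space UNIV)"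
  proof (rule nn_integral_count_space_nn_integral)
    fix m
    have "(\<lambda>x. u + x + ?V m) \<in> borel_measurable borel"
      by (intro borel_measurable_continuous_onI continuous_intros)
    from borel_measurable_times_ennreal[OF iR measurable_compose[OF this iB]]
    show "(\<lambda>x. indicator R x * indicator B' (u + x + ?V m) :: ennreal) \<in> borel_measurable lborel" by simp
  qed simp
  \<comment> \<open>The substitution \<open>y = u + x + ?V m\<close> moves the lattice from
    \<open>B'\<close> to \<open>R\<close>, whose translates sum to \<open>1\<close>.\<close>
  also have "\<dots> = (\<integral>\<^sup>+m. \<integral>\<^sup>+y. indicator R (y - u - ?V m) * indicator B' y \<partial>lborel \<partial>count_space UNIV)"
  proof (rule nn_integral_cong)
    fix m
    let ?f = "\<lambda>y. indicator R (y - (u + ?V m)) * indicator B' y :: ennreal"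
    have "?f \<in> borel_measurable borel"
      by (rule borel_measurable_times_ennreal[OF measurable_compose[OF transl(2) iR] iB])
    from nn_integral_lborel_translation[OF this, of "u + ?V m"]
    show "(\<integral>\<^sup>+x. indicator R x * indicator B' (u + x + ?V m) \<partial>lborel) =
      (\<integral>\<^sup>+y. indicator R (y - u - ?V m) * indicator B' y \<partial>lborel)"
      by (simp add: ac_simps diff_diff_eq)
  qed
  also have "\<dots> = (\<integral>\<^sup>+y. \<integral>\<^sup>+m. indicator R (y - u - ?V m) * indicator B' y \<partial>count_space UNIV \<partial>lborel)"
  proof (rule nn_integral_count_space_nn_integral[symmetric])
    fix m
    have "(\<lambda>x. x - u - ?V m) \<in> borel_measurable borel"
      by (intro borel_measurable_continuous_onI continuous_intros)
    from borel_measurable_times_ennreal[OF measurable_compose[OF this iR] iB]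
    show "(\<lambda>y. indicator R (y - u - ?V m) * indicator B' y :: ennreal) \<in> borel_measurable lborel" by simp
  qed simp
  also have "\<dots> = (\<integral>\<^sup>+y. indicator B' y \<partial>lborel)"
    by (intro nn_integral_cong) (simp add: nn_integral_multc count2)
  also have "\<dots> = (\<integral>\<^sup>+y. indicator B y \<partial>lborel)"
  proof (rule nn_integral_cong_AE)
    show "AE y in lborel. indicator B' y = (indicator B y :: ennreal)"
      using AE_coordinates(2)[of 1]
    proof eventually_elim
      case (elim y)
      have "y \<in> B \<Longrightarrow> y \<in> R" using elim B(2) unfolding R_def by (cases y) force
      then show ?case by (auto simp: B'_def indicator_def)
    qed
  qed
  also have "\<dots> = emeasure lborel B" using B(1) by simp
  finally show ?thesis .
qed

context classical_billiard
begin

lemma wrap_lattice_vector: "v \<in> wrap_lattice T i \<longleftrightarrow> (\<exists>m. v = lattice_vector (hi T i - lo T i) m)"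
  by (auto simp: wrap_lattice_def lattice_vector_def)

section \<open>The wrapped noise\<close>

text \<open>The full preimage, in the plane, of the slice of \<open>B\<close> in component
  \<open>i\<close> under reduction modulo the lattice.\<close>

definition wrapped :: "collision set \<Rightarrow> nat \<Rightarrow> plane set" where
  "wrapped B i = {z. \<exists>m. (i, z + lattice_vector (hi T i - lo T i) m) \<in> B}"

lemma sets_slice: "B \<in> sets borel \<Longrightarrow> {x. (i, x) \<in> B} \<in> sets borel" for i :: nat and B :: "collision set"
proof -
  assume "B \<in> sets borel"
  then have "(\<lambda>x. (i, x)) -` B \<inter> space borel \<in> sets borel"
    by (rule measurable_sets[rotated]) (intro borel_measurable_continuous_onI continuous_intros)
  then show ?thesis by (simp add: vimage_def)
qed

lemma sets_wrapped: "B \<in> sets borel \<Longrightarrow> wrapped B i \<in> sets borel"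
proof -
  assume B: "B \<in> sets borel"
  have "wrapped B i = (\<Union>m. (\<lambda>z. z + lattice_vector (hi T i - lo T i) m) -` {x. (i, x) \<in> B} \<inter> space borel)"
    by (auto simp: wrapped_def)
  also have "\<dots> \<in> sets borel"
  proof (rule sets.countable_UN'')
    show "(\<lambda>z. z + lattice_vector (hi T i - lo T i) m) -` {x. (i, x) \<in> B} \<inter> space borel \<in> sets borel" for m
      by (rule measurable_sets[OF _ sets_slice[OF B]]) (intro borel_measurable_continuous_onI continuous_intros)
  qed simp
  finally show ?thesis .
qed

context
  fixes \<rho> :: "plane \<Rightarrow> real"
  assumes \<rho>m: "\<rho> \<in> borel_measurable borel"
begin

abbreviation "\<nu> \<equiv> density lborel (\<lambda>u. ennreal (\<rho> u))"

lemma noise_eq: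
  assumes B: "B \<in> sets borel"
  shows "noise T \<nu> (i, x) B = (\<integral>\<^sup>+u. ennreal (\<rho> u) * indicator (wrapped B i) (u + x) \<partial>lborel)"
proof -
  have set: "{u. \<exists>v\<in>wrap_lattice T i. (i, u + x + v) \<in> B} = (\<lambda>u. u + x) -` wrapped B i"
  proof -
    have "(\<exists>v\<in>wrap_lattice T i. (i, u + x + v) \<in> B) \<longleftrightarrow> u + x \<in> wrapped B i" for u
      unfolding wrapped_def Bex_def wrap_lattice_vector mem_Collect_eq by blast
    then show ?thesis by (simp add: vimage_def)
  qed
  have "(\<lambda>u. u + x) -` wrapped B i \<inter> space borel \<in> sets borel"
    by (intro measurable_sets[OF _ sets_wrapped[OF B]] borel_measurable_continuous_onI continuous_intros)
  then have s: "(\<lambda>u. u + x) -` wrapped B i \<in> sets lborel" by simp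
  show ?thesis
    unfolding noise_def prod.case set
    using s \<rho>m by (subst emeasure_density) (auto simp: indicator_def intro!: nn_integral_cong)
qed

lemma noise_integrand: "B \<in> sets borel \<Longrightarrow>
  (\<lambda>(x, u). ennreal (\<rho> u) * indicator (wrapped B i) (u + x)) \<in> borel_measurable (lborel \<Otimes>\<^sub>M lborel)"
proof -
  assume B: "B \<in> sets borel"
  have "(\<lambda>p :: plane \<times> plane. snd p + fst p) \<in> borel_measurable borel"
    by (intro borel_measurable_continuous_onI continuous_intros)
  moreover have "(indicator (wrapped B i) :: plane \<Rightarrow> ennreal) \<in> borel_measurable borel"
    using sets_wrapped[OF B] by simp
  ultimately have 1: "(\<lambda>p :: plane \<times> plane. indicator (wrapped B i) (snd p + fst p) :: ennreal) \<in> borel_measurable borel"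
    by (rule measurable_compose)
  have "(\<lambda>p :: plane \<times> plane. snd p) \<in> borel_measurable borel"
    by (intro borel_measurable_continuous_onI continuous_intros)
  then have "(\<lambda>p :: plane \<times> plane. ennreal (\<rho> (snd p))) \<in> borel_measurable borel"
    using \<rho>m by (intro measurable_compose[OF measurable_compose[OF _ \<rho>m]]) auto
  with 1 have "(\<lambda>p :: plane \<times> plane. ennreal (\<rho> (snd p)) * indicator (wrapped B i) (snd p + fst p)) \<in> borel_measurable borel"
    by (intro borel_measurable_times_ennreal)
  then show ?thesis by (simp add: split_beta lborel_prod)
qed

lemma measurable_noise:
  assumes B: "B \<in> sets borel"
  shows "(\<lambda>y. noise T \<nu> y B) \<in> borel_measurable borel"
proof -
  have "(\<lambda>x. noise T \<nu> (i, x) B) \<in> borel_measurable lborel" for i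
    unfolding noise_eq[OF B]
    using lborel.borel_measurable_nn_integral_fst[OF noise_integrand[OF B]] by simp
  then have "(\<lambda>y. noise T \<nu> y B) \<in> borel_measurable (count_space UNIV \<Otimes>\<^sub>M lborel)"
    by (intro measurable_pair_measure_countable1) auto
  then show ?thesis by (simp only: measurable_cong_sets[OF sets_count_lborel refl])
qed

text \<open>By Tonelli the displacement \<open>u\<close> may be fixed first. Wrapping a translated
  cell preserves area by \<open>lattice_tiling\<close>, and the remaining integral of
  \<open>\<rho>\<close> is \<open>1\<close>.\<close>

lemma noise_preserves:
  assumes \<rho>p: "prob_space \<nu>" and B: "B \<in> sets (collision_space T)"
  shows "(\<integral>\<^sup>+y. noise T \<nu> y B \<partial>billiard_measure T) = emeasure (billiard_measure T) B"
proof -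
  have Bb: "B \<in> sets borel" "B \<subseteq> collisions T" using B by (auto simp: sets_collision_space)
  have one: "(\<integral>\<^sup>+u. ennreal (\<rho> u) \<partial>lborel) = 1"
  proof -
    have "emeasure \<nu> (space \<nu>) = 1" by (rule prob_space.emeasure_space_1[OF \<rho>p])
    then show ?thesis using \<rho>m by (simp add: emeasure_density)
  qed
  have slice_eq: "(\<integral>\<^sup>+x. indicator ({lo T i..<hi T i} \<times> {-1..1}) x * noise T \<nu> (i, x) B \<partial>lborel) =
    (\<integral>\<^sup>+x. indicator ({lo T i..<hi T i} \<times> {-1..1}) x * indicator B (i, x) \<partial>lborel)" if i: "i < N" for i
  proof -
    let ?R = "{lo T i..<hi T i} \<times> {-1..1::real}" and ?w = "hi T i - lo T i"
    let ?B = "{x. (i, x) \<in> B}"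
    have w: "0 < ?w" using lo_less_hi[OF i] by simp
    have R: "?R \<in> sets borel" by (intro borel_Times) auto
    have BR: "?B \<subseteq> ?R" using Bb(2) by (auto simp: collisions_def)
    have W: "wrapped B i = {z. \<exists>m. z + lattice_vector ?w m \<in> ?B}" by (simp add: wrapped_def)
    have m: "(\<lambda>(x, u). indicator ?R x * (ennreal (\<rho> u) * indicator (wrapped B i) (u + x))) \<in> borel_measurable (lborel \<Otimes>\<^sub>M lborel)"
    proof -
      have "(\<lambda>p :: plane \<times> plane. indicator ?R (fst p) :: ennreal) \<in> borel_measurable (lborel \<Otimes>\<^sub>M lborel)"
        using R by (intro measurable_compose[OF measurable_fst]) simp
      then show ?thesis using noise_integrand[OF Bb(1), of i] unfolding split_beta by (rule borel_measurable_times_ennreal)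
    qed
    have mu: "(\<lambda>u. ennreal (\<rho> u) * indicator (wrapped B i) (u + x)) \<in> borel_measurable lborel" for x
    proof -
      have "(\<lambda>u. u + x) \<in> borel_measurable borel" by (intro borel_measurable_continuous_onI continuous_intros)
      then have "(\<lambda>u. indicator (wrapped B i) (u + x) :: ennreal) \<in> borel_measurable borel"
        by (rule measurable_compose) (use sets_wrapped[OF Bb(1)] in simp)
      then show ?thesis using \<rho>m by simp
    qed
    have mx: "(\<lambda>x. indicator ?R x * indicator (wrapped B i) (u + x) :: ennreal) \<in> borel_measurable lborel" for u
    proof -
      have "(\<lambda>x. u + x) \<in> borel_measurable borel" by (intro borel_measurable_continuous_onI continuous_intros)
      then have "(\<lambda>x. indicator (wrapped B i) (u + x) :: ennreal) \<in> borel_measurable borel"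
        by (rule measurable_compose) (use sets_wrapped[OF Bb(1)] in simp)
      then show ?thesis using R by simp
    qed
    have "(\<integral>\<^sup>+x. indicator ?R x * noise T \<nu> (i, x) B \<partial>lborel) =
      (\<integral>\<^sup>+x. \<integral>\<^sup>+u. indicator ?R x * (ennreal (\<rho> u) * indicator (wrapped B i) (u + x)) \<partial>lborel \<partial>lborel)"
      unfolding noise_eq[OF Bb(1)] by (intro nn_integral_cong nn_integral_cmult[symmetric] mu)
    also have "\<dots> = (\<integral>\<^sup>+u. \<integral>\<^sup>+x. indicator ?R x * (ennreal (\<rho> u) * indicator (wrapped B i) (u + x)) \<partial>lborel \<partial>lborel)"
      using lborel_pair.Fubini'[OF m] by simp
    also have "\<dots> = (\<integral>\<^sup>+u. \<integral>\<^sup>+x. ennreal (\<rho> u) * (indicator ?R x * indicator (wrapped B i) (u + x)) \<partial>lborel \<partial>lborel)"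
      by (simp only: mult.left_commute)
    also have "\<dots> = (\<integral>\<^sup>+u. ennreal (\<rho> u) * (\<integral>\<^sup>+x. indicator ?R x * indicator (wrapped B i) (u + x) \<partial>lborel) \<partial>lborel)"
      by (intro nn_integral_cong nn_integral_cmult mx)
    also have "\<dots> = (\<integral>\<^sup>+u. ennreal (\<rho> u) * emeasure lborel ?B \<partial>lborel)"
      using lattice_tiling[OF w sets_slice[OF Bb(1), of i], of "lo T i"] BR unfolding W by simp
    also have "\<dots> = emeasure lborel ?B" using \<rho>m by (simp add: nn_integral_multc one)
    also have "\<dots> = (\<integral>\<^sup>+x. indicator ?B x \<partial>lborel)" using sets_slice[OF Bb(1)] by simp
    also have "\<dots> = (\<integral>\<^sup>+x. indicator ?R x * indicator B (i, x) \<partial>lborel)"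
      using BR by (intro nn_integral_cong) (auto simp: indicator_def)
    finally show ?thesis .
  qed
  have ind: "indicator B \<in> borel_measurable borel" using Bb by simp
  have "(\<integral>\<^sup>+y. noise T \<nu> y B \<partial>billiard_measure T) = (\<integral>\<^sup>+y. indicator B y \<partial>billiard_measure T)"
    unfolding nn_integral_billiard_measure[OF measurable_noise[OF Bb(1)]] nn_integral_billiard_measure[OF ind]
      unnormalized_plane[OF measurable_noise[OF Bb(1)]] unnormalized_plane[OF ind]
    by (intro arg_cong2[of _ _ _ _ times] sum.cong refl slice_eq) simp
  also have "\<dots> = emeasure (billiard_measure T) B" using B by (simp add: sets_billiard_measure)
  finally show ?thesis .
qed

lemma random_billiard_invariant:
  assumes \<rho>p: "prob_space \<nu>" and P: "random_billiard T \<nu> P"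
  shows "invariant_measure (collision_space T) P (billiard_measure T)"
  unfolding invariant_measure_def
proof (intro conjI ballI prob_space_billiard_measure sets_billiard_measure)
  fix B assume B: "B \<in> sets (collision_space T)"
  have Bb: "B \<in> sets borel" using B by (simp add: sets_collision_space)
  have Pm: "P \<in> collision_space T \<rightarrow>\<^sub>M subprob_algebra (collision_space T)"
    using P unfolding random_billiard_def markov_kernel_def by (intro measurable_prob_algebraD) simp
  \<comment> \<open>The indicator extends the values of the kernel to a Borel function on the whole
    type, as \<open>billiard_map_preserves\<close> requires.\<close>
  define h where "h x = emeasure (P x) B * indicator (collisions T) x" for x
  have "(\<lambda>x. emeasure (P x) B) \<in> borel_measurable (collision_space T)"
    by (rule measurable_emeasure_kernel[OF Pm B])
  then have h: "h \<in> borel_measurable borel"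
    unfolding h_def collision_space_def using sets_collisions
    by (subst (asm) borel_measurable_restrict_space_iff_ennreal) auto
  have "AE x in billiard_measure T. x \<in> collisions T"
    using AE_space[of "billiard_measure T"] by (simp add: space_billiard_measure)
  moreover have "AE x in billiard_measure T. \<forall>B\<in>sets (collision_space T). emeasure (P x) B = noise T \<nu> (billiard_map T x) B"
    using P by (simp add: random_billiard_def)
  ultimately have eq: "AE x in billiard_measure T. h x = noise T \<nu> (billiard_map T x) B"
    by eventually_elim (use B in \<open>simp add: h_def\<close>)
  have "(\<integral>\<^sup>+x. emeasure (P x) B \<partial>billiard_measure T) = (\<integral>\<^sup>+x. h x \<partial>billiard_measure T)"
    by (rule nn_integral_cong) (simp add: h_def space_billiard_measure)
  also have "\<dots> = (\<integral>\<^sup>+y. noise T \<nu> y B \<partial>billiard_measure T)"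
    by (rule billiard_map_preserves[OF h measurable_noise[OF Bb] eq])
  also have "\<dots> = emeasure (billiard_measure T) B" by (rule noise_preserves[OF \<rho>p B])
  finally show "emeasure (billiard_measure T) B = (\<integral>\<^sup>+x. emeasure (P x) B \<partial>billiard_measure T)" ..
qed

end

end

section \<open>Ergodicity\<close>

lemma AE_open_ex:
  fixes U :: "plane set"
  assumes "open U" "U \<noteq> {}" and Q: "AE x in lborel. Q x"
  shows "\<exists>x\<in>U. Q x"
proof (rule ccontr)
  assume none: "\<not> (\<exists>x\<in>U. Q x)"
  from Q have "AE x in lborel. x \<notin> U" by eventually_elim (use none in blast)
  then have "U \<in> null_sets lborel" using assms(1) by (subst AE_iff_null_sets) auto
  then have "negligible U" by (simp add: negligible_iff_null_sets null_sets_completionI)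
  then show False using open_not_negligible[OF assms(1,2)] by simp
qed

text \<open>The radius \<open>\<epsilon>\<close> is the same at a dense set of centres, so half of
  it serves at every centre. Constants at centres closer than \<open>\<epsilon> / 2\<close> agree,
  because the balls overlap in an open set of positive measure inside \<open>U\<close>.
  Connectedness makes the constant global, and Lindelof reduces the cover to countably many null
  sets.\<close>

lemma AE_const_of_local:
  fixes U :: "plane set" and f :: "plane \<Rightarrow> real"
  assumes U: "open U" "connected U" and \<epsilon>: "0 < \<epsilon>"
    and dense: "\<And>W. open W \<Longrightarrow> W \<subseteq> U \<Longrightarrow> W \<noteq> {} \<Longrightarrow>
      \<exists>z\<in>W. \<exists>c. AE y in lborel. dist y z < \<epsilon> \<and> y \<in> U \<longrightarrow> f y = c"
  shows "\<exists>c. AE y in lborel. y \<in> U \<longrightarrow> f y = c"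
proof (cases "U = {}")
  case False
  have "\<exists>c. AE y in lborel. dist y z < \<epsilon> / 2 \<and> y \<in> U \<longrightarrow> f y = c" if z: "z \<in> U" for z
  proof -
    have "open (U \<inter> ball z (\<epsilon> / 2))" "U \<inter> ball z (\<epsilon> / 2) \<noteq> {}" using U z \<epsilon> by auto
    then obtain z' c where z': "z' \<in> U \<inter> ball z (\<epsilon> / 2)" and c: "AE y in lborel. dist y z' < \<epsilon> \<and> y \<in> U \<longrightarrow> f y = c"
      using dense[of "U \<inter> ball z (\<epsilon> / 2)"] by blast
    from c have "AE y in lborel. dist y z < \<epsilon> / 2 \<and> y \<in> U \<longrightarrow> f y = c"
    proof eventually_elim
      case (elim y)
      have "dist y z' \<le> dist y z + dist z z'" by (rule dist_triangle)
      then show ?case using elim z' by auto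
    qed
    then show ?thesis by blast
  qed
  then have "\<forall>z\<in>U. \<exists>c. AE y in lborel. dist y z < \<epsilon> / 2 \<and> y \<in> U \<longrightarrow> f y = c" ..
  from bchoice[OF this] obtain c where "\<forall>z\<in>U. AE y in lborel. dist y z < \<epsilon> / 2 \<and> y \<in> U \<longrightarrow> f y = c z" ..
  then have c: "AE y in lborel. dist y z < \<epsilon> / 2 \<and> y \<in> U \<longrightarrow> f y = c z" if "z \<in> U" for z
    using that by (rule bspec)
  have loc: "c z = c z'" if "z \<in> U" "z' \<in> U" "dist z' z < \<epsilon> / 2" for z z'
  proof -
    have "open (U \<inter> ball z (\<epsilon> / 2) \<inter> ball z' (\<epsilon> / 2))" using U by auto
    moreover have "z' \<in> U \<inter> ball z (\<epsilon> / 2) \<inter> ball z' (\<epsilon> / 2)" using that \<epsilon> by (simp add: dist_commute)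
    moreover have "AE y in lborel. (dist y z < \<epsilon> / 2 \<and> y \<in> U \<longrightarrow> f y = c z) \<and> (dist y z' < \<epsilon> / 2 \<and> y \<in> U \<longrightarrow> f y = c z')"
      using c[OF that(1)] c[OF that(2)] by eventually_elim simp
    ultimately obtain y where "y \<in> U \<inter> ball z (\<epsilon> / 2) \<inter> ball z' (\<epsilon> / 2)"
      "(dist y z < \<epsilon> / 2 \<and> y \<in> U \<longrightarrow> f y = c z) \<and> (dist y z' < \<epsilon> / 2 \<and> y \<in> U \<longrightarrow> f y = c z')"
      using AE_open_ex[of "U \<inter> ball z (\<epsilon> / 2) \<inter> ball z' (\<epsilon> / 2)"] by blast
    then show ?thesis by (simp add: dist_commute)
  qed
  obtain z0 where z0: "z0 \<in> U" using False by blast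
  have const: "c z = c z0" if "z \<in> U" for z
  proof (rule connected_local_const[OF U(2) that z0, of c], intro ballI)
    fix a assume a: "a \<in> U"
    show "\<forall>\<^sub>F b in at a within U. c a = c b"
      unfolding eventually_at
    proof (intro exI[of _ "\<epsilon> / 2"] conjI ballI impI)
      show "0 < \<epsilon> / 2" using \<epsilon> by simp
      show "c a = c b" if "b \<in> U" "b \<noteq> a \<and> dist b a < \<epsilon> / 2" for b
        using loc[OF a that(1)] that(2) by simp
    qed
  qed
  obtain F where F: "F \<subseteq> (\<lambda>z. ball z (\<epsilon> / 2)) ` U" "countable F" "\<Union>F = \<Union>((\<lambda>z. ball z (\<epsilon> / 2)) ` U)"
    by (rule Lindelof[of "(\<lambda>z. ball z (\<epsilon> / 2)) ` U"]) auto
  have "AE y in lborel. \<forall>B\<in>F. y \<in> B \<and> y \<in> U \<longrightarrow> f y = c z0"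
  proof (rule AE_ball_countable'[OF _ F(2)])
    fix B assume "B \<in> F"
    then obtain z where z: "z \<in> U" "B = ball z (\<epsilon> / 2)" using F(1) by blast
    show "AE y in lborel. y \<in> B \<and> y \<in> U \<longrightarrow> f y = c z0"
      using c[OF z(1)] by eventually_elim (use z const in \<open>auto simp: dist_commute\<close>)
  qed
  then have "AE y in lborel. y \<in> U \<longrightarrow> f y = c z0"
  proof eventually_elim
    case (elim y)
    have "y \<in> \<Union>F" if "y \<in> U" unfolding F(3) using that \<epsilon> by (intro UN_I[of y]) auto
    then show ?case using elim by blast
  qed
  then show ?thesis by blast
qed simp

context classical_billiard
begin

section \<open>Harmonic functions are constant\<close>

lemma nn_integral_indicator_slice:
  assumes i: "i < N" and W: "W \<in> sets borel" "W \<subseteq> {lo T i..<hi T i} \<times> {-1..1}"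
  shows "unnormalized (indicator ({i} \<times> W)) = emeasure lborel W"
proof -
  have "{i} \<times> W \<in> sets borel" using W(1) by (intro borel_Times) auto
  then have m: "indicator ({i} \<times> W) \<in> borel_measurable borel" by simp
  have "unnormalized (indicator ({i} \<times> W)) =
      (\<Sum>k<N. \<integral>\<^sup>+x. indicator ({lo T k..<hi T k} \<times> {-1..1}) x * indicator ({i} \<times> W) (k, x) \<partial>lborel)"
    by (rule unnormalized_plane[OF m])
  also have "\<dots> = (\<Sum>k<N. if k = i then emeasure lborel W else 0)"
  proof (rule sum.cong[OF refl])
    fix k
    have "(\<integral>\<^sup>+x. indicator ({lo T k..<hi T k} \<times> {-1..1}) x * indicator ({i} \<times> W) (k, x) \<partial>lborel) =
      (\<integral>\<^sup>+x. (if k = i then indicator W x else 0) \<partial>lborel)"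
      using W(2) by (intro nn_integral_cong) (auto simp: indicator_def)
    also have "\<dots> = (if k = i then emeasure lborel W else 0)" using W(1) by simp
    finally show "(\<integral>\<^sup>+x. indicator ({lo T k..<hi T k} \<times> {-1..1}) x * indicator ({i} \<times> W) (k, x) \<partial>lborel) =
      (if k = i then emeasure lborel W else 0)" .
  qed
  also have "\<dots> = emeasure lborel W" using i by simp
  finally show ?thesis .
qed

text \<open>Arrival data weighted by the chord density are distributed by \<open>dr ds\<close>, so
  they charge every nonempty open \<open>W\<close>, while the chords that violate \<open>Q\<close>
  form a null set.\<close>

lemma arrivals_dense:
  assumes j: "j < N" and W: "open W" "W \<noteq> {}" "W \<subseteq> {lo T j<..<hi T j} \<times> {-1<..<1}"
    and Q: "\<And>i. i < N \<Longrightarrow> AE p in lborel. chord i (fst p) j (snd p) \<longrightarrow> Q i p"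
  shows "\<exists>i p. i < N \<and> chord i (fst p) j (snd p) \<and> (snd p, - sine j (snd p) i (fst p)) \<in> W \<and> Q i p"
proof (rule ccontr)
  assume none: "\<not> ?thesis"
  have Wb: "W \<in> sets borel" using W(1) by simp
  have "{j} \<times> W \<in> sets borel" using Wb by (intro borel_Times) auto
  then have m: "indicator ({j} \<times> W) \<in> borel_measurable borel" by simp
  have "(\<integral>\<^sup>+p. weight i k p * indicator ({j} \<times> W) (k, snd p, - sine k (snd p) i (fst p)) \<partial>lborel) = 0" if "i < N" for i k
  proof -
    have "(\<integral>\<^sup>+p. weight i k p * indicator ({j} \<times> W) (k, snd p, - sine k (snd p) i (fst p)) \<partial>lborel) = (\<integral>\<^sup>+p. 0 \<partial>(lborel :: plane measure))"
    proof (rule nn_integral_cong_AE)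
      show "AE p in lborel. weight i k p * indicator ({j} \<times> W) (k, snd p, - sine k (snd p) i (fst p)) = 0"
        using Q[OF that]
      proof eventually_elim
        case (elim p)
        then have "(snd p, - sine j (snd p) i (fst p)) \<notin> W" if "chord i (fst p) j (snd p)"
          using none that \<open>i < N\<close> by blast
        then show ?case by (cases "k = j") (auto simp: weight_def indicator_def)
      qed
    qed
    then show ?thesis by simp
  qed
  then have "chord_integral (\<lambda>i r k r'. indicator ({j} \<times> W) (k, r', - sine k r' i r)) = 0"
    unfolding chord_integral_def by simp
  then have "unnormalized (indicator ({j} \<times> W)) = 0" unfolding chord_integral_arrival[OF m] .
  moreover have "W \<subseteq> {lo T j..<hi T j} \<times> {-1..1}" using W(3) by force
  ultimately have "emeasure lborel W = 0" using nn_integral_indicator_slice[OF j Wb] by simp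
  then have "W \<in> null_sets lborel" using Wb by (intro null_setsI) auto
  then have "AE x in lborel. x \<notin> W" by (rule AE_not_in)
  from AE_open_ex[OF W(1,2) this] show False by blast
qed

context
  fixes \<rho> :: "plane \<Rightarrow> real" and \<epsilon> :: real and P :: "collision \<Rightarrow> collision measure" and k :: "collision \<Rightarrow> real"
  assumes \<rho>m: "\<rho> \<in> borel_measurable borel" and \<epsilon>: "0 < \<epsilon>"
    and pos: "\<And>u. u \<in> ball (0, 0) \<epsilon> \<Longrightarrow> 0 < \<rho> u"
    and rb: "random_billiard T (density lborel (\<lambda>u. ennreal (\<rho> u))) P"
    and km: "k \<in> borel_measurable (collision_space T)"
    and harmonic: "AE x in billiard_measure T. AE y in P x. k y = k x"
begin

text \<open>The next state charges every set of positive measure near the image under the billiard map.\<close>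

lemma const_near_arrival:
  assumes ij: "i < N" "j < N"
  shows "AE p in lborel. chord i (fst p) j (snd p) \<longrightarrow>
    (AE y in lborel. dist y (snd p, - sine j (snd p) i (fst p)) < \<epsilon> \<and> (j, y) \<in> collisions T \<longrightarrow>
      k (j, y) = k (i, fst p, sine i (fst p) j (snd p)))"
proof -
  let ?\<nu> = "density lborel (\<lambda>u. ennreal (\<rho> u))"
  have "AE x in billiard_measure T. \<forall>B\<in>sets (collision_space T). emeasure (P x) B = noise T ?\<nu> (billiard_map T x) B"
    using rb by (simp add: random_billiard_def)
  with harmonic have "AE x in billiard_measure T. (AE y in P x. k y = k x) \<and>
      (\<forall>B\<in>sets (collision_space T). emeasure (P x) B = noise T ?\<nu> (billiard_map T x) B)"
    by eventually_elim simp
  from AE_chord_departure[OF this ij] show ?thesis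
  proof eventually_elim
    case (elim p)
    show ?case
    proof
      assume c: "chord i (fst p) j (snd p)"
      define x where "x = (i, fst p, sine i (fst p) j (snd p))"
      define z where "z = (snd p, - sine j (snd p) i (fst p))"
      have harm: "AE y in P x. k y = k x"
        and Px: "\<And>B. B \<in> sets (collision_space T) \<Longrightarrow> emeasure (P x) B = noise T ?\<nu> (billiard_map T x) B"
        using elim c unfolding x_def by auto
      have Fx: "billiard_map T x = (j, z)" unfolding x_def z_def by (rule next_collision_chord[OF c])
      have xC: "x \<in> space (collision_space T)" unfolding x_def space_collision_space by (rule chord_collision[OF c])
      have Pm: "P \<in> collision_space T \<rightarrow>\<^sub>M subprob_algebra (collision_space T)"
        using rb unfolding random_billiard_def markov_kernel_def by (intro measurable_prob_algebraD) simp
      have sP: "sets (P x) = sets (collision_space T)" by (rule subprob_measurableD(2)[OF Pm xC])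
      define B where "B = {y \<in> collisions T. k y \<noteq> k x}"
      have Bs: "B \<in> sets (collision_space T)"
      proof -
        have "{y \<in> space (collision_space T). k y \<noteq> k x} \<in> sets (collision_space T)"
          using km by measurable
        then show ?thesis by (simp add: B_def space_collision_space)
      qed
      then have Bb: "B \<in> sets borel" by (simp add: sets_collision_space)
      have "{y \<in> space (P x). \<not> k y = k x} = B"
        unfolding B_def sets_eq_imp_space_eq[OF sP] space_collision_space ..
      then have "emeasure (P x) B = 0"
        using harm AE_iff_measurable[of B "P x" "\<lambda>y. k y = k x"] Bs sP by simp
      then have n0: "noise T ?\<nu> (j, z) B = 0" using Px[OF Bs] Fx by simp
      \<comment> \<open>The displacements in the ball where \<open>\<rho>\<close> is positive that
        lead to a state with a different value of \<open>k\<close>.\<close>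
      define A where "A = {u \<in> ball (0, 0) \<epsilon>. (j, z + u) \<in> B}"
      have shift: "(\<lambda>u. z + u) \<in> borel_measurable borel" by (intro borel_measurable_continuous_onI continuous_intros)
      have "(\<lambda>u. z + u) -` {y. (j, y) \<in> B} \<inter> space borel \<in> sets borel"
        by (rule measurable_sets[OF shift sets_slice[OF Bb]])
      then have "(\<lambda>u. z + u) -` {y. (j, y) \<in> B} \<inter> ball (0, 0) \<epsilon> \<in> sets borel" by auto
      also have "(\<lambda>u. z + u) -` {y. (j, y) \<in> B} \<inter> ball (0, 0) \<epsilon> = A" by (auto simp: A_def)
      finally have Ab: "A \<in> sets borel" .
      have "(\<integral>\<^sup>+u. ennreal (\<rho> u) * indicator A u \<partial>lborel) \<le> (\<integral>\<^sup>+u. ennreal (\<rho> u) * indicator (wrapped B j) (u + z) \<partial>lborel)"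
      proof (intro nn_integral_mono mult_left_mono)
        fix u
        have "u + z \<in> wrapped B j" if "u \<in> A"
        proof -
          \<comment> \<open>The zero lattice vector suffices, as \<open>u + z\<close> already lies
            in the rectangle.\<close>
          have "(j, (u + z) + lattice_vector (hi T j - lo T j) (0, 0)) \<in> B"
            using that by (simp add: A_def lattice_vector_def add.commute zero_prod_def[symmetric])
          then show ?thesis unfolding wrapped_def by blast
        qed
        then show "indicator A u \<le> (indicator (wrapped B j) (u + z) :: ennreal)" by (auto simp: indicator_def)
      qed simp
      also have "\<dots> = 0" using n0 noise_eq[OF \<rho>m Bb] by simp
      finally have "(\<integral>\<^sup>+u. ennreal (\<rho> u) * indicator A u \<partial>lborel) = 0" by simp
      then have "AE u in lborel. ennreal (\<rho> u) * indicator A u = 0"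
        using \<rho>m Ab by (subst (asm) nn_integral_0_iff_AE) auto
      then have "AE u in lborel. u \<notin> A"
      proof eventually_elim
        case (elim u)
        show ?case
        proof
          assume "u \<in> A"
          then have "0 < \<rho> u" using pos by (simp add: A_def)
          then show False using elim \<open>u \<in> A\<close> by simp
        qed
      qed
      then have "A \<in> null_sets lborel" using Ab by (subst AE_iff_null_sets) auto
      then have A0: "(\<integral>\<^sup>+u. indicator A u \<partial>lborel) = 0" using Ab by (simp add: null_setsD1)
      define A' where "A' = {y. dist y z < \<epsilon> \<and> (j, y) \<in> B}"
      have "A' = ball z \<epsilon> \<inter> {y. (j, y) \<in> B}" by (auto simp: A'_def dist_commute)
      then have A'b: "A' \<in> sets borel" using sets_slice[OF Bb] by auto
      then have "indicator A' \<in> borel_measurable borel" by simp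
      from nn_integral_lborel_translation[OF this, of z]
      have "(\<integral>\<^sup>+y. indicator A' y \<partial>lborel) = (\<integral>\<^sup>+u. indicator A' (z + u) \<partial>lborel)" by simp
      also have "\<dots> = (\<integral>\<^sup>+u. indicator A u \<partial>lborel)"
        by (intro nn_integral_cong) (auto simp: A'_def A_def indicator_def dist_norm zero_prod_def[symmetric])
      finally have "emeasure lborel A' = 0" using A0 A'b by simp
      then have "A' \<in> null_sets lborel" using A'b by (intro null_setsI) auto
      then have "AE y in lborel. y \<notin> A'" by (rule AE_not_in)
      then show "AE y in lborel. dist y (snd p, - sine j (snd p) i (fst p)) < \<epsilon> \<and> (j, y) \<in> collisions T \<longrightarrow>
          k (j, y) = k (i, fst p, sine i (fst p) j (snd p))"
        unfolding z_def[symmetric] x_def[symmetric]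
        by eventually_elim (auto simp: A'_def B_def)
    qed
  qed
qed

text \<open>Arrival points of typical chords are dense in the component, and around each of them
  \<open>k\<close> is constant at the uniform radius \<open>\<epsilon>\<close>; the open rectangle
  is connected.\<close>

lemma const_on_component:
  assumes j: "j < N"
  shows "\<exists>c. AE y in lborel. y \<in> {lo T j<..<hi T j} \<times> {-1<..<1} \<longrightarrow> k (j, y) = c"
proof (rule AE_const_of_local[OF _ _ \<epsilon>])
  let ?U = "{lo T j<..<hi T j} \<times> {-1<..<1::real}"
  show "open ?U" by (intro open_Times) auto
  show "connected ?U" by (intro convex_connected convex_Times) auto
  have UC: "(j, y) \<in> collisions T" if "y \<in> ?U" for y using that j by (auto simp: collisions_def)
  fix W assume W: "open W" "W \<subseteq> ?U" "W \<noteq> {}"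
  obtain i p where ip: "(snd p, - sine j (snd p) i (fst p)) \<in> W"
    "AE y in lborel. dist y (snd p, - sine j (snd p) i (fst p)) < \<epsilon> \<and> (j, y) \<in> collisions T \<longrightarrow>
      k (j, y) = k (i, fst p, sine i (fst p) j (snd p))"
    using arrivals_dense[OF j W(1,3,2) const_near_arrival[OF _ j]] by blast
  have "AE y in lborel. dist y (snd p, - sine j (snd p) i (fst p)) < \<epsilon> \<and> y \<in> ?U \<longrightarrow>
      k (j, y) = k (i, fst p, sine i (fst p) j (snd p))"
    using ip(2) by eventually_elim (use UC in blast)
  then show "\<exists>z\<in>W. \<exists>c. AE y in lborel. dist y z < \<epsilon> \<and> y \<in> ?U \<longrightarrow> k (j, y) = c"
    using ip(1) by blast
qed

text \<open>The constants \<open>c j\<close> on the components form a colouring of the curves that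
  agrees along chords, so \<open>colour_const\<close> identifies them.\<close>

lemma harmonic_const: "\<exists>c. AE x in billiard_measure T. k x = c"
proof -
  let ?U = "\<lambda>j. {lo T j<..<hi T j} \<times> {-1<..<1::real}"
  have "\<forall>j\<in>{..<N}. \<exists>c. AE y in lborel. y \<in> ?U j \<longrightarrow> k (j, y) = c"
    using const_on_component by simp
  from bchoice[OF this] obtain c where "\<forall>j\<in>{..<N}. AE y in lborel. y \<in> ?U j \<longrightarrow> k (j, y) = c j" ..
  then have c: "AE y in lborel. y \<in> ?U j \<longrightarrow> k (j, y) = c j" if "j < N" for j
    by (rule bspec) (use that in simp)
  define bad where "bad = {x \<in> collisions T. k x \<noteq> c (fst x)}"
  have badb: "bad \<in> sets borel" "bad \<in> sets (collision_space T)"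
  proof -
    have "(\<lambda>x. c (fst x)) \<in> borel_measurable (collision_space T)"
    proof -
      have "fst \<in> collision_space T \<rightarrow>\<^sub>M count_space (UNIV :: nat set)"
        unfolding collision_space_def
        by (subst measurable_cong_sets[OF refl sets_borel_eq_count_space[symmetric]])
          (intro measurable_restrict_space1 borel_measurable_continuous_onI continuous_intros)
      then show ?thesis by (rule measurable_compose) simp
    qed
    then have "{x \<in> space (collision_space T). k x \<noteq> c (fst x)} \<in> sets (collision_space T)"
      using km by measurable
    then show "bad \<in> sets (collision_space T)" by (simp add: bad_def space_collision_space)
    then show "bad \<in> sets borel" by (simp add: sets_collision_space)
  qed
  have ind: "indicator bad \<in> borel_measurable borel" using badb by simp
  have "(\<integral>\<^sup>+x. indicator ({lo T i..<hi T i} \<times> {-1..1}) x * indicator bad (i, x) \<partial>lborel) = (\<integral>\<^sup>+x. 0 \<partial>(lborel :: plane measure))"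
    if i: "i < N" for i
  proof (rule nn_integral_cong_AE)
    show "AE x in lborel. indicator ({lo T i..<hi T i} \<times> {-1..1}) x * indicator bad (i, x) = (0 :: ennreal)"
      using c[OF i] AE_coordinates(1)[of "lo T i"] AE_coordinates(2)[of 1] AE_coordinates(2)[of "-1"]
    proof eventually_elim
      case (elim x)
      have "(i, x) \<notin> bad" if "x \<in> {lo T i..<hi T i} \<times> {-1..1}"
      proof -
        have "x \<in> ?U i" using that elim(2-4) by (cases x) force
        then show ?thesis using elim(1) by (simp add: bad_def)
      qed
      then show ?case by (auto simp: indicator_def)
    qed
  qed
  then have "unnormalized (indicator bad) = 0"
    unfolding unnormalized_plane[OF ind] by (intro sum.neutral) auto
  then have "(\<integral>\<^sup>+x. indicator bad x \<partial>billiard_measure T) = 0"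
    unfolding nn_integral_billiard_measure[OF ind] by simp
  then have "bad \<in> null_sets (billiard_measure T)"
    using badb(2) by (intro null_setsI) (simp_all add: sets_billiard_measure)
  then have "AE x in billiard_measure T. x \<notin> bad" by (rule AE_not_in)
  moreover have inC: "AE x in billiard_measure T. x \<in> collisions T"
    using AE_space[of "billiard_measure T"] by (simp add: space_billiard_measure)
  ultimately have kc: "AE x in billiard_measure T. k x = c (fst x)"
    by eventually_elim (simp add: bad_def)
  \<comment> \<open>The chords from curve \<open>i\<close> to curve \<open>j\<close> form an open
    set, so one chord yields a typical one. It starts at a state with value \<open>c i\<close>, and
    \<open>k\<close> keeps this value almost everywhere near the arrival, on an open set of
    component \<open>j\<close> where \<open>k\<close> is also almost everywhere
    \<open>c j\<close>.\<close>
  have chord_colour: "c i = c j" if ch: "chord i r j r'" for i r j r'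
  proof -
    have ij: "i < N" "j < N" using ch nice_bounds by (auto simp: chord_def)
    define Q where "Q p \<longleftrightarrow> k (i, fst p, sine i (fst p) j (snd p)) = c i \<and>
      (AE y in lborel. dist y (snd p, - sine j (snd p) i (fst p)) < \<epsilon> \<and> (j, y) \<in> collisions T \<longrightarrow>
        k (j, y) = k (i, fst p, sine i (fst p) j (snd p)))" for p
    have "AE p in lborel. chord i (fst p) j (snd p) \<longrightarrow> Q p"
      using AE_chord_departure[OF kc ij] const_near_arrival[OF ij] by eventually_elim (simp add: Q_def)
    moreover have "{p. chord i (fst p) j (snd p)} \<noteq> {}"
    proof -
      have "(r, r') \<in> {p. chord i (fst p) j (snd p)}" using ch by simp
      then show ?thesis by blast
    qed
    ultimately obtain p where "chord i (fst p) j (snd p)" "Q p"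
      using AE_open_ex[OF open_chord, of i j] by blast
    then have p: "chord i (fst p) j (snd p)" "k (i, fst p, sine i (fst p) j (snd p)) = c i"
      "AE y in lborel. dist y (snd p, - sine j (snd p) i (fst p)) < \<epsilon> \<and> (j, y) \<in> collisions T \<longrightarrow>
        k (j, y) = k (i, fst p, sine i (fst p) j (snd p))"
      unfolding Q_def by blast+
    define z where "z = (snd p, - sine j (snd p) i (fst p))"
    have rev: "chord j (snd p) i (fst p)" using p(1) by (rule chord_sym_imp)
    have zU: "z \<in> ?U j"
      using chord_velocity(2,3)[OF rev] nice_bounds[of j "snd p"] rev by (auto simp: z_def chord_def)
    have "open (?U j \<inter> ball z \<epsilon>)" by (intro open_Int open_Times) auto
    moreover have "?U j \<inter> ball z \<epsilon> \<noteq> {}" using zU \<epsilon> by auto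
    moreover have "AE y in lborel. (dist y z < \<epsilon> \<and> (j, y) \<in> collisions T \<longrightarrow> k (j, y) = c i) \<and> (y \<in> ?U j \<longrightarrow> k (j, y) = c j)"
      using p(3) c[OF ij(2)] unfolding z_def[symmetric] p(2) by eventually_elim simp
    ultimately obtain y where y: "y \<in> ?U j \<inter> ball z \<epsilon>"
      "(dist y z < \<epsilon> \<and> (j, y) \<in> collisions T \<longrightarrow> k (j, y) = c i) \<and> (y \<in> ?U j \<longrightarrow> k (j, y) = c j)"
      using AE_open_ex by blast
    have "(j, y) \<in> collisions T" using y(1) ij by (auto simp: collisions_def)
    then show ?thesis using y by (simp add: dist_commute)
  qed
  have "AE x in billiard_measure T. k x = c 0"
    using kc inC
  proof eventually_elim
    case (elim x)
    have "fst x < N" using elim(2) by (auto simp: collisions_def)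
    moreover have "0 < N" using N_pos by simp
    ultimately have "c (fst x) = c 0" by (rule colour_const[where c=c, rotated]) (rule chord_colour)
    with elim(1) show ?case by (rule trans)
  qed
  then show ?thesis by blast
qed

end

end

theorem theorem4p6:
  fixes T :: billiard_table and \<epsilon> :: real and \<rho> :: "plane \<Rightarrow> real"
    and P :: "collision \<Rightarrow> collision measure"
  assumes "classical_table T"
    and "0 < \<epsilon>"
    and "\<rho> \<in> borel_measurable borel"
    and "\<And>u. 0 \<le> \<rho> u"
    and "prob_space (density lborel (\<lambda>u. ennreal (\<rho> u)))"
    and "\<And>u. u \<in> ball (0, 0) \<epsilon> \<Longrightarrow> 0 < \<rho> u"
    and "random_billiard T (density lborel (\<lambda>u. ennreal (\<rho> u))) P"
  shows "ergodic_measure (collision_space T) P (billiard_measure T)"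
proof -
  interpret classical_billiard T by unfold_locales fact
  have "markov_kernel (collision_space T) P"
    using assms(7) by (simp add: random_billiard_def)
  then interpret markov_process "collision_space T" P "billiard_measure T"
    by (rule markov_process.intro[OF _ prob_space_billiard_measure sets_billiard_measure])
  show ?thesis
  proof (rule ergodicI)
    show "invariant_measure (collision_space T) P (billiard_measure T)"
      by (rule random_billiard_invariant[OF assms(3,5,7)])
    show "\<exists>c. AE x in billiard_measure T. k x = c"
      if "k \<in> borel_measurable (collision_space T)" "AE x in billiard_measure T. AE y in P x. k y = k x"
      for k :: "collision \<Rightarrow> real"
      by (rule harmonic_const[OF assms(3,2,6,7) that])
  qed
qed

end
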